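(* Let $\Gamma=\langle v_0,v_1,\ldots,v_g\rangle$ be the semigroup of values of a plane branch, with conductor $c$, and let $\mathcal E\subset\mathbb C^{c-v_1-1}$ be the constructible set parametrizing its equisingularity class, i.e. the set of coefficient vectors $(c_{v_1+1},\ldots,c_{c-1})$ such that the branch $x=t^{v_0},\ y=t^{v_1}+\sum_{i=v_1+1}^{c-1}c_it^i$ has semigroup $\Gamma$. Let $\mathcal E_\ell\subset\mathcal E$ be the (constructible) subset consisting of those points whose corresponding branch has a prescribed set $\Lambda_\ell$ of values of K\"ahler differentials. Then on each irreducible component of $\mathcal E_\ell$ there is a Zariski open dense subset on which the equisingularity class of the general polar of the corresponding curves is constant.
   Context: For a reduced germ $f\in\mathbb C\{x,y\}$ with $f(0,0)=0$, the polar of $f$ in the direction $(a:b)\in\mathbb P^1_{\mathbb C}$ is the germ $af_x+bf_y=0$; except for finitely many directions it is reduced and its equisingularity class (class under germs of homeomorphisms of $(\mathbb C^2,0)$) is independent of $(a:b)$, and this is called the equisingularity class of the general polar of $f$. The set $\Lambda$ of values of K\"ahler differentials of a branch $\mathcal C$ with parametrization $(x(t),y(t))$ is the set of $t$-orders (plus one, i.e. values $\mathrm{ord}_t(\omega(t)/dt)+1$) of the pullbacks $\omega(t)$ of holomorphic $1$-forms $\omega=A\,dx+B\,dy$ to the normalization; it is an analytic invariant and contains $\Gamma\setminus\{0\}$. The sets $\mathcal E_\ell$ (finitely many) partition $\mathcal E$. *)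

theory Defs
  imports "HOL-Analysis.Analysis"
begin

text \<open>A convergent power series in two variables (an element of C{x,y}), represented by
  its sum function near the origin.\<close>
definition conv2 :: "(complex \<times> complex \<Rightarrow> complex) \<Rightarrow> bool" where
  "conv2 F \<longleftrightarrow> (\<exists>(a :: nat \<times> nat \<Rightarrow> complex) r. r > 0 \<and>
     (\<forall>x y. cmod x < r \<and> cmod y < r \<longrightarrow>
        ((\<lambda>(m,n). a (m,n) * x ^ m * y ^ n) has_sum F (x, y)) UNIV))"

definition ord0 :: "(complex \<Rightarrow> complex) \<Rightarrow> nat \<Rightarrow> bool" where
  "ord0 g n \<longleftrightarrow> (\<exists>h. h analytic_on {0} \<and> h 0 \<noteq> 0 \<and>
      eventually (\<lambda>t. g t = t ^ n * h t) (nhds 0))"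

definition value_semigroup :: "(complex \<Rightarrow> complex) \<Rightarrow> (complex \<Rightarrow> complex) \<Rightarrow> nat set" where
  "value_semigroup X Y = {n. \<exists>F. conv2 F \<and> ord0 (\<lambda>t. F (X t, Y t)) n}"

text \<open>Values of Kaehler differentials: ord_t(omega(t)/dt) + 1 for omega = A dx + B dy.\<close>
definition kahler_values :: "(complex \<Rightarrow> complex) \<Rightarrow> (complex \<Rightarrow> complex) \<Rightarrow> nat set" where
  "kahler_values X Y = {Suc n | n. \<exists>A B. conv2 A \<and> conv2 B \<and>
      ord0 (\<lambda>t. A (X t, Y t) * deriv X t + B (X t, Y t) * deriv Y t) n}"

definition is_branch_param :: "(complex \<Rightarrow> complex) \<Rightarrow> (complex \<Rightarrow> complex) \<Rightarrow> bool" where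
  "is_branch_param X Y \<longleftrightarrow> X analytic_on {0} \<and> Y analytic_on {0} \<and> X 0 = 0 \<and> Y 0 = 0"

text \<open>The normal-form branch x = t^v0, y = t^v1 + sum_{j<N} z_j t^(v1+1+j),
  where z_j is the coefficient c_{v1+1+j}.\<close>
definition bx :: "nat \<Rightarrow> complex \<Rightarrow> complex" where
  "bx v0 t = t ^ v0"

definition byp :: "nat \<Rightarrow> nat \<Rightarrow> (nat \<Rightarrow> complex) \<Rightarrow> complex \<Rightarrow> complex" where
  "byp v1 N z t = t ^ v1 + (\<Sum>j<N. z j * t ^ (v1 + 1 + j))"

definition sg_v0 :: "nat set \<Rightarrow> nat" where
  "sg_v0 G = (LEAST n. n \<in> G \<and> n > 0)"

definition sg_v1 :: "nat set \<Rightarrow> nat" where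
  "sg_v1 G = (LEAST n. n \<in> G \<and> \<not> sg_v0 G dvd n)"

definition conductor :: "nat set \<Rightarrow> nat" where
  "conductor G = (LEAST c. \<forall>n\<ge>c. n \<in> G)"

definition sg_dim :: "nat set \<Rightarrow> nat" where
  "sg_dim G = conductor G - sg_v1 G - 1"

definition aff :: "nat \<Rightarrow> (nat \<Rightarrow> complex) set" where
  "aff N = {z. \<forall>i\<ge>N. z i = 0}"

definition poly_fun :: "nat \<Rightarrow> ((nat \<Rightarrow> complex) \<Rightarrow> complex) \<Rightarrow> bool" where
  "poly_fun N p \<longleftrightarrow> (\<exists>(A :: (nat \<Rightarrow> nat) set) coef. finite A \<and>
     (\<forall>\<alpha>\<in>A. \<forall>i\<ge>N. \<alpha> i = 0) \<and>
     p = (\<lambda>z. \<Sum>\<alpha>\<in>A. coef \<alpha> * (\<Prod>i<N. z i ^ \<alpha> i)))"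

definition zclosed :: "nat \<Rightarrow> (nat \<Rightarrow> complex) set \<Rightarrow> bool" where
  "zclosed N S \<longleftrightarrow> (\<exists>P. (\<forall>p\<in>P. poly_fun N p) \<and> S = {z \<in> aff N. \<forall>p\<in>P. p z = 0})"

definition zirreducible :: "nat \<Rightarrow> (nat \<Rightarrow> complex) set \<Rightarrow> bool" where
  "zirreducible N Z \<longleftrightarrow> Z \<noteq> {} \<and> Z \<subseteq> aff N \<and>
     (\<forall>F G. zclosed N F \<and> zclosed N G \<and> Z \<subseteq> F \<union> G \<longrightarrow> Z \<subseteq> F \<or> Z \<subseteq> G)"

definition zirreducible_component :: "nat \<Rightarrow> (nat \<Rightarrow> complex) set \<Rightarrow> (nat \<Rightarrow> complex) set \<Rightarrow> bool" where
  "zirreducible_component N E Z \<longleftrightarrow> Z \<subseteq> E \<and> zirreducible N Z \<and>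
     (\<forall>Z'. Z \<subseteq> Z' \<and> Z' \<subseteq> E \<and> zirreducible N Z' \<longrightarrow> Z' = Z)"

definition zopen_in :: "nat \<Rightarrow> (nat \<Rightarrow> complex) set \<Rightarrow> (nat \<Rightarrow> complex) set \<Rightarrow> bool" where
  "zopen_in N Z U \<longleftrightarrow> (\<exists>F. zclosed N F \<and> U = Z - F)"

definition zdense_in :: "nat \<Rightarrow> (nat \<Rightarrow> complex) set \<Rightarrow> (nat \<Rightarrow> complex) set \<Rightarrow> bool" where
  "zdense_in N Z U \<longleftrightarrow> (\<forall>F. zclosed N F \<and> U \<subseteq> F \<longrightarrow> Z \<subseteq> F)"

definition eq_class_set :: "nat set \<Rightarrow> (nat \<Rightarrow> complex) set" where
  "eq_class_set G = {z \<in> aff (sg_dim G).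
     value_semigroup (bx (sg_v0 G)) (byp (sg_v1 G) (sg_dim G) z) = G}"

definition eq_class_set_kahler :: "nat set \<Rightarrow> nat set \<Rightarrow> (nat \<Rightarrow> complex) set" where
  "eq_class_set_kahler G L = {z \<in> eq_class_set G.
     kahler_values (bx (sg_v0 G)) (byp (sg_v1 G) (sg_dim G) z) = L}"

definition weierstrass_eq :: "nat \<Rightarrow> (complex \<Rightarrow> complex) \<Rightarrow> (complex \<Rightarrow> complex)
    \<Rightarrow> (complex \<times> complex \<Rightarrow> complex) \<Rightarrow> bool" where
  "weierstrass_eq n X Y f \<longleftrightarrow> (\<exists>a :: nat \<Rightarrow> complex \<Rightarrow> complex.
     (\<forall>k<n. a k analytic_on {0} \<and> a k 0 = 0) \<and>
     f = (\<lambda>(x, y). y ^ n + (\<Sum>k<n. a k x * y ^ k)) \<and>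
     eventually (\<lambda>t. f (X t, Y t) = 0) (nhds 0))"

definition polar :: "(complex \<times> complex \<Rightarrow> complex) \<Rightarrow> complex \<Rightarrow> complex
    \<Rightarrow> (complex \<times> complex \<Rightarrow> complex)" where
  "polar f a b = (\<lambda>(x, y). a * deriv (\<lambda>s. f (s, y)) x + b * deriv (\<lambda>s. f (x, s)) y)"

text \<open>Equisingularity (topological equivalence) of the germs at 0 of the zero sets.\<close>
definition top_equiv :: "(complex \<times> complex \<Rightarrow> complex) \<Rightarrow> (complex \<times> complex \<Rightarrow> complex) \<Rightarrow> bool" where
  "top_equiv g h \<longleftrightarrow> (\<exists>U V \<phi> \<psi>. open U \<and> open V \<and> (0,0) \<in> U \<and>
     homeomorphism U V \<phi> \<psi> \<and> \<phi> (0,0) = (0,0) \<and>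
     \<phi> ` (U \<inter> {p. g p = 0}) = V \<inter> {p. h p = 0})"

text \<open>P holds for all directions (a:b) in P^1 outside a finite set.\<close>
definition general_dir :: "(complex \<Rightarrow> complex \<Rightarrow> bool) \<Rightarrow> bool" where
  "general_dir P \<longleftrightarrow> (\<exists>D. finite D \<and> (\<forall>(c,d)\<in>D. (c,d) \<noteq> (0,0)) \<and>
     (\<forall>a b. (a,b) \<noteq> (0,0) \<and> (\<forall>(c,d)\<in>D. a * d - b * c \<noteq> 0) \<longrightarrow> P a b))"

definition same_general_polar_class :: "(complex \<times> complex \<Rightarrow> complex) \<Rightarrow> (complex \<times> complex \<Rightarrow> complex) \<Rightarrow> bool" where
  "same_general_polar_class f g \<longleftrightarrow>
     general_dir (\<lambda>a b. general_dir (\<lambda>a' b'. top_equiv (polar f a b) (polar g a' b')))"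

end

theory Submission
  imports Defs "HOL-Complex_Analysis.Complex_Analysis" "HOL-Computational_Algebra.Fundamental_Theorem_Algebra"
begin

text \<open>For a fixed coefficient vector the polar of slope \<open>l\<close> is, up to a unit, a monic polynomial in \<open>y\<close>
  whose coefficients are power series in \<open>x\<close> depending polynomially on the coefficient vector and on \<open>l\<close>.
  Its Puiseux roots are power series in \<open>x\<^sup>1\<^sup>/\<^sup>L\<close> with \<open>L\<close> depending on the degree only.

  The orders of contact of the roots are the digits, to a large base, of the least order of a weighted product of
  root differences over all selections of roots, and this least order is detected by the power sums of the products.
  These sums are polynomials in the power sums of the roots, hence power series in \<open>x\<close>
  with coefficients polynomial in the parameters, and such a series has constant order on a nonempty Zariski
  open subset of an irreducible set. So for generic parameters the contact orders agree up to a bijection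
  of the roots.

  A bijection preserving contact orders can be replaced by one that is also equivariant under the monodromy:
  induct over the tree of contacts, matching the branches at a node one orbit at a time.

  Given such an equivariant bijection, the affine combinations of corresponding roots, with a complex
  parameter avoiding finitely many values, form a family with constant contact orders. For nearby
  parameters the displacement of the roots is Lipschitz with a small constant on every fibre, so its
  McShane extension perturbs the identity to an injective continuous map, which is a homeomorphism
  by invariance of domain.\<close>

section \<open>Polynomials with given roots\<close>

definition poly_of_roots :: "'a::comm_ring_1 multiset \<Rightarrow> 'a poly" where
  "poly_of_roots A = (\<Prod>a\<in>#A. [:- a, 1:])"

lemma poly_of_roots_empty [simp]: "poly_of_roots {#} = 1"
  by (simp add: poly_of_roots_def)

lemma poly_of_roots_add_mset [simp]: "poly_of_roots (add_mset a A) = [:- a, 1:] * poly_of_roots A"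
  by (simp add: poly_of_roots_def)

lemma poly_of_roots_union [simp]: "poly_of_roots (A + B) = poly_of_roots A * poly_of_roots B"
  by (simp add: poly_of_roots_def)

lemma poly_poly_of_roots: "poly (poly_of_roots A) x = (\<Prod>a\<in>#A. x - a)"
  by (simp add: poly_of_roots_def poly_prod_mset)

lemma poly_poly_of_roots_eq_0_iff:
  fixes A :: "'a::idom multiset"
  shows "poly (poly_of_roots A) x = 0 \<longleftrightarrow> x \<in># A"
  by (auto simp: poly_poly_of_roots)

lemma lead_coeff_poly_of_roots:
  fixes A :: "'a::idom multiset"
  shows "lead_coeff (poly_of_roots A) = 1"
proof (induction A)
  case (add a A)
  have "lead_coeff (poly_of_roots (add_mset a A)) = lead_coeff [:- a, 1:] * lead_coeff (poly_of_roots A)"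
    unfolding poly_of_roots_add_mset by (rule lead_coeff_mult)
  then show ?case unfolding add.IH by simp
qed simp

lemma poly_of_roots_nonzero [simp]: "poly_of_roots A \<noteq> 0" for A :: "'a::idom multiset"
  using lead_coeff_poly_of_roots[of A] by auto

lemma degree_poly_of_roots [simp]: "degree (poly_of_roots A) = size A" for A :: "'a::idom multiset"
  by (induction A) (simp_all add: degree_mult_eq del: mult_pCons_left)

lemma monic_polyI:
  fixes p :: "'a::comm_semiring_1 poly"
  assumes "coeff p n = 1" "\<And>k. k > n \<Longrightarrow> coeff p k = 0"
  shows "degree p = n" "lead_coeff p = 1"
proof -
  have "degree p \<le> n" using assms(2) by (blast intro: degree_le)
  moreover have "n \<le> degree p" by (rule le_degree) (simp add: assms(1))
  ultimately show "degree p = n" by (rule antisym)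
  with assms(1) show "lead_coeff p = 1" by simp
qed

lemma complex_monic_eq_poly_of_roots:
  fixes p :: "complex poly"
  assumes "lead_coeff p = 1"
  obtains A where "p = poly_of_roots A"
proof -
  have "p \<noteq> 0" using assms by auto
  then obtain A where "p = smult (lead_coeff p) (\<Prod>a\<in>#A. [:- a, 1:])"
    using alg_closed_imp_factorization by blast
  then have "p = poly_of_roots A" using assms by (simp add: poly_of_roots_def)
  then show ?thesis by (rule that)
qed

lemma monic_eq_poly_of_distinct_roots:
  fixes p :: "'a::idom poly"
  assumes "lead_coeff p = 1" "finite I" "degree p = card I" "inj_on y I" "\<And>i. i \<in> I \<Longrightarrow> poly p (y i) = 0"
  shows "p = poly_of_roots (image_mset y (mset_set I))"
proof (rule ccontr)
  define q where "q = poly_of_roots (image_mset y (mset_set I))"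
  define d where "d = p - q"
  assume "p \<noteq> poly_of_roots (image_mset y (mset_set I))"
  then have "d \<noteq> 0" by (simp add: d_def q_def)
  have "degree q = card I" "lead_coeff q = 1"
    using lead_coeff_poly_of_roots[of "image_mset y (mset_set I)"] by (simp_all add: q_def)
  then have "coeff d (card I) = 0" "degree d \<le> card I"
    using assms(1,3) by (simp_all add: d_def degree_diff_le)
  then have "degree d < card I"
    using \<open>d \<noteq> 0\<close> by (metis le_neq_implies_less leading_coeff_0_iff)
  moreover have "card (y ` I) \<le> card {x. poly d x = 0}"
  proof (rule card_mono)
    show "finite {x. poly d x = 0}" using \<open>d \<noteq> 0\<close> by (rule poly_roots_finite)
    show "y ` I \<subseteq> {x. poly d x = 0}"
      using assms(2,5) poly_poly_of_roots_eq_0_iff[of "image_mset y (mset_set I)"] by (auto simp: d_def q_def)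
  qed
  ultimately show False
    using card_poly_roots_bound[OF \<open>d \<noteq> 0\<close>] card_image[OF assms(4)] by simp
qed

lemma coeff_poly_of_roots_scale:
  "coeff (poly_of_roots (image_mset ((*) u) A)) k * u ^ k = u ^ size A * coeff (poly_of_roots A) k"
proof (induction A arbitrary: k)
  case (add a A)
  then show ?case
  proof (cases k)
    case (Suc j)
    have "coeff (poly_of_roots (image_mset ((*) u) (add_mset a A))) k * u ^ k
        = u * (coeff (poly_of_roots (image_mset ((*) u) A)) j * u ^ j)
          - u * a * (coeff (poly_of_roots (image_mset ((*) u) A)) k * u ^ k)"
      by (simp add: Suc algebra_simps)
    also have "\<dots> = u ^ size (add_mset a A) * coeff (poly_of_roots (add_mset a A)) k"
      unfolding add.IH by (simp add: Suc algebra_simps)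
    finally show ?thesis .
  qed (use add.IH[of 0] in \<open>simp add: mult_ac\<close>)
qed (simp add: coeff_1)

lemma poly_logarithmic_derivative:
  fixes A :: "'a::field multiset"
  assumes "y \<notin># A"
  shows "poly (pderiv (poly_of_roots A)) y / poly (poly_of_roots A) y = (\<Sum>a\<in>#A. 1 / (y - a))"
  using assms
proof (induction A)
  case (add a A)
  have nonzero: "y - a \<noteq> 0" "poly (poly_of_roots A) y \<noteq> 0"
    using add.prems poly_poly_of_roots_eq_0_iff[of A y] by auto
  have "poly (pderiv (poly_of_roots (add_mset a A))) y
      = poly (poly_of_roots A) y + (y - a) * poly (pderiv (poly_of_roots A)) y"
    unfolding poly_of_roots_add_mset pderiv_mult poly_add poly_mult by (simp add: pderiv_pCons)
  moreover have "poly (poly_of_roots (add_mset a A)) y = (y - a) * poly (poly_of_roots A) y"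
    unfolding poly_of_roots_add_mset poly_mult by simp
  ultimately have "poly (pderiv (poly_of_roots (add_mset a A))) y / poly (poly_of_roots (add_mset a A)) y
      = 1 / (y - a) + poly (pderiv (poly_of_roots A)) y / poly (poly_of_roots A) y"
    using nonzero by (simp only: add_divide_distrib) simp
  with add show ?case by simp
qed simp

lemma map_poly_add_hom:
  assumes "f 0 = 0" "\<And>a b. f (a + b) = f a + f b"
  shows "map_poly f (p + q) = map_poly f p + map_poly f q"
  by (rule poly_eqI) (simp add: assms coeff_map_poly)

lemma map_poly_mult_hom:
  assumes "f 0 = 0" "\<And>a b. f (a + b) = f a + f b" "\<And>a b. f (a * b) = f a * f b"
  shows "map_poly f (p * q) = map_poly f p * map_poly f q"
proof (rule poly_eqI)
  have "f (sum g S) = (\<Sum>i\<in>S. f (g i))" for g and S :: "nat set"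
    by (induction S rule: infinite_finite_induct) (simp_all add: assms)
  then show "coeff (map_poly f (p * q)) n = coeff (map_poly f p * map_poly f q) n" for n
    by (simp add: coeff_map_poly coeff_mult assms)
qed

subsection \<open>Newton's identities\<close>

fun newton_power_sum :: "'a::comm_ring_1 poly \<Rightarrow> nat \<Rightarrow> 'a" where
  "newton_power_sum p 0 = of_nat (degree p)"
| "newton_power_sum p (Suc k) = - (of_nat (Suc k) * coeff (reflect_poly p) (Suc k))
     - (\<Sum>i\<in>{1..k}. coeff (reflect_poly p) i * newton_power_sum p (Suc k - i))"

lemma fps_deriv_reflect_poly_of_roots:
  fixes A :: "'a::idom multiset"
  defines "R \<equiv> \<lambda>A. fps_of_poly (reflect_poly (poly_of_roots A))"
  shows "fps_deriv (R A) = - R A * Abs_fps (\<lambda>n. \<Sum>a\<in>#A. a ^ Suc n)"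
proof (induction A)
  case empty
  show ?case by (simp add: R_def fps_eq_iff)
next
  case (add a A)
  define geometric where "geometric = Abs_fps (\<lambda>n. a ^ Suc n)"
  define S where "S A = Abs_fps (\<lambda>n. \<Sum>a\<in>#A. a ^ Suc n)" for A :: "'a multiset"
  define l where "l = 1 - fps_const a * fps_X"
  have "reflect_poly [:- a, 1:] = [:1, - a:]"
    by (rule poly_eqI) (simp add: coeff_reflect_poly coeff_pCons split: nat.splits)
  then have R_add: "R (add_mset a A) = l * R A"
    by (simp add: R_def l_def reflect_poly_mult fps_of_poly_mult fps_of_poly_pCons fps_const_neg[symmetric]
        del: mult_pCons_left fps_const_neg)
  have S_add: "S (add_mset a A) = geometric + S A"
    by (simp add: S_def geometric_def fps_eq_iff)
  have geometric_sum: "l * geometric = fps_const a"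
  proof (rule fps_ext)
    show "fps_nth (l * geometric) n = fps_nth (fps_const a) n" for n
      by (cases n) (simp_all add: l_def geometric_def algebra_simps)
  qed
  have "fps_deriv (l * R A) = l * fps_deriv (R A) - fps_const a * R A"
    by (simp add: l_def fps_const_neg[symmetric] del: fps_const_neg)
  also have "\<dots> = - (l * R A) * (geometric + S A)"
    unfolding add.IH geometric_sum[symmetric] S_def by (simp add: algebra_simps)
  finally show ?case unfolding R_add S_add[unfolded S_def] S_def .
qed

lemma newton_identity:
  fixes A :: "'a::idom multiset"
  defines "e \<equiv> coeff (reflect_poly (poly_of_roots A))"
  shows "of_nat (Suc n) * e (Suc n) = - (\<Sum>i=0..n. e i * (\<Sum>a\<in>#A. a ^ Suc (n - i)))"
proof -
  define R where "R = fps_of_poly (reflect_poly (poly_of_roots A))"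
  have "of_nat (Suc n) * e (Suc n) = fps_nth (fps_deriv R) n"
    by (simp add: R_def e_def)
  also have "\<dots> = fps_nth (- (R * Abs_fps (\<lambda>n. \<Sum>a\<in>#A. a ^ Suc n))) n"
    using fps_deriv_reflect_poly_of_roots[of A] by (simp add: R_def)
  also have "\<dots> = - (\<Sum>i=0..n. e i * (\<Sum>a\<in>#A. a ^ Suc (n - i)))"
    unfolding fps_neg_nth fps_mult_nth by (simp add: R_def e_def)
  finally show ?thesis .
qed

theorem power_sum_eq_newton_power_sum:
  fixes A :: "'a::idom multiset"
  shows "(\<Sum>a\<in>#A. a ^ k) = newton_power_sum (poly_of_roots A) k"
proof (induction k rule: less_induct)
  case (less k)
  show ?case
  proof (cases k)
    case (Suc n)
    define e where "e = coeff (reflect_poly (poly_of_roots A))"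
    have "e 0 = 1" using lead_coeff_poly_of_roots[of A] by (simp add: e_def)
    then have "(\<Sum>i=0..n. e i * (\<Sum>a\<in>#A. a ^ Suc (n - i)))
        = (\<Sum>a\<in>#A. a ^ k) + (\<Sum>i\<in>{1..n}. e i * (\<Sum>a\<in>#A. a ^ Suc (n - i)))"
      using sum.atLeast_Suc_atMost[of 0 n "\<lambda>i. e i * (\<Sum>a\<in>#A. a ^ Suc (n - i))"] by (simp add: Suc)
    also have "(\<Sum>i\<in>{1..n}. e i * (\<Sum>a\<in>#A. a ^ Suc (n - i)))
        = (\<Sum>i\<in>{1..n}. e i * newton_power_sum (poly_of_roots A) (Suc n - i))"
    proof (intro sum.cong refl)
      fix i assume "i \<in> {1..n}"
      then have "Suc n - i < k" "Suc (n - i) = Suc n - i" using Suc by auto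
      then show "e i * (\<Sum>a\<in>#A. a ^ Suc (n - i)) = e i * newton_power_sum (poly_of_roots A) (Suc n - i)"
        using less.IH by (simp only:)
    qed
    finally have "of_nat (Suc n) * e (Suc n) = - ((\<Sum>a\<in>#A. a ^ k)
        + (\<Sum>i\<in>{1..n}. e i * newton_power_sum (poly_of_roots A) (Suc n - i)))"
      using newton_identity[of n A] by (simp only: e_def)
    then have "(\<Sum>a\<in>#A. a ^ k) = - (of_nat (Suc n) * e (Suc n))
        - (\<Sum>i\<in>{1..n}. e i * newton_power_sum (poly_of_roots A) (Suc n - i))"
      by (simp only: minus_minus add_diff_cancel_right')
    then show ?thesis by (simp only: Suc newton_power_sum.simps e_def)
  qed simp
qed

section \<open>Orders of power series\<close>

definition fps_order :: "'a::zero fps \<Rightarrow> enat" where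
  "fps_order f = (if f = 0 then \<infinity> else enat (subdegree f))"

lemma fps_order_eq_infinity_iff [simp]: "fps_order f = \<infinity> \<longleftrightarrow> f = 0"
  by (simp add: fps_order_def)

lemma enat_le_fps_order_iff: "enat n \<le> fps_order f \<longleftrightarrow> (\<forall>k<n. fps_nth f k = 0)"
  by (auto simp: fps_order_def intro: subdegree_geI nth_less_subdegree_zero)

lemma fps_order_eq_enat_iff: "fps_order f = enat n \<longleftrightarrow> fps_nth f n \<noteq> 0 \<and> (\<forall>k<n. fps_nth f k = 0)"
  by (auto simp: fps_order_def intro: subdegreeI nth_less_subdegree_zero)

lemma fps_order_minus_commute: "fps_order (f - g) = fps_order (g - f)"
  for f g :: "'a::group_add fps"
  by (auto simp: fps_order_def)

definition fps_rot :: "'a::comm_ring_1 \<Rightarrow> 'a fps \<Rightarrow> 'a fps" where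
  "fps_rot w f = f oo (fps_const w * fps_X)"

lemma fps_nth_rot [simp]: "fps_nth (fps_rot w f) k = w ^ k * fps_nth f k"
  by (simp add: fps_rot_def)

lemma fps_rot_one [simp]: "fps_rot 1 f = f"
  by (simp add: fps_eq_iff)

lemma fps_rot_rot: "fps_rot w (fps_rot w' f) = fps_rot (w * w') f"
  by (simp add: fps_eq_iff power_mult_distrib mult_ac)

lemma fps_rot_diff: "fps_rot w (f - g) = fps_rot w f - fps_rot w g"
  by (simp add: fps_eq_iff algebra_simps)

lemma fps_order_rot:
  fixes w :: "'a::idom"
  assumes "w \<noteq> 0"
  shows "fps_order (fps_rot w f) = fps_order f"
proof (cases "fps_order f")
  case (enat n)
  then have "fps_order (fps_rot w f) = enat n" using assms by (simp add: fps_order_eq_enat_iff)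
  with enat show ?thesis by simp
qed (simp add: fps_rot_def)

lemma fps_order_rot_diff:
  fixes w :: "'a::idom"
  assumes "w \<noteq> 0"
  shows "fps_order (fps_rot w f - fps_rot w g) = fps_order (f - g)"
  using fps_order_rot[OF assms] by (metis fps_rot_diff)

section \<open>Contact of finite sets of power series\<close>

definition contact_iso ::
  "complex \<Rightarrow> complex fps set \<Rightarrow> complex fps set \<Rightarrow> (complex fps \<times> complex fps) set \<Rightarrow> bool" where
  "contact_iso w Y Y' R \<longleftrightarrow> Domain R = Y \<and> Range R = Y' \<and>
     (\<forall>(x, x')\<in>R. \<forall>(y, y')\<in>R. fps_order (x - y) = fps_order (x' - y')) \<and>
     (\<forall>(x, x')\<in>R. (fps_rot w x, fps_rot w x') \<in> R)"

definition contact_equiv :: "complex \<Rightarrow> complex fps set \<Rightarrow> complex fps set \<Rightarrow> bool" where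
  "contact_equiv w Y Y' \<longleftrightarrow> (\<exists>R. contact_iso w Y Y' R)"

lemma contact_isoI:
  assumes "Domain R = Y" "Range R = Y'"
    and "\<And>x x' y y'. (x, x') \<in> R \<Longrightarrow> (y, y') \<in> R \<Longrightarrow> fps_order (x - y) = fps_order (x' - y')"
    and "\<And>x x'. (x, x') \<in> R \<Longrightarrow> (fps_rot w x, fps_rot w x') \<in> R"
  shows "contact_iso w Y Y' R"
  using assms by (auto simp: contact_iso_def)

lemma contact_iso_Domain: "contact_iso w Y Y' R \<Longrightarrow> Domain R = Y"
  and contact_iso_Range: "contact_iso w Y Y' R \<Longrightarrow> Range R = Y'"
  unfolding contact_iso_def by auto

lemma contact_iso_mem: "contact_iso w Y Y' R \<Longrightarrow> (x, x') \<in> R \<Longrightarrow> x \<in> Y \<and> x' \<in> Y'"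
  using contact_iso_Domain contact_iso_Range by blast

lemma contact_iso_order:
  "contact_iso w Y Y' R \<Longrightarrow> (x, x') \<in> R \<Longrightarrow> (y, y') \<in> R \<Longrightarrow> fps_order (x - y) = fps_order (x' - y')"
  unfolding contact_iso_def by fast

lemma contact_iso_eq:
  assumes "contact_iso w Y Y' R" "(x, x') \<in> R" "(y, y') \<in> R"
  shows "x = y \<longleftrightarrow> x' = y'"
  using contact_iso_order[OF assms] fps_order_eq_infinity_iff
  by (metis eq_iff_diff_eq_0)

lemma contact_iso_rot:
  "contact_iso w Y Y' R \<Longrightarrow> (x, x') \<in> R \<Longrightarrow> (fps_rot w x, fps_rot w x') \<in> R"
  unfolding contact_iso_def by fast

lemma contact_iso_imp_equiv: "contact_iso w Y Y' R \<Longrightarrow> contact_equiv w Y Y'"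
  unfolding contact_equiv_def by blast

lemma contact_equiv_refl: "contact_equiv 1 Y Y"
  by (rule contact_iso_imp_equiv[of _ _ _ "Id_on Y"]) (auto simp: contact_iso_def)

lemma contact_equiv_sym:
  assumes "contact_equiv w Y Y'"
  shows "contact_equiv w Y' Y"
proof -
  obtain R where R: "contact_iso w Y Y' R" using assms by (auto simp: contact_equiv_def)
  have "contact_iso w Y' Y (R\<inverse>)"
    using contact_iso_Domain[OF R] contact_iso_Range[OF R] contact_iso_order[OF R] contact_iso_rot[OF R]
    by (intro contact_isoI) auto
  then show ?thesis by (rule contact_iso_imp_equiv)
qed

lemma contact_equiv_trans [trans]:
  assumes "contact_equiv w X Y" "contact_equiv w Y Z"
  shows "contact_equiv w X Z"
proof -
  obtain R where R: "contact_iso w X Y R" using assms(1) by (auto simp: contact_equiv_def)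
  obtain S where S: "contact_iso w Y Z S" using assms(2) by (auto simp: contact_equiv_def)
  have "contact_iso w X Z (R O S)"
  proof (rule contact_isoI)
    show "Domain (R O S) = X" "Range (R O S) = Z"
      using contact_iso_Domain[OF R] contact_iso_Range[OF R] contact_iso_Domain[OF S] contact_iso_Range[OF S]
      by blast+
    show "fps_order (x - y) = fps_order (x' - y')" if "(x, x') \<in> R O S" "(y, y') \<in> R O S" for x x' y y'
      using that contact_iso_order[OF R] contact_iso_order[OF S] by (auto elim!: relcompE)
    show "(fps_rot w x, fps_rot w x') \<in> R O S" if "(x, x') \<in> R O S" for x x'
      using that contact_iso_rot[OF R] contact_iso_rot[OF S] by blast
  qed
  then show ?thesis by (rule contact_iso_imp_equiv)
qed

lemma contact_equiv_empty_iff: "contact_equiv w Y Y' \<Longrightarrow> Y = {} \<longleftrightarrow> Y' = {}"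
  by (auto simp: contact_equiv_def contact_iso_def)

lemma contact_iso_restrict:
  assumes R: "contact_iso w Y Y' R" and "X \<subseteq> Y"
  shows "contact_equiv 1 X (R `` X)"
proof (rule contact_iso_imp_equiv)
  show "contact_iso 1 X (R `` X) {(x, x') \<in> R. x \<in> X}"
    using contact_iso_Domain[OF R] contact_iso_order[OF R] \<open>X \<subseteq> Y\<close> by (intro contact_isoI) auto
qed

lemma contact_iso_Image_Diff:
  assumes R: "contact_iso w Y Y' R" and "X \<subseteq> Y"
  shows "R `` (Y - X) = Y' - R `` X"
  using contact_iso_Domain[OF R] contact_iso_Range[OF R] contact_iso_eq[OF R] by blast

lemma contact_equiv_rot_image:
  assumes "w \<noteq> 0"
  shows "contact_equiv 1 X (fps_rot w ` X)"
proof (rule contact_iso_imp_equiv)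
  show "contact_iso 1 X (fps_rot w ` X) ((\<lambda>x. (x, fps_rot w x)) ` X)"
    by (rule contact_isoI) (auto simp: fps_order_rot_diff[OF assms])
qed

lemma contact_equiv_glue:
  assumes "contact_equiv w X X'" "contact_equiv w Z Z'"
    and across: "\<And>x z. x \<in> X \<Longrightarrow> z \<in> Z \<Longrightarrow> fps_order (x - z) = h"
    and across': "\<And>x z. x \<in> X' \<Longrightarrow> z \<in> Z' \<Longrightarrow> fps_order (x - z) = h"
  shows "contact_equiv w (X \<union> Z) (X' \<union> Z')"
proof -
  obtain R where R: "contact_iso w X X' R" using assms by (auto simp: contact_equiv_def)
  obtain S where S: "contact_iso w Z Z' S" using assms by (auto simp: contact_equiv_def)
  have mixed: "fps_order (x - y) = h \<and> fps_order (x' - y') = h" if "(x, x') \<in> R" "(y, y') \<in> S" for x x' y y'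
    using contact_iso_mem[OF R that(1)] contact_iso_mem[OF S that(2)] across across' by blast
  have "contact_iso w (X \<union> Z) (X' \<union> Z') (R \<union> S)"
  proof (rule contact_isoI)
    show "Domain (R \<union> S) = X \<union> Z" "Range (R \<union> S) = X' \<union> Z'"
      using contact_iso_Domain[OF R] contact_iso_Range[OF R] contact_iso_Domain[OF S] contact_iso_Range[OF S]
      by auto
    show "fps_order (x - y) = fps_order (x' - y')" if "(x, x') \<in> R \<union> S" "(y, y') \<in> R \<union> S" for x x' y y'
      using that mixed contact_iso_order[OF R] contact_iso_order[OF S] by (metis UnE fps_order_minus_commute)
    show "(fps_rot w x, fps_rot w x') \<in> R \<union> S" if "(x, x') \<in> R \<union> S" for x x'
      using that contact_iso_rot[OF R] contact_iso_rot[OF S] by blast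
  qed
  then show ?thesis by (rule contact_iso_imp_equiv)
qed

subsection \<open>Jets\<close>

definition agree_below :: "nat \<Rightarrow> complex fps set \<Rightarrow> bool" where
  "agree_below h Y \<longleftrightarrow> (\<forall>x\<in>Y. \<forall>y\<in>Y. enat h \<le> fps_order (x - y))"

definition jet_class :: "nat \<Rightarrow> complex fps set \<Rightarrow> complex \<Rightarrow> complex fps set" where
  "jet_class h Y a = {y \<in> Y. fps_nth y h = a}"

lemma agree_below_subset: "agree_below h Y \<Longrightarrow> X \<subseteq> Y \<Longrightarrow> agree_below h X"
  unfolding agree_below_def by blast

lemma agree_below_order_eq_iff:
  assumes "agree_below h Y" "x \<in> Y" "y \<in> Y"
  shows "fps_order (x - y) = enat h \<longleftrightarrow> fps_nth x h \<noteq> fps_nth y h"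
proof -
  have "\<forall>k<h. fps_nth (x - y) k = 0"
    using assms unfolding agree_below_def enat_le_fps_order_iff by blast
  then have "fps_order (x - y) = enat h \<longleftrightarrow> fps_nth (x - y) h \<noteq> 0"
    unfolding fps_order_eq_enat_iff by blast
  then show ?thesis by simp
qed

lemma contact_iso_agree_below:
  assumes R: "contact_iso w Y Y' R" and agree: "agree_below h Y"
  shows "agree_below h Y'"
  unfolding agree_below_def
proof (intro ballI)
  fix x' y' assume "x' \<in> Y'" "y' \<in> Y'"
  then obtain x y where "(x, x') \<in> R" "(y, y') \<in> R" using contact_iso_Range[OF R] by blast
  then show "enat h \<le> fps_order (x' - y')"
    using agree contact_iso_mem[OF R] contact_iso_order[OF R] by (metis agree_below_def)
qed

lemma obtain_separating_level:
  assumes "x \<in> Y" "y \<in> Y" "x \<noteq> y"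
  obtains h u v where "agree_below h Y" "u \<in> Y" "v \<in> Y" "fps_nth u h \<noteq> fps_nth v h"
proof -
  define separates where "separates h \<longleftrightarrow> (\<exists>u\<in>Y. \<exists>v\<in>Y. fps_nth u h \<noteq> fps_nth v h)" for h
  have "\<exists>h. separates h" using assms by (auto simp: separates_def fps_eq_iff)
  then have "separates (LEAST h. separates h)" by (rule LeastI_ex)
  moreover have "agree_below (LEAST h. separates h) Y"
    unfolding agree_below_def enat_le_fps_order_iff using not_less_Least[of _ separates]
    by (metis fps_sub_nth right_minus_eq separates_def)
  ultimately show ?thesis using that by (auto simp: separates_def)
qed

lemma contact_iso_same_jet:
  assumes R: "contact_iso w Y Y' R" and agree: "agree_below h Y" and "(x, x') \<in> R" "(y, y') \<in> R"
  shows "fps_nth x h = fps_nth y h \<longleftrightarrow> fps_nth x' h = fps_nth y' h"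
  using agree_below_order_eq_iff[OF agree] agree_below_order_eq_iff[OF contact_iso_agree_below[OF R agree]]
    contact_iso_order[OF R] contact_iso_mem[OF R] assms(3,4) by metis

lemma contact_iso_jet_class:
  assumes R: "contact_iso w Y Y' R" and "agree_below h Y" and x: "(x, x') \<in> R"
  shows "R `` jet_class h Y (fps_nth x h) = jet_class h Y' (fps_nth x' h)"
proof -
  have "y' \<in> jet_class h Y' (fps_nth x' h) \<longleftrightarrow> y \<in> jet_class h Y (fps_nth x h)" if "(y, y') \<in> R" for y y'
    using contact_iso_same_jet[OF assms that] contact_iso_mem[OF R that] by (auto simp: jet_class_def)
  then show ?thesis using contact_iso_Range[OF R] by (auto simp: jet_class_def)
qed

lemma contact_iso_restrict_jet_class:
  assumes "contact_iso w Y Y' R" "agree_below h Y" "(x, x') \<in> R"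
  shows "contact_equiv 1 (jet_class h Y (fps_nth x h)) (jet_class h Y' (fps_nth x' h))"
  using contact_iso_restrict[OF assms(1), of "jet_class h Y (fps_nth x h)"] contact_iso_jet_class[OF assms]
  by (simp add: jet_class_def)

lemma contact_equiv_swap_class:
  assumes agree: "agree_below h Y" and classes: "contact_equiv 1 (jet_class h Y a) (jet_class h Y b)"
  shows "contact_equiv 1 (Y - jet_class h Y a) (Y - jet_class h Y b)"
proof (cases "a = b")
  case False
  define V where "V = Y - jet_class h Y a - jet_class h Y b"
  have "contact_equiv 1 (jet_class h Y b \<union> V) (jet_class h Y a \<union> V)"
  proof (rule contact_equiv_glue[OF contact_equiv_sym[OF classes] contact_equiv_refl])
    show "fps_order (x - z) = enat h" if "x \<in> jet_class h Y b" "z \<in> V" for x z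
      using that agree_below_order_eq_iff[OF agree] by (auto simp: V_def jet_class_def)
    show "fps_order (x - z) = enat h" if "x \<in> jet_class h Y a" "z \<in> V" for x z
      using that agree_below_order_eq_iff[OF agree] by (auto simp: V_def jet_class_def)
  qed
  moreover have "jet_class h Y b \<union> V = Y - jet_class h Y a" "jet_class h Y a \<union> V = Y - jet_class h Y b"
    using False by (auto simp: V_def jet_class_def)
  ultimately show ?thesis by simp
qed (simp add: contact_equiv_refl)

lemma contact_equiv_remove_class:
  assumes "contact_equiv 1 Y Y'" and agree: "agree_below h Y"
    and classes: "contact_equiv 1 (jet_class h Y a) (jet_class h Y' a')"
  shows "contact_equiv 1 (Y - jet_class h Y a) (Y' - jet_class h Y' a')"
proof (cases "jet_class h Y a = {}")
  case True
  then show ?thesis using contact_equiv_empty_iff[OF classes] assms(1) by simp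
next
  case False
  obtain R where R: "contact_iso 1 Y Y' R" using assms(1) by (auto simp: contact_equiv_def)
  obtain x where "x \<in> Y" "fps_nth x h = a" using False by (auto simp: jet_class_def)
  then obtain x' where x: "(x, x') \<in> R" using contact_iso_Domain[OF R] by blast
  have "contact_equiv 1 (Y - jet_class h Y a) (R `` (Y - jet_class h Y a))"
    using contact_iso_restrict[OF R, of "Y - jet_class h Y a"] by simp
  also have "R `` (Y - jet_class h Y a) = Y' - jet_class h Y' (fps_nth x' h)"
    using contact_iso_Image_Diff[OF R, of "jet_class h Y a"] contact_iso_jet_class[OF R agree x]
    by (simp add: jet_class_def \<open>fps_nth x h = a\<close>)
  also have "contact_equiv 1 (Y' - jet_class h Y' (fps_nth x' h)) (Y' - jet_class h Y' a')"
  proof (rule contact_equiv_swap_class[OF contact_iso_agree_below[OF R agree]])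
    have "contact_equiv 1 (jet_class h Y' (fps_nth x' h)) (jet_class h Y a)"
      using contact_iso_restrict_jet_class[OF R agree x] contact_equiv_sym by (simp add: \<open>fps_nth x h = a\<close>)
    also note classes
    finally show "contact_equiv 1 (jet_class h Y' (fps_nth x' h)) (jet_class h Y' a')" .
  qed
  finally show ?thesis .
qed

subsection \<open>Equivariance under rotation by a root of unity\<close>

lemma rot_power_invariant:
  assumes "fps_rot w ` Y \<subseteq> Y" "y \<in> Y"
  shows "fps_rot (w ^ k) y \<in> Y"
proof (induction k)
  case (Suc k)
  then show ?case using assms(1) fps_rot_rot[of w "w ^ k" y] by (auto simp: image_subset_iff)
qed (use assms in simp)

lemma fps_rot_jet_class:
  assumes inv: "fps_rot w ` Y \<subseteq> Y" and unity: "w ^ N = 1" "N > 0"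
  shows "fps_rot (w ^ k) ` jet_class h Y a = jet_class h Y ((w ^ h) ^ k * a)"
proof (intro equalityI subsetI)
  fix y assume "y \<in> fps_rot (w ^ k) ` jet_class h Y a"
  then show "y \<in> jet_class h Y ((w ^ h) ^ k * a)"
    using rot_power_invariant[OF inv] by (auto simp: jet_class_def mult.commute simp flip: power_mult)
next
  fix y assume y: "y \<in> jet_class h Y ((w ^ h) ^ k * a)"
  have "w ^ (k * N) = 1" using unity(1) by (metis mult.commute power_mult power_one)
  moreover have "k * N = k + (k * N - k)" using unity(2) by simp
  ultimately have inverse: "w ^ k * w ^ (k * N - k) = 1" by (metis power_add)
  have "fps_nth (fps_rot (w ^ (k * N - k)) y) h = (w ^ k * w ^ (k * N - k)) ^ h * a"
    using y by (simp add: jet_class_def power_mult_distrib mult_ac flip: power_mult)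
  also have "\<dots> = a" by (simp add: inverse)
  finally have "fps_nth (fps_rot (w ^ (k * N - k)) y) h = a" .
  then have "fps_rot (w ^ (k * N - k)) y \<in> jet_class h Y a"
    using rot_power_invariant[OF inv] y by (simp add: jet_class_def)
  moreover have "y = fps_rot (w ^ k) (fps_rot (w ^ (k * N - k)) y)"
    by (simp add: fps_rot_rot inverse)
  ultimately show "y \<in> fps_rot (w ^ k) ` jet_class h Y a" by blast
qed

lemma contact_equiv_rot_jet_class:
  assumes "fps_rot w ` Y \<subseteq> Y" "w ^ N = 1" "N > 0"
  shows "contact_equiv 1 (jet_class h Y a) (jet_class h Y ((w ^ h) ^ k * a))"
proof -
  have "w ^ k \<noteq> 0" using assms(2,3) by (auto simp: power_0_left)
  then show ?thesis
    using contact_equiv_rot_image[of "w ^ k" "jet_class h Y a"] by (simp add: fps_rot_jet_class[OF assms])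
qed

lemma obtain_order_of_root_of_unity:
  fixes \<omega> :: "'a::field"
  assumes "\<omega> ^ N = 1" "N > 0"
  obtains q where "q > 0" "\<omega> ^ q = 1" "\<And>a. a \<noteq> 0 \<or> q = 1 \<Longrightarrow> inj_on (\<lambda>k. \<omega> ^ k * a) {..<q}"
proof -
  define is_period where "is_period q \<longleftrightarrow> q > 0 \<and> \<omega> ^ q = 1" for q
  define q where "q = (LEAST q. is_period q)"
  have q: "is_period q" unfolding q_def by (rule LeastI[of _ N]) (simp add: is_period_def assms)
  have "\<omega> \<noteq> 0" using assms by (auto simp: power_0_left)
  have distinct: "\<omega> ^ j * a \<noteq> \<omega> ^ k * a" if "j < k" "k < q" "a \<noteq> 0" for j k a
  proof
    assume "\<omega> ^ j * a = \<omega> ^ k * a"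
    then have "\<omega> ^ k = \<omega> ^ j" using that(3) by simp
    moreover have "\<omega> ^ k = \<omega> ^ j * \<omega> ^ (k - j)" using that(1) by (simp flip: power_add)
    ultimately have "is_period (k - j)" using \<open>\<omega> \<noteq> 0\<close> that(1) by (simp add: is_period_def)
    moreover have "k - j < q" using that by simp
    ultimately show False using not_less_Least unfolding q_def by blast
  qed
  have "inj_on (\<lambda>k. \<omega> ^ k * a) {..<q}" if "a \<noteq> 0 \<or> q = 1" for a
  proof (cases "q = 1")
    case False
    then show ?thesis using distinct that by (intro linorder_inj_onI) auto
  qed (simp add: inj_on_def)
  then show ?thesis using that q by (auto simp: is_period_def)
qed

definition jet_orbit :: "complex \<Rightarrow> nat \<Rightarrow> nat \<Rightarrow> complex fps set \<Rightarrow> complex \<Rightarrow> complex fps set" where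
  "jet_orbit w h q Y a = (\<Union>k<q. jet_class h Y ((w ^ h) ^ k * a))"

lemma mem_jet_orbit_iff:
  assumes "(w ^ h) ^ q = 1" "q > 0"
  shows "y \<in> jet_orbit w h q Y a \<longleftrightarrow> y \<in> Y \<and> (\<exists>k. fps_nth y h = (w ^ h) ^ k * a)"
proof -
  have "(w ^ h) ^ (k mod q) = (w ^ h) ^ k" for k
  proof -
    have "(w ^ h) ^ k = (w ^ h) ^ (q * (k div q) + k mod q)" by simp
    then show ?thesis by (simp only: power_add power_mult assms(1) power_one mult_1)
  qed
  then have "(\<exists>k<q. fps_nth y h = (w ^ h) ^ k * a) \<longleftrightarrow> (\<exists>k. fps_nth y h = (w ^ h) ^ k * a)"
    using assms(2) by (metis mod_less_divisor)
  then show ?thesis by (auto simp: jet_orbit_def jet_class_def)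
qed

lemma fps_rot_Diff_jet_orbit:
  assumes inv: "fps_rot w ` Y \<subseteq> Y" and period: "(w ^ h) ^ q = 1" "q > 0"
  shows "fps_rot w ` (Y - jet_orbit w h q Y a) \<subseteq> Y - jet_orbit w h q Y a"
proof -
  have "\<exists>k. fps_nth y h = (w ^ h) ^ k * a" if "fps_nth (fps_rot w y) h = (w ^ h) ^ k * a" for y k
  proof
    have "(w ^ h) ^ (q - 1 + k) * a = (w ^ h) ^ (q - 1) * (w ^ h * fps_nth y h)"
      using that by (simp add: power_add mult.assoc)
    also have "\<dots> = (w ^ h) ^ q * fps_nth y h"
      using power_minus_mult[OF period(2), of "w ^ h"] by (simp only: mult.assoc[symmetric])
    finally show "fps_nth y h = (w ^ h) ^ (q - 1 + k) * a" by (simp only: period(1) mult_1)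
  qed
  then have "y \<in> jet_orbit w h q Y a" if "y \<in> Y" "fps_rot w y \<in> jet_orbit w h q Y a" for y
    using that unfolding mem_jet_orbit_iff[OF period] by blast
  then show ?thesis using inv by blast
qed

lemma agree_below_jet_orbit_order:
  assumes "agree_below h Y" "x \<in> jet_orbit w h q Y a" "z \<in> Y - jet_orbit w h q Y a"
  shows "fps_order (x - z) = enat h"
  using assms agree_below_order_eq_iff[of h Y x z] by (auto simp: jet_orbit_def jet_class_def)

lemma agree_below_distinct_classes_order:
  assumes "agree_below h Y" "inj_on (\<lambda>k. u ^ k * a) {..<q}" "j < q" "k < q" "j \<noteq> k"
    and "x \<in> jet_class h Y (u ^ j * a)" "y \<in> jet_class h Y (u ^ k * a)"
  shows "fps_order (x - y) = enat h"
proof -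
  have "u ^ j * a \<noteq> u ^ k * a" using assms(2-5) by (auto simp: inj_on_def)
  then show ?thesis using assms(6,7) by (simp add: jet_class_def agree_below_order_eq_iff[OF assms(1)])
qed

definition rot_orbit :: "complex \<Rightarrow> nat \<Rightarrow> (complex fps \<times> complex fps) set \<Rightarrow> (complex fps \<times> complex fps) set" where
  "rot_orbit w q R = (\<Union>k<q. map_prod (fps_rot (w ^ k)) (fps_rot (w ^ k)) ` R)"

lemma rot_orbit_cases:
  assumes "(x, x') \<in> rot_orbit w q R"
  obtains k u u' where "k < q" "(u, u') \<in> R" "x = fps_rot (w ^ k) u" "x' = fps_rot (w ^ k) u'"
  using assms by (auto simp: rot_orbit_def)

lemma rot_orbit_rot:
  assumes R: "contact_iso (w ^ q) Y Y' R" and "q > 0" and "(x, x') \<in> rot_orbit w q R"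
  shows "(fps_rot w x, fps_rot w x') \<in> rot_orbit w q R"
  using assms(3)
proof (rule rot_orbit_cases)
  define rot where "rot k = map_prod (fps_rot (w ^ k)) (fps_rot (w ^ k))" for k
  fix k u u' assume k: "k < q" and u: "(u, u') \<in> R" and x: "x = fps_rot (w ^ k) u" "x' = fps_rot (w ^ k) u'"
  have rot_Suc: "(fps_rot w x, fps_rot w x') = rot (Suc k) (u, u')" by (simp add: rot_def x fps_rot_rot)
  show ?thesis
  proof (cases "Suc k < q")
    case True
    then show ?thesis unfolding rot_Suc rot_orbit_def rot_def[symmetric] using u by blast
  next
    case False
    then have "Suc k = q" using k by simp
    then have "(fps_rot w x, fps_rot w x') \<in> rot 0 ` R"
      using contact_iso_rot[OF R u] rot_Suc by (force simp: rot_def)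
    then show ?thesis unfolding rot_orbit_def rot_def[symmetric] using \<open>q > 0\<close> by blast
  qed
qed

lemma image_rot_orbit:
  assumes R: "contact_iso (w ^ q) (jet_class h Y a) (jet_class h Y' a') R"
    and inv: "fps_rot w ` Y \<subseteq> Y" "fps_rot w ` Y' \<subseteq> Y'" and unity: "w ^ N = 1" "N > 0"
  shows "Domain (rot_orbit w q R) = jet_orbit w h q Y a" "Range (rot_orbit w q R) = jet_orbit w h q Y' a'"
proof -
  have "fst ` map_prod (fps_rot v) (fps_rot v) ` R = fps_rot v ` fst ` R"
    "snd ` map_prod (fps_rot v) (fps_rot v) ` R = fps_rot v ` snd ` R" for v
    by (auto simp: image_image)
  moreover have "fst ` R = jet_class h Y a" "snd ` R = jet_class h Y' a'"
    using contact_iso_Domain[OF R] contact_iso_Range[OF R] by (simp_all add: Domain_fst Range_snd)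
  ultimately show "Domain (rot_orbit w q R) = jet_orbit w h q Y a" "Range (rot_orbit w q R) = jet_orbit w h q Y' a'"
    unfolding rot_orbit_def jet_orbit_def Domain_fst Range_snd image_UN
    by (simp_all add: fps_rot_jet_class[OF inv(1) unity] fps_rot_jet_class[OF inv(2) unity])
qed

lemma contact_equiv_jet_orbit:
  assumes classes: "contact_equiv (w ^ q) (jet_class h Y a) (jet_class h Y' a')"
    and agree: "agree_below h Y" "agree_below h Y'"
    and inv: "fps_rot w ` Y \<subseteq> Y" "fps_rot w ` Y' \<subseteq> Y'" and unity: "w ^ N = 1" "N > 0" and "q > 0"
    and free: "inj_on (\<lambda>k. (w ^ h) ^ k * a) {..<q}" "inj_on (\<lambda>k. (w ^ h) ^ k * a') {..<q}"
  shows "contact_equiv w (jet_orbit w h q Y a) (jet_orbit w h q Y' a')"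
proof -
  obtain R where R: "contact_iso (w ^ q) (jet_class h Y a) (jet_class h Y' a') R"
    using classes by (auto simp: contact_equiv_def)
  have "w \<noteq> 0" using unity by (auto simp: power_0_left)
  have "contact_iso w (jet_orbit w h q Y a) (jet_orbit w h q Y' a') (rot_orbit w q R)"
  proof (rule contact_isoI)
    fix x x' y y' assume "(x, x') \<in> rot_orbit w q R" "(y, y') \<in> rot_orbit w q R"
    then obtain j k u u' v v' where jk: "j < q" "k < q" and uv: "(u, u') \<in> R" "(v, v') \<in> R"
      and x: "x = fps_rot (w ^ j) u" "x' = fps_rot (w ^ j) u'"
      and y: "y = fps_rot (w ^ k) v" "y' = fps_rot (w ^ k) v'"
      by (elim rot_orbit_cases) (rule that)
    show "fps_order (x - y) = fps_order (x' - y')"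
    proof (cases "j = k")
      case True
      then show ?thesis
        using contact_iso_order[OF R uv] \<open>w \<noteq> 0\<close> by (simp add: x y fps_order_rot_diff)
    next
      case False
      have "x \<in> jet_class h Y ((w ^ h) ^ j * a)" "y \<in> jet_class h Y ((w ^ h) ^ k * a)"
        "x' \<in> jet_class h Y' ((w ^ h) ^ j * a')" "y' \<in> jet_class h Y' ((w ^ h) ^ k * a')"
        using contact_iso_mem[OF R uv(1)] contact_iso_mem[OF R uv(2)]
        unfolding x y fps_rot_jet_class[OF inv(1) unity, symmetric] fps_rot_jet_class[OF inv(2) unity, symmetric]
        by blast+
      then show ?thesis
        using agree_below_distinct_classes_order[OF agree(1) free(1) jk False]
          agree_below_distinct_classes_order[OF agree(2) free(2) jk False] by simp
    qed
  qed (simp_all only: image_rot_orbit[OF R inv unity] rot_orbit_rot[OF R \<open>q > 0\<close>])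
  then show ?thesis by (rule contact_iso_imp_equiv)
qed

lemma contact_equiv_Diff_jet_orbit:
  assumes equiv: "contact_equiv 1 Y Y'" and agree: "agree_below h Y"
    and classes: "contact_equiv 1 (jet_class h Y a) (jet_class h Y' a')"
    and inv: "fps_rot w ` Y \<subseteq> Y" "fps_rot w ` Y' \<subseteq> Y'" and unity: "w ^ N = 1" "N > 0"
    and free: "inj_on (\<lambda>k. (w ^ h) ^ k * a) {..<q}" "inj_on (\<lambda>k. (w ^ h) ^ k * a') {..<q}"
  shows "contact_equiv 1 (Y - jet_orbit w h q Y a) (Y' - jet_orbit w h q Y' a')"
  using free
proof (induction q)
  case 0
  show ?case using equiv by (simp add: jet_orbit_def)
next
  case (Suc q)
  define V V' where "V = Y - jet_orbit w h q Y a" and "V' = Y' - jet_orbit w h q Y' a'"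
  have class_Diff: "jet_class h (X - jet_orbit w h q X b) ((w ^ h) ^ q * b) = jet_class h X ((w ^ h) ^ q * b)"
    if inj: "inj_on (\<lambda>k. (w ^ h) ^ k * b) {..<Suc q}" for X b
  proof -
    have "(w ^ h) ^ k * b \<noteq> (w ^ h) ^ q * b" if "k < q" for k
      using inj_onD[OF inj, of k q] that by auto
    then show ?thesis by (auto simp: jet_orbit_def jet_class_def simp del: mult_cancel_right)
  qed
  have orbit_Suc: "X - jet_orbit w h q X b - jet_class h X ((w ^ h) ^ q * b) = X - jet_orbit w h (Suc q) X b" for X b
    by (auto simp: jet_orbit_def less_Suc_eq)
  have "contact_equiv 1 V V'"
    unfolding V_def V'_def
    by (rule Suc.IH) (rule inj_on_subset[OF Suc.prems(1)] inj_on_subset[OF Suc.prems(2)]; auto)+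
  moreover have "agree_below h V" using agree by (rule agree_below_subset) (simp add: V_def)
  moreover have "contact_equiv 1 (jet_class h Y ((w ^ h) ^ q * a)) (jet_class h Y' ((w ^ h) ^ q * a'))"
    using contact_equiv_sym[OF contact_equiv_rot_jet_class[OF inv(1) unity]] classes
      contact_equiv_rot_jet_class[OF inv(2) unity] contact_equiv_trans by blast
  then have "contact_equiv 1 (jet_class h V ((w ^ h) ^ q * a)) (jet_class h V' ((w ^ h) ^ q * a'))"
    unfolding V_def V'_def class_Diff[OF Suc.prems(1)] class_Diff[OF Suc.prems(2)] .
  ultimately have "contact_equiv 1 (V - jet_class h V ((w ^ h) ^ q * a)) (V' - jet_class h V' ((w ^ h) ^ q * a'))"
    by (rule contact_equiv_remove_class)
  then show ?case
    unfolding V_def V'_def class_Diff[OF Suc.prems(1)] class_Diff[OF Suc.prems(2)] orbit_Suc .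
qed

text \<open>If the partner of a class with nonzero coefficient has coefficient zero, a conjugate of the class has a
  partner with nonzero coefficient.\<close>

lemma obtain_free_partner_class:
  assumes "contact_equiv 1 Y Y'" and agree: "agree_below h Y"
    and inv: "fps_rot w ` Y \<subseteq> Y" and unity: "w ^ N = 1" "N > 0"
    and x: "x \<in> Y" "fps_nth x h \<noteq> 0"
  obtains a' where "a' \<noteq> 0 \<or> w ^ h = 1"
    "contact_equiv 1 (jet_class h Y (fps_nth x h)) (jet_class h Y' a')"
proof -
  obtain R where R: "contact_iso 1 Y Y' R" using assms(1) by (auto simp: contact_equiv_def)
  have partner: "\<exists>y'. (y, y') \<in> R" if "y \<in> Y" for y using contact_iso_Domain[OF R] that by blast
  obtain x' where x': "(x, x') \<in> R" using partner x(1) by blast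
  show ?thesis
  proof (cases "fps_nth x' h \<noteq> 0 \<or> w ^ h = 1")
    case True
    then show ?thesis using contact_iso_restrict_jet_class[OF R agree x'] that by blast
  next
    case False
    define y where "y = fps_rot w x"
    have y: "y \<in> Y" "fps_nth y h = (w ^ h) ^ 1 * fps_nth x h" using x inv by (auto simp: y_def)
    obtain y' where y': "(y, y') \<in> R" using partner y(1) by blast
    have "fps_nth y h \<noteq> fps_nth x h" using x(2) y(2) False by simp
    then have "fps_nth y' h \<noteq> fps_nth x' h" using contact_iso_same_jet[OF R agree y' x'] by simp
    moreover have "contact_equiv 1 (jet_class h Y (fps_nth x h)) (jet_class h Y (fps_nth y h))"
      unfolding y(2) by (rule contact_equiv_rot_jet_class[OF inv unity])
    then have "contact_equiv 1 (jet_class h Y (fps_nth x h)) (jet_class h Y' (fps_nth y' h))"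
      using contact_iso_restrict_jet_class[OF R agree y'] by (rule contact_equiv_trans)
    ultimately show ?thesis using that False by metis
  qed
qed

lemma contact_equiv_at_most_one:
  assumes "contact_equiv 1 Y Y'" and unique: "\<And>x y. x \<in> Y \<Longrightarrow> y \<in> Y \<Longrightarrow> x = y"
    and inv: "fps_rot w ` Y \<subseteq> Y" "fps_rot w ` Y' \<subseteq> Y'"
  shows "contact_equiv w Y Y'"
proof -
  obtain R where R: "contact_iso 1 Y Y' R" using assms(1) by (auto simp: contact_equiv_def)
  have unique': "x' = y'" if "x' \<in> Y'" "y' \<in> Y'" for x' y'
    using that unique contact_iso_eq[OF R] contact_iso_mem[OF R] contact_iso_Range[OF R] by (metis RangeE)
  have "(fps_rot w x, fps_rot w x') = (x, x')" if "(x, x') \<in> R" for x x'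
    using contact_iso_mem[OF R that] unique unique' inv by blast
  then have "contact_iso w Y Y' R" using R by (auto simp: contact_iso_def)
  then show ?thesis by (rule contact_iso_imp_equiv)
qed

lemma obtain_free_orbits:
  assumes equiv: "contact_equiv 1 Y Y'" and agree: "agree_below h Y"
    and inv: "fps_rot w ` Y \<subseteq> Y" and unity: "w ^ N = 1" "N > 0"
    and x: "x \<in> Y" "fps_nth x h \<noteq> 0"
  obtains q a' where "q > 0" "(w ^ h) ^ q = 1"
    "inj_on (\<lambda>k. (w ^ h) ^ k * fps_nth x h) {..<q}" "inj_on (\<lambda>k. (w ^ h) ^ k * a') {..<q}"
    "contact_equiv 1 (jet_class h Y (fps_nth x h)) (jet_class h Y' a')"
proof -
  have "(w ^ h) ^ N = 1" using unity(1) by (metis mult.commute power_mult power_one)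
  then obtain q where q: "q > 0" "(w ^ h) ^ q = 1"
    and free: "\<And>a. a \<noteq> 0 \<or> q = 1 \<Longrightarrow> inj_on (\<lambda>k. (w ^ h) ^ k * a) {..<q}"
    using obtain_order_of_root_of_unity unity(2) by blast
  have "q = 1" if "w ^ h = 1" using inj_onD[OF free[of 1], of 0 1] that q(1) by (cases "q = 1") auto
  then obtain a' where "a' \<noteq> 0 \<or> q = 1"
    and "contact_equiv 1 (jet_class h Y (fps_nth x h)) (jet_class h Y' a')"
    using obtain_free_partner_class[OF equiv agree inv unity x] by metis
  show ?thesis
  proof (rule that[OF q])
    show "inj_on (\<lambda>k. (w ^ h) ^ k * fps_nth x h) {..<q}" using x(2) by (intro free) simp
    show "inj_on (\<lambda>k. (w ^ h) ^ k * a') {..<q}" using \<open>a' \<noteq> 0 \<or> q = 1\<close> by (rule free)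
  qed fact
qed

lemma card_jet_class_less:
  assumes "finite Y" "u \<in> Y" "v \<in> Y" "fps_nth u h \<noteq> fps_nth v h"
  shows "card (jet_class h Y a) < card Y"
proof -
  have "\<not> (u \<in> jet_class h Y a \<and> v \<in> jet_class h Y a)" "jet_class h Y a \<subseteq> Y"
    using assms(4) by (auto simp: jet_class_def)
  then have "jet_class h Y a \<subset> Y" using assms(2,3) by blast
  then show ?thesis using assms(1) by (rule psubset_card_mono[rotated])
qed

lemma card_Diff_jet_orbit_less:
  assumes "finite Y" "x \<in> Y" "q > 0"
  shows "card (Y - jet_orbit w h q Y (fps_nth x h)) < card Y"
proof -
  have "x \<in> jet_orbit w h q Y (fps_nth x h)"
    unfolding jet_orbit_def using assms(2,3) by (intro UN_I[of 0]) (simp_all add: jet_class_def)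
  then show ?thesis using assms(1,2) by (intro psubset_card_mono) auto
qed

theorem contact_equiv_equivariant:
  assumes "finite Y" "contact_equiv 1 Y Y'" "fps_rot w ` Y \<subseteq> Y" "fps_rot w ` Y' \<subseteq> Y'"
    and "w ^ N = 1" "N > 0"
  shows "contact_equiv w Y Y'"
  using assms
proof (induction "card Y" arbitrary: Y Y' w rule: less_induct)
  case less
  note equiv = less.prems(2) and inv = less.prems(3,4) and unity = less.prems(5,6)
  show ?case
  proof (cases "\<exists>x\<in>Y. \<exists>y\<in>Y. x \<noteq> y")
    case False
    then show ?thesis using contact_equiv_at_most_one[OF equiv _ inv] by blast
  next
    case True
    then obtain h u v where agree: "agree_below h Y" and uv: "u \<in> Y" "v \<in> Y" "fps_nth u h \<noteq> fps_nth v h"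
      using obtain_separating_level by metis
    have agree': "agree_below h Y'"
      using equiv agree contact_iso_agree_below by (auto simp: contact_equiv_def)
    obtain x where x: "x \<in> Y" "fps_nth x h \<noteq> 0" using uv by metis
    define a where "a = fps_nth x h"
    obtain q a' where q: "q > 0" "(w ^ h) ^ q = 1"
      and free: "inj_on (\<lambda>k. (w ^ h) ^ k * a) {..<q}" "inj_on (\<lambda>k. (w ^ h) ^ k * a') {..<q}"
      and classes: "contact_equiv 1 (jet_class h Y a) (jet_class h Y' a')"
      by (rule obtain_free_orbits[OF equiv agree inv(1) unity x, folded a_def]) (rule that)
    have "contact_equiv (w ^ q) (jet_class h Y a) (jet_class h Y' a')"
    proof (rule less.hyps[OF _ _ classes])
      show "card (jet_class h Y a) < card Y" by (rule card_jet_class_less[OF less.prems(1) uv])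
      show "fps_rot (w ^ q) ` jet_class h Y a \<subseteq> jet_class h Y a"
        "fps_rot (w ^ q) ` jet_class h Y' a' \<subseteq> jet_class h Y' a'"
        using fps_rot_jet_class[OF inv(1) unity, of q h] fps_rot_jet_class[OF inv(2) unity, of q h] q by simp_all
      show "(w ^ q) ^ N = 1" using unity(1) by (metis mult.commute power_mult power_one)
    qed (use less.prems unity in \<open>auto simp: jet_class_def\<close>)
    then have orbits: "contact_equiv w (jet_orbit w h q Y a) (jet_orbit w h q Y' a')"
      by (rule contact_equiv_jet_orbit[OF _ agree agree' inv unity q(1) free])
    have "contact_equiv w (Y - jet_orbit w h q Y a) (Y' - jet_orbit w h q Y' a')"
    proof (rule less.hyps[OF _ _ contact_equiv_Diff_jet_orbit[OF equiv agree classes inv unity free]])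
      show "card (Y - jet_orbit w h q Y a) < card Y"
        unfolding a_def by (rule card_Diff_jet_orbit_less[OF less.prems(1) x(1) q(1)])
    qed (use less.prems fps_rot_Diff_jet_orbit[OF _ q(2,1)] in auto)
    with orbits have "contact_equiv w (jet_orbit w h q Y a \<union> (Y - jet_orbit w h q Y a))
        (jet_orbit w h q Y' a' \<union> (Y' - jet_orbit w h q Y' a'))"
      by (rule contact_equiv_glue) (use agree_below_jet_orbit_order agree agree' in blast)+
    moreover have "jet_orbit w h q X b \<union> (X - jet_orbit w h q X b) = X" for X b
      by (auto simp: jet_orbit_def jet_class_def)
    ultimately show ?thesis by simp
  qed
qed

section \<open>Splitting of monic polynomials over convergent power series\<close>

subsection \<open>Holomorphic families of polynomials\<close>

definition poly_family :: "complex set \<Rightarrow> nat \<Rightarrow> (complex \<Rightarrow> complex poly) \<Rightarrow> bool" where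
  "poly_family S d p \<longleftrightarrow> (\<forall>x\<in>S. degree (p x) \<le> d) \<and> (\<forall>k. (\<lambda>x. coeff (p x) k) holomorphic_on S)"

lemma poly_eq_sum_coeff:
  fixes p :: "'a::comm_semiring_1 poly"
  assumes "degree p \<le> d"
  shows "poly p x = (\<Sum>k\<le>d. coeff p k * x ^ k)"
  unfolding poly_altdef using assms by (intro sum.mono_neutral_left) (auto simp: coeff_eq_0)

lemma poly_family_subset: "poly_family S d p \<Longrightarrow> T \<subseteq> S \<Longrightarrow> poly_family T d p"
  unfolding poly_family_def using holomorphic_on_subset by blast

lemma poly_family_pderiv:
  assumes "poly_family S d p"
  shows "poly_family S d (\<lambda>x. pderiv (p x))"
  using assms by (auto simp: poly_family_def coeff_pderiv degree_pderiv intro!: holomorphic_intros)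

lemma continuous_on_poly_family:
  assumes "poly_family S d p"
  shows "continuous_on (S \<times> T) (\<lambda>(x, y). poly (p x) y)"
proof -
  have "continuous_on S (\<lambda>x. coeff (p x) k)" for k
    using assms by (simp add: poly_family_def holomorphic_on_imp_continuous_on)
  then have "continuous_on (S \<times> T) (\<lambda>z. coeff (p (fst z)) k)" for k
    by (rule continuous_on_compose2) (auto intro: continuous_intros)
  then have "continuous_on (S \<times> T) (\<lambda>z. \<Sum>k\<le>d. coeff (p (fst z)) k * snd z ^ k)"
    by (intro continuous_intros)
  then show ?thesis
  proof (rule continuous_on_eq)
    fix z assume "z \<in> S \<times> T"
    then have "degree (p (fst z)) \<le> d" using assms by (auto simp: poly_family_def)
    then show "(\<Sum>k\<le>d. coeff (p (fst z)) k * snd z ^ k) = (\<lambda>(x, y). poly (p x) y) z"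
      using poly_eq_sum_coeff[of "p (fst z)" d "snd z"] by (simp add: case_prod_beta)
  qed
qed

definition poly_family_deriv :: "nat \<Rightarrow> (complex \<Rightarrow> complex poly) \<Rightarrow> complex \<Rightarrow> complex poly" where
  "poly_family_deriv d p x = (\<Sum>k\<le>d. monom (deriv (\<lambda>x. coeff (p x) k) x) k)"

lemma coeff_poly_family_deriv:
  "coeff (poly_family_deriv d p x) k = (if k \<le> d then deriv (\<lambda>x. coeff (p x) k) x else 0)"
  by (simp add: poly_family_deriv_def coeff_sum coeff_monom)

lemma poly_family_poly_family_deriv:
  assumes "poly_family S d p" "open S"
  shows "poly_family S d (poly_family_deriv d p)"
proof -
  have "(\<lambda>x. coeff (poly_family_deriv d p x) k) holomorphic_on S" for k
    using assms by (cases "k \<le> d")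
      (auto simp: coeff_poly_family_deriv[abs_def] poly_family_def intro: holomorphic_deriv)
  moreover have "degree (poly_family_deriv d p x) \<le> d" for x
    by (rule degree_le) (simp add: coeff_poly_family_deriv)
  ultimately show ?thesis by (simp add: poly_family_def)
qed

lemma poly_family_has_field_derivative:
  assumes p: "poly_family S d p" and "open S" "x \<in> S"
  shows "((\<lambda>x. poly (p x) y) has_field_derivative poly (poly_family_deriv d p x) y) (at x within S)"
proof -
  have "((\<lambda>x. coeff (p x) k) has_field_derivative deriv (\<lambda>x. coeff (p x) k) x) (at x within S)" for k
    using p holomorphic_derivI[OF _ assms(2,3)] by (auto simp: poly_family_def intro: has_field_derivative_at_within)
  then have "((\<lambda>x. \<Sum>k\<le>d. coeff (p x) k * y ^ k) has_field_derivative
      (\<Sum>k\<le>d. deriv (\<lambda>x. coeff (p x) k) x * y ^ k)) (at x within S)"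
    by (intro DERIV_sum DERIV_cmult_right)
  moreover have "(\<Sum>k\<le>d. deriv (\<lambda>x. coeff (p x) k) x * y ^ k) = poly (poly_family_deriv d p x) y"
    by (simp add: poly_family_deriv_def poly_sum poly_monom)
  moreover have "(\<Sum>k\<le>d. coeff (p z) k * y ^ k) = poly (p z) y" if "z \<in> S" for z
    using p that poly_eq_sum_coeff[of "p z" d y] by (simp add: poly_family_def)
  ultimately show ?thesis
    using \<open>x \<in> S\<close> by (auto intro: has_field_derivative_transform_within[where d = 1])
qed

lemma poly_family_no_roots_nearby:
  assumes p: "poly_family S d p" and "open S" "x \<in> S" "compact K"
    and "\<And>y. y \<in> K \<Longrightarrow> poly (p x) y \<noteq> 0"
  obtains r where "r > 0" "ball x r \<subseteq> S" "\<forall>z\<in>ball x r. \<forall>y\<in>K. poly (p z) y \<noteq> 0"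
proof -
  define W where "W = S \<times> UNIV \<inter> (\<lambda>(x, y). poly (p x) y) -` (- {0})"
  have "open W"
    unfolding W_def using \<open>open S\<close>
    by (intro continuous_open_preimage continuous_on_poly_family[OF p] open_Times) auto
  moreover have "{x} \<times> K \<subseteq> W" using assms by (auto simp: W_def)
  ultimately obtain U V where UV: "open U" "x \<in> U" "K \<subseteq> V" "U \<times> V \<subseteq> W"
    using tube_lemma_right[of euclidean euclidean W K x] \<open>compact K\<close> by (auto simp: euclidean_product_topology)
  have "open (U \<inter> S)" "x \<in> U \<inter> S" using UV \<open>open S\<close> \<open>x \<in> S\<close> by auto
  then obtain r where "r > 0" "ball x r \<subseteq> U \<inter> S" using open_contains_ball by blast
  moreover have "poly (p z) y \<noteq> 0" if "z \<in> ball x r" "y \<in> K" for z y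
  proof -
    have "(z, y) \<in> W" using that UV \<open>ball x r \<subseteq> U \<inter> S\<close> by blast
    then show ?thesis by (simp add: W_def)
  qed
  ultimately show ?thesis using that[of r] by blast
qed

lemma poly_family_newton_power_sum:
  assumes p: "poly_family S d p" and degree: "\<And>x. x \<in> S \<Longrightarrow> degree (p x) = d"
  shows "(\<lambda>x. newton_power_sum (p x) k) holomorphic_on S"
proof (induction k rule: less_induct)
  case (less k)
  have reflect: "(\<lambda>x. coeff (reflect_poly (p x)) j) holomorphic_on S" for j
  proof (rule holomorphic_transform)
    show "(\<lambda>x. if j > d then 0 else coeff (p x) (d - j)) holomorphic_on S"
      using p by (cases "j > d") (auto simp: poly_family_def)
  qed (simp add: coeff_reflect_poly degree)
  show ?case
  proof (cases k)
    case 0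
    have "(\<lambda>x. newton_power_sum (p x) 0) holomorphic_on S \<longleftrightarrow> (\<lambda>x. of_nat d :: complex) holomorphic_on S"
      by (rule holomorphic_cong) (simp_all add: degree)
    then show ?thesis by (simp add: 0)
  next
    case (Suc n)
    show ?thesis unfolding Suc newton_power_sum.simps
      using less.IH Suc by (intro holomorphic_intros reflect) auto
  qed
qed

lemma poly_family_of_power_sums:
  assumes power_sums: "\<And>k. (\<lambda>x. \<Sum>a\<in>#A x. a ^ k) holomorphic_on S" and size: "\<And>x. x \<in> S \<Longrightarrow> size (A x) = d"
  shows "poly_family S d (\<lambda>x. poly_of_roots (A x))"
proof -
  define e where "e j x = coeff (reflect_poly (poly_of_roots (A x))) j" for j x
  have "e j holomorphic_on S" for j
  proof (induction j rule: less_induct)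
    case (less j)
    show ?case
    proof (cases j)
      case 0
      then have "e j = (\<lambda>x. 1)" using lead_coeff_poly_of_roots by (auto simp: e_def fun_eq_iff)
      then show ?thesis by simp
    next
      case (Suc n)
      have "e j = (\<lambda>x. - (\<Sum>i=0..n. e i x * (\<Sum>a\<in>#A x. a ^ Suc (n - i))) / of_nat (Suc n))"
        unfolding Suc e_def newton_identity[symmetric] by (simp del: of_nat_Suc)
      moreover have "\<dots> holomorphic_on S"
        using less.IH Suc power_sums by (intro holomorphic_intros) (auto simp del: power_Suc of_nat_Suc)
      ultimately show ?thesis by simp
    qed
  qed
  then have "(\<lambda>x. if k \<le> d then e (d - k) x else 0) holomorphic_on S" for k
    by (cases "k \<le> d") auto
  moreover have "(if k \<le> d then e (d - k) x else 0) = coeff (poly_of_roots (A x)) k" if "x \<in> S" for k x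
    using size[OF that] by (auto simp: e_def coeff_reflect_poly coeff_eq_0)
  ultimately have "(\<lambda>x. coeff (poly_of_roots (A x)) k) holomorphic_on S" for k
    by (rule holomorphic_transform)
  then show ?thesis using size by (auto simp: poly_family_def)
qed

subsection \<open>Power sums of the roots in a disc\<close>

lemma has_contour_integral_power_over_linear:
  assumes "\<epsilon> > 0" "a \<notin> sphere \<alpha> \<epsilon>"
  shows "((\<lambda>y. y ^ k / (y - a)) has_contour_integral
      (if a \<in> ball \<alpha> \<epsilon> then 2 * of_real pi * \<i> * a ^ k else 0)) (circlepath \<alpha> \<epsilon>)"
proof (cases "a \<in> ball \<alpha> \<epsilon>")
  case True
  have "((\<lambda>y. y ^ k / (y - a)) has_contour_integral 2 * of_real pi * \<i> * a ^ k) (circlepath \<alpha> \<epsilon>)"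
    by (rule Cauchy_integral_circlepath_simple[of "\<lambda>y. y ^ k"])
       (use True in \<open>auto intro!: holomorphic_intros simp: dist_norm norm_minus_commute\<close>)
  then show ?thesis using True by simp
next
  case False
  then have outside: "dist \<alpha> a > \<epsilon>" using assms by (auto simp: not_less)
  have "((\<lambda>y. y ^ k / (y - a)) has_contour_integral 0) (circlepath \<alpha> \<epsilon>)"
  proof (rule Cauchy_theorem_convex_simple[of _ "ball \<alpha> (dist \<alpha> a)"])
    show "(\<lambda>y. y ^ k / (y - a)) holomorphic_on ball \<alpha> (dist \<alpha> a)"
      by (auto intro!: holomorphic_intros)
    show "path_image (circlepath \<alpha> \<epsilon>) \<subseteq> ball \<alpha> (dist \<alpha> a)"
      using outside assms(1) by (auto simp: dist_norm)
  qed (use assms(1) in auto)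
  then show ?thesis using False by simp
qed

lemma has_contour_integral_log_deriv_poly_of_roots:
  assumes "\<epsilon> > 0" "\<And>a. a \<in># A \<Longrightarrow> a \<notin> sphere \<alpha> \<epsilon>"
  shows "((\<lambda>y. y ^ k * poly (pderiv (poly_of_roots A)) y / poly (poly_of_roots A) y) has_contour_integral
     2 * of_real pi * \<i> * (\<Sum>a\<in>#filter_mset (\<lambda>a. a \<in> ball \<alpha> \<epsilon>) A. a ^ k)) (circlepath \<alpha> \<epsilon>)"
proof -
  have "((\<lambda>y. \<Sum>a\<in>#A. y ^ k / (y - a)) has_contour_integral
      2 * of_real pi * \<i> * (\<Sum>a\<in>#filter_mset (\<lambda>a. a \<in> ball \<alpha> \<epsilon>) A. a ^ k)) (circlepath \<alpha> \<epsilon>)"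
    using assms(2)
  proof (induction A)
    case (add a A)
    then show ?case
      using has_contour_integral_add[OF has_contour_integral_power_over_linear[OF assms(1), of a \<alpha> k] add.IH]
      by (auto simp: algebra_simps)
  qed (simp add: has_contour_integral_0)
  then show ?thesis
  proof (rule has_contour_integral_eq)
    fix y assume "y \<in> path_image (circlepath \<alpha> \<epsilon>)"
    then have "y \<notin># A" using assms by auto
    have "(\<Sum>a\<in>#A. y ^ k / (y - a)) = y ^ k * (\<Sum>a\<in>#A. 1 / (y - a))"
      by (simp add: sum_mset_distrib_left)
    then show "(\<Sum>a\<in>#A. y ^ k / (y - a)) = y ^ k * poly (pderiv (poly_of_roots A)) y / poly (poly_of_roots A) y"
      by (simp add: poly_logarithmic_derivative[OF \<open>y \<notin># A\<close>, symmetric])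
  qed
qed

lemma holomorphic_on_contour_integral_circlepath:
  assumes "convex S" "\<epsilon> \<ge> 0"
    and deriv: "\<And>x y. x \<in> S \<Longrightarrow> y \<in> sphere \<alpha> \<epsilon> \<Longrightarrow> ((\<lambda>x. F x y) has_field_derivative F' x y) (at x within S)"
    and cont: "continuous_on (S \<times> sphere \<alpha> \<epsilon>) (\<lambda>(x, y). F x y)"
    and cont': "continuous_on (S \<times> sphere \<alpha> \<epsilon>) (\<lambda>(x, y). F' x y)"
  shows "(\<lambda>x. contour_integral (circlepath \<alpha> \<epsilon>) (F x)) holomorphic_on S"
proof -
  define \<gamma> where "\<gamma> = circlepath \<alpha> \<epsilon>"
  define \<gamma>' where "\<gamma>' t = vector_derivative \<gamma> (at t)" for t
  have \<gamma>: "\<gamma> t \<in> sphere \<alpha> \<epsilon>" for t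
    using \<open>\<epsilon> \<ge> 0\<close> by (simp add: \<gamma>_def circlepath dist_norm norm_mult)
  have cont_\<gamma>: "continuous_on T \<gamma>" and cont_\<gamma>': "continuous_on T \<gamma>'" for T
    unfolding \<gamma>'_def \<gamma>_def vector_derivative_circlepath unfolding circlepath by (intro continuous_intros)+
  have cont_along: "continuous_on (S \<times> T) (\<lambda>(x, t). G x (\<gamma> t) * \<gamma>' t)"
    if "continuous_on (S \<times> sphere \<alpha> \<epsilon>) (\<lambda>(x, y). G x y)" for G T
  proof -
    have along: "continuous_on (S \<times> T) (\<lambda>z. \<gamma> (snd z))" "continuous_on (S \<times> T) (\<lambda>z. \<gamma>' (snd z))"
      by (rule continuous_on_compose2[OF cont_\<gamma>[of UNIV]] continuous_on_compose2[OF cont_\<gamma>'[of UNIV]];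
          auto intro: continuous_intros)+
    have "continuous_on (S \<times> T) (\<lambda>z. (\<lambda>(x, y). G x y) (fst z, \<gamma> (snd z)))"
      by (rule continuous_on_compose2[OF that]) (use \<gamma> in \<open>auto intro!: continuous_intros along\<close>)
    then show ?thesis using along(2) by (simp add: case_prod_beta continuous_on_mult)
  qed
  have "(\<lambda>x. integral (cbox 0 1) (\<lambda>t. F x (\<gamma> t) * \<gamma>' t)) holomorphic_on S"
  proof (rule leibniz_rule_holomorphic[OF _ _ cont_along[OF cont'] \<open>convex S\<close>])
    show "((\<lambda>x. F x (\<gamma> t) * \<gamma>' t) has_field_derivative F' x (\<gamma> t) * \<gamma>' t) (at x within S)" if "x \<in> S" for x t
      using deriv[OF that \<gamma>] by (rule DERIV_cmult_right)
    show "(\<lambda>t. F x (\<gamma> t) * \<gamma>' t) integrable_on cbox 0 1" if "x \<in> S" for x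
    proof (rule integrable_continuous)
      have "continuous_on (cbox 0 1) (\<lambda>t. (\<lambda>(x, t). F x (\<gamma> t) * \<gamma>' t) (x, t))"
        by (rule continuous_on_compose2[OF cont_along[OF cont, of "cbox 0 1"]])
           (use that in \<open>auto intro!: continuous_intros\<close>)
      then show "continuous_on (cbox 0 1) (\<lambda>t. F x (\<gamma> t) * \<gamma>' t)" by simp
    qed
  qed
  then show ?thesis by (simp add: contour_integral_integral \<gamma>_def \<gamma>'_def)
qed

lemma holomorphic_on_contour_integral_log_deriv:
  assumes p: "poly_family S d p" and S: "open S" "convex S" and "\<epsilon> > 0"
    and no_roots: "\<And>x y. x \<in> S \<Longrightarrow> y \<in> sphere \<alpha> \<epsilon> \<Longrightarrow> poly (p x) y \<noteq> 0"
  shows "(\<lambda>x. contour_integral (circlepath \<alpha> \<epsilon>) (\<lambda>y. y ^ k * poly (pderiv (p x)) y / poly (p x) y)) holomorphic_on S"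
proof -
  define q where "q x = pderiv (p x)" for x
  have q: "poly_family S d q" unfolding q_def by (rule poly_family_pderiv[OF p])
  define p' q' where "p' = poly_family_deriv d p" and "q' = poly_family_deriv d q"
  have families: "poly_family S d p'" "poly_family S d q'"
    unfolding p'_def q'_def by (intro poly_family_poly_family_deriv p q S)+
  note cont = families[THEN continuous_on_poly_family, of "sphere \<alpha> \<epsilon>"] continuous_on_poly_family[OF p, of "sphere \<alpha> \<epsilon>"]
    continuous_on_poly_family[OF q, of "sphere \<alpha> \<epsilon>"]
  define F' where "F' x y = y ^ k * ((poly (q' x) y * poly (p x) y - poly (q x) y * poly (p' x) y)
      / (poly (p x) y * poly (p x) y))" for x y
  have "(\<lambda>x. contour_integral (circlepath \<alpha> \<epsilon>) (\<lambda>y. y ^ k * (poly (q x) y / poly (p x) y))) holomorphic_on S"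
  proof (rule holomorphic_on_contour_integral_circlepath[where F' = F'])
    show "((\<lambda>x. y ^ k * (poly (q x) y / poly (p x) y)) has_field_derivative F' x y) (at x within S)"
      if "x \<in> S" "y \<in> sphere \<alpha> \<epsilon>" for x y
      unfolding F'_def p'_def q'_def
      using poly_family_has_field_derivative[OF p S(1) that(1)] poly_family_has_field_derivative[OF q S(1) that(1)]
        no_roots[OF that] by (intro DERIV_cmult DERIV_divide)
    show "continuous_on (S \<times> sphere \<alpha> \<epsilon>) (\<lambda>(x, y). y ^ k * (poly (q x) y / poly (p x) y))"
      "continuous_on (S \<times> sphere \<alpha> \<epsilon>) (\<lambda>(x, y). F' x y)"
      using cont no_roots unfolding F'_def case_prod_beta by (auto intro!: continuous_intros)
  qed (use S \<open>\<epsilon> > 0\<close> in auto)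
  then show ?thesis by (simp add: q_def)
qed

lemma continuous_of_nat_constant:
  fixes n :: "complex \<Rightarrow> nat"
  assumes "connected S" "continuous_on S (\<lambda>x. of_nat (n x) :: complex)" "\<And>x. x \<in> S \<Longrightarrow> n x \<le> d" "x \<in> S" "y \<in> S"
  shows "n x = n y"
proof -
  have "(\<lambda>x. of_nat (n x) :: complex) ` S \<subseteq> of_nat ` {..d}" using assms(3) by auto
  then have "finite ((\<lambda>x. of_nat (n x) :: complex) ` S)" using finite_subset by blast
  then have "(\<lambda>x. of_nat (n x) :: complex) constant_on S"
    using assms(1,2) by (rule continuous_finite_range_constant[rotated 2])
  then show ?thesis using assms(4,5) unfolding constant_on_def by (metis of_nat_eq_iff)
qed

lemma holomorphic_on_power_sum_inside:
  assumes p: "poly_family S d p" and S: "open S" "convex S" and "\<epsilon> > 0"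
    and no_roots: "\<And>x y. x \<in> S \<Longrightarrow> y \<in> sphere \<alpha> \<epsilon> \<Longrightarrow> poly (p x) y \<noteq> 0"
    and C: "\<And>x. x \<in> S \<Longrightarrow> p x = poly_of_roots (C x)"
  shows "(\<lambda>x. \<Sum>a\<in>#filter_mset (\<lambda>a. a \<in> ball \<alpha> \<epsilon>) (C x). a ^ k) holomorphic_on S"
proof (rule holomorphic_transform)
  show "(\<lambda>x. contour_integral (circlepath \<alpha> \<epsilon>) (\<lambda>y. y ^ k * poly (pderiv (p x)) y / poly (p x) y)
      / (2 * of_real pi * \<i>)) holomorphic_on S"
    by (intro holomorphic_intros holomorphic_on_contour_integral_log_deriv[OF p S \<open>\<epsilon> > 0\<close> no_roots]) auto
  fix x assume "x \<in> S"
  then have "a \<notin> sphere \<alpha> \<epsilon>" if "a \<in># C x" for a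
    using no_roots that poly_poly_of_roots_eq_0_iff C by metis
  then show "contour_integral (circlepath \<alpha> \<epsilon>) (\<lambda>y. y ^ k * poly (pderiv (p x)) y / poly (p x) y)
      / (2 * of_real pi * \<i>) = (\<Sum>a\<in>#filter_mset (\<lambda>a. a \<in> ball \<alpha> \<epsilon>) (C x). a ^ k)"
    using contour_integral_unique[OF has_contour_integral_log_deriv_poly_of_roots[OF \<open>\<epsilon> > 0\<close>, of "C x" \<alpha> k]]
    by (simp add: C[OF \<open>x \<in> S\<close>])
qed

lemma power_sums_size_constant:
  fixes D :: "complex \<Rightarrow> complex multiset"
  assumes "connected S" "\<And>k. (\<lambda>x. \<Sum>a\<in>#D x. a ^ k) holomorphic_on S"
    and bound: "\<And>x. x \<in> S \<Longrightarrow> size (D x) \<le> d"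
  shows "\<exists>m. \<forall>x\<in>S. size (D x) = m"
proof -
  have cont: "continuous_on S (\<lambda>x. of_nat (size (D x)) :: complex)"
    using holomorphic_on_imp_continuous_on[OF assms(2)[of 0]] by simp
  have "size (D x) = size (D (SOME y. y \<in> S))" if "x \<in> S" for x
    using continuous_of_nat_constant[OF assms(1) cont bound that] someI[of "\<lambda>y. y \<in> S", OF that] by simp
  then show ?thesis by blast
qed

theorem poly_family_split:
  assumes p: "poly_family S d p" and monic: "\<And>x. x \<in> S \<Longrightarrow> degree (p x) = d \<and> lead_coeff (p x) = 1"
    and S: "open S" "convex S" and "\<epsilon> > 0"
    and no_roots: "\<And>x y. x \<in> S \<Longrightarrow> y \<in> sphere \<alpha> \<epsilon> \<Longrightarrow> poly (p x) y \<noteq> 0"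
  obtains A B m n where "\<forall>x\<in>S. p x = poly_of_roots (A x) * poly_of_roots (B x)"
    "\<forall>x\<in>S. size (A x) = m \<and> size (B x) = n"
    "\<forall>x\<in>S. set_mset (A x) \<subseteq> ball \<alpha> \<epsilon> \<and> set_mset (B x) \<inter> ball \<alpha> \<epsilon> = {}"
    "poly_family S m (\<lambda>x. poly_of_roots (A x))" "poly_family S n (\<lambda>x. poly_of_roots (B x))"
proof -
  have "\<forall>x\<in>S. \<exists>C. p x = poly_of_roots C"
    using monic complex_monic_eq_poly_of_roots by metis
  then obtain C where C: "\<And>x. x \<in> S \<Longrightarrow> p x = poly_of_roots (C x)" by metis
  define A B where "A x = filter_mset (\<lambda>a. a \<in> ball \<alpha> \<epsilon>) (C x)"
    and "B x = filter_mset (\<lambda>a. a \<notin> ball \<alpha> \<epsilon>) (C x)" for x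
  have split: "C x = A x + B x" for x unfolding A_def B_def by (rule multiset_partition)
  have sums_A: "(\<lambda>x. \<Sum>a\<in>#A x. a ^ k) holomorphic_on S" for k
    unfolding A_def by (rule holomorphic_on_power_sum_inside[OF p S \<open>\<epsilon> > 0\<close> no_roots C])
  have sums_B: "(\<lambda>x. \<Sum>a\<in>#B x. a ^ k) holomorphic_on S" for k
  proof (rule holomorphic_transform)
    show "(\<lambda>x. newton_power_sum (p x) k - (\<Sum>a\<in>#A x. a ^ k)) holomorphic_on S"
      using monic by (intro holomorphic_intros poly_family_newton_power_sum[OF p] sums_A) auto
    show "newton_power_sum (p x) k - (\<Sum>a\<in>#A x. a ^ k) = (\<Sum>a\<in>#B x. a ^ k)" if "x \<in> S" for x
    proof -
      have "newton_power_sum (p x) k = (\<Sum>a\<in>#C x. a ^ k)"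
        by (simp add: C[OF that] power_sum_eq_newton_power_sum)
      then show ?thesis by (simp add: split)
    qed
  qed
  have size_C: "size (A x) \<le> d" "size (B x) \<le> d" if "x \<in> S" for x
  proof -
    have "size (C x) = d" using C[OF that] monic[OF that] by simp
    then show "size (A x) \<le> d" "size (B x) \<le> d" by (auto simp: split)
  qed
  obtain m where m: "\<forall>x\<in>S. size (A x) = m"
    using power_sums_size_constant[OF convex_connected[OF S(2)] sums_A size_C(1)] by blast
  obtain n where n: "\<forall>x\<in>S. size (B x) = n"
    using power_sums_size_constant[OF convex_connected[OF S(2)] sums_B size_C(2)] by blast
  show ?thesis
  proof (rule that[of A B m n])
    show "poly_family S m (\<lambda>x. poly_of_roots (A x))" using sums_A m by (intro poly_family_of_power_sums) auto
    show "poly_family S n (\<lambda>x. poly_of_roots (B x))" using sums_B n by (intro poly_family_of_power_sums) auto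
    show "\<forall>x\<in>S. p x = poly_of_roots (A x) * poly_of_roots (B x)"
      by (auto simp: C split)
  qed (use m n in \<open>auto simp: A_def B_def\<close>)
qed

subsection \<open>Polynomials with convergent coefficients\<close>

lemma fps_conv_radius_pos_add:
  "fps_conv_radius f > 0 \<Longrightarrow> fps_conv_radius g > 0 \<Longrightarrow> fps_conv_radius (f + g :: complex fps) > 0"
  by (rule less_le_trans[OF _ fps_conv_radius_add]) simp

lemma fps_conv_radius_pos_mult:
  "fps_conv_radius f > 0 \<Longrightarrow> fps_conv_radius g > 0 \<Longrightarrow> fps_conv_radius (f * g :: complex fps) > 0"
  by (rule less_le_trans[OF _ fps_conv_radius_mult]) simp

lemma fps_conv_radius_pos_sum:
  "(\<And>i. i \<in> A \<Longrightarrow> fps_conv_radius (f i) > 0) \<Longrightarrow> fps_conv_radius (\<Sum>i\<in>A. f i :: complex fps) > 0"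
  by (induction A rule: infinite_finite_induct) (auto intro: fps_conv_radius_pos_add)

lemma fps_conv_radius_pos_compose_X_power:
  assumes "fps_conv_radius f > 0" "M > 0"
  shows "fps_conv_radius (f oo fps_X ^ M :: complex fps) > 0"
proof -
  have "(eval_fps f \<circ> (\<lambda>x. x ^ M)) has_fps_expansion (f oo fps_X ^ M)"
    using assms by (intro has_fps_expansion_compose has_fps_expansion_fps_X_power)
      (auto simp: has_fps_expansion_def)
  then show ?thesis by (simp add: has_fps_expansion_def)
qed

lemma eval_fps_has_fps_expansion_self: "fps_conv_radius f > 0 \<Longrightarrow> eval_fps f has_fps_expansion f"
  by (simp add: has_fps_expansion_def)

lemma has_fps_expansion_eventually_eq:
  "f has_fps_expansion F \<Longrightarrow> g has_fps_expansion F \<Longrightarrow> eventually (\<lambda>z. f z = g z) (nhds 0)"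
  unfolding has_fps_expansion_def by (auto elim: eventually_elim2)

definition conv_coeffs :: "complex fps poly \<Rightarrow> bool" where
  "conv_coeffs G \<longleftrightarrow> (\<forall>k. fps_conv_radius (coeff G k) > 0)"

lemma conv_coeffs_0 [simp]: "conv_coeffs 0"
  by (simp add: conv_coeffs_def)

lemma conv_coeffs_pCons [simp]: "conv_coeffs (pCons a G) \<longleftrightarrow> fps_conv_radius a > 0 \<and> conv_coeffs G"
  unfolding conv_coeffs_def by (metis coeff_pCons_0 coeff_pCons_Suc not0_implies_Suc)

lemma conv_coeffs_add: "conv_coeffs G \<Longrightarrow> conv_coeffs H \<Longrightarrow> conv_coeffs (G + H)"
  by (simp add: conv_coeffs_def fps_conv_radius_pos_add)

lemma conv_coeffs_mult: "conv_coeffs G \<Longrightarrow> conv_coeffs H \<Longrightarrow> conv_coeffs (G * H)"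
  by (auto simp: conv_coeffs_def coeff_mult intro!: fps_conv_radius_pos_sum fps_conv_radius_pos_mult)

lemma conv_coeffs_pcompose: "conv_coeffs G \<Longrightarrow> conv_coeffs H \<Longrightarrow> conv_coeffs (pcompose G H)"
  by (induction G) (auto simp: pcompose_pCons intro!: conv_coeffs_add conv_coeffs_mult)

definition eval_coeffs :: "complex fps poly \<Rightarrow> complex \<Rightarrow> complex poly" where
  "eval_coeffs G x = map_poly (\<lambda>c. eval_fps c x) G"

lemma coeff_eval_coeffs: "coeff (eval_coeffs G x) k = eval_fps (coeff G k) x"
  by (simp add: eval_coeffs_def coeff_map_poly)

lemma degree_eval_coeffs_le: "degree (eval_coeffs G x) \<le> degree G"
  by (rule degree_le) (simp add: coeff_eval_coeffs coeff_eq_0)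

lemma eval_coeffs_monic:
  assumes "lead_coeff G = 1"
  shows "degree (eval_coeffs G x) = degree G" "lead_coeff (eval_coeffs G x) = 1"
  by (rule monic_polyI[of _ "degree G"]; simp add: coeff_eval_coeffs assms coeff_eq_0)+

lemma conv_coeffs_imp_expansion:
  assumes "conv_coeffs G"
  shows "(\<lambda>x. coeff (eval_coeffs G x) k) has_fps_expansion coeff G k"
  using assms by (simp add: coeff_eval_coeffs conv_coeffs_def eval_fps_has_fps_expansion_self)

lemma eval_coeffs_unique:
  assumes "conv_coeffs G" "conv_coeffs H" "eventually (\<lambda>x. eval_coeffs G x = eval_coeffs H x) (nhds 0)"
  shows "G = H"
proof (rule poly_eqI)
  fix k
  have agree: "eventually (\<lambda>x. coeff (eval_coeffs G x) k = coeff (eval_coeffs H x) k) (nhds 0)"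
    using assms(3) by eventually_elim simp
  have "(\<lambda>x. coeff (eval_coeffs H x) k) has_fps_expansion coeff G k"
    using conv_coeffs_imp_expansion[OF assms(1), of k] has_fps_expansion_cong[OF agree refl] by simp
  then show "coeff G k = coeff H k"
    using conv_coeffs_imp_expansion[OF assms(2)] fps_expansion_unique_complex by blast
qed

lemma eventually_eq_eval_coeffs:
  assumes expansion: "\<And>k. (\<lambda>x. coeff (p x) k) has_fps_expansion coeff G k"
    and degree: "eventually (\<lambda>x. degree (p x) \<le> d) (nhds 0)"
  shows "conv_coeffs G" "eventually (\<lambda>x. p x = eval_coeffs G x) (nhds 0)"
proof -
  show conv: "conv_coeffs G" using expansion by (auto simp: conv_coeffs_def has_fps_expansion_def)
  define n where "n = max d (degree G)"
  have "eventually (\<lambda>x. \<forall>k\<in>{..n}. coeff (p x) k = coeff (eval_coeffs G x) k) (nhds 0)"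
    using has_fps_expansion_eventually_eq[OF expansion conv_coeffs_imp_expansion[OF conv]]
    by (intro eventually_ball_finite) auto
  with degree show "eventually (\<lambda>x. p x = eval_coeffs G x) (nhds 0)"
  proof eventually_elim
    case (elim x)
    show ?case
    proof (rule poly_eqI)
      fix k
      show "coeff (p x) k = coeff (eval_coeffs G x) k"
      proof (cases "k \<le> n")
        case False
        then show ?thesis
          using elim(1) degree_eval_coeffs_le[of G x] by (simp add: n_def coeff_eq_0)
      qed (use elim(2) in simp)
    qed
  qed
qed

lemma eventually_eval_coeffs_mult:
  assumes "conv_coeffs G" "conv_coeffs H"
  shows "eventually (\<lambda>x. eval_coeffs (G * H) x = eval_coeffs G x * eval_coeffs H x) (nhds 0)"
proof -
  have "(\<lambda>x. coeff (eval_coeffs G x * eval_coeffs H x) k) has_fps_expansion coeff (G * H) k" for k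
    unfolding coeff_mult using assms
    by (intro has_fps_expansion_sum has_fps_expansion_mult conv_coeffs_imp_expansion)
  moreover have "degree (eval_coeffs G x * eval_coeffs H x) \<le> degree G + degree H" for x
    by (meson add_mono degree_eval_coeffs_le degree_mult_le order_trans)
  ultimately have "eventually (\<lambda>x. eval_coeffs G x * eval_coeffs H x = eval_coeffs (G * H) x) (nhds 0)"
    by (intro eventually_eq_eval_coeffs(2)[where d = "degree G + degree H"]) auto
  then show ?thesis by eventually_elim simp
qed

lemma obtain_poly_family_eval_coeffs:
  assumes "conv_coeffs G"
  obtains r where "r > 0" "poly_family (ball 0 r) (degree G) (eval_coeffs G)"
proof -
  have "eval_fps (coeff G k) analytic_on {0}" for k
    using assms by (auto simp: conv_coeffs_def
        intro: has_fps_expansion_imp_analytic_0[OF eval_fps_has_fps_expansion_self])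
  then have "\<forall>k. \<exists>S. open S \<and> 0 \<in> S \<and> eval_fps (coeff G k) holomorphic_on S"
    unfolding analytic_at by blast
  from choice[OF this] obtain S
    where S: "\<And>k. open (S k) \<and> 0 \<in> S k \<and> eval_fps (coeff G k) holomorphic_on S k" by blast
  have "open (\<Inter>k\<in>{..degree G}. S k)" using S by (intro open_INT) auto
  moreover have "0 \<in> (\<Inter>k\<in>{..degree G}. S k)" using S by simp
  ultimately obtain r where r: "r > 0" "ball 0 r \<subseteq> (\<Inter>k\<in>{..degree G}. S k)"
    by (rule openE)
  have "(\<lambda>x. coeff (eval_coeffs G x) k) holomorphic_on ball 0 r" for k
  proof (cases "k \<le> degree G")
    case True
    then have "ball 0 r \<subseteq> S k" using r(2) by auto
    then have "eval_fps (coeff G k) holomorphic_on ball 0 r" using S[of k] by (blast intro: holomorphic_on_subset)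
    then show ?thesis by (simp add: coeff_eval_coeffs)
  qed (simp add: coeff_eval_coeffs coeff_eq_0)
  then show ?thesis by (intro that[OF r(1)]) (simp add: poly_family_def degree_eval_coeffs_le)
qed

lemma obtain_eval_coeffs_of_poly_family:
  assumes p: "poly_family (ball 0 r) d p" and "r > 0"
    and monic: "\<And>x. x \<in> ball 0 r \<Longrightarrow> degree (p x) = d \<and> lead_coeff (p x) = 1"
  obtains P where "conv_coeffs P" "degree P = d" "lead_coeff P = 1"
    "eventually (\<lambda>x. p x = eval_coeffs P x) (nhds 0)"
proof -
  have near: "eventually (\<lambda>x. x \<in> ball 0 r) (nhds (0::complex))"
    using \<open>r > 0\<close> by (intro eventually_nhds_in_open) auto
  define P where "P = (\<Sum>k\<le>d. monom (fps_expansion (\<lambda>x. coeff (p x) k) 0) k)"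
  have coeff_P: "coeff P k = (if k \<le> d then fps_expansion (\<lambda>x. coeff (p x) k) 0 else 0)" for k
    by (simp add: P_def coeff_sum coeff_monom)
  have expansion: "(\<lambda>x. coeff (p x) k) has_fps_expansion coeff P k" for k
  proof (cases "k \<le> d")
    case True
    then show ?thesis
      using p \<open>r > 0\<close> by (auto simp: coeff_P poly_family_def intro!: has_fps_expansion_fps_expansion[of "ball 0 r"])
  next
    case False
    have "eventually (\<lambda>x. coeff (p x) k = 0) (nhds 0)"
      using near by eventually_elim (use False monic in \<open>auto intro: coeff_eq_0\<close>)
    then show ?thesis using False by (simp add: coeff_P has_fps_expansion_0_iff)
  qed
  have lead: "eventually (\<lambda>x. coeff (p x) d = 1) (nhds 0)"
    using near by eventually_elim (use monic in auto)
  have "(\<lambda>x. 1) has_fps_expansion coeff P d"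
    using expansion[of d] has_fps_expansion_cong[OF lead refl] by simp
  then have "coeff P d = 1" using has_fps_expansion_1 fps_expansion_unique_complex by blast
  then have "degree P = d" "lead_coeff P = 1" by (rule monic_polyI[of _ d]; simp add: coeff_P)+
  moreover have "eventually (\<lambda>x. degree (p x) \<le> d) (nhds 0)"
    using near by eventually_elim (use monic in auto)
  ultimately show ?thesis using that eventually_eq_eval_coeffs[OF expansion] by blast
qed

lemma poly_family_isolating_circle:
  assumes g: "poly_family S d g" and S: "open S" "x0 \<in> S" and "g x0 \<noteq> 0"
  shows "\<exists>\<epsilon> r. \<epsilon> > 0 \<and> (\<forall>y. poly (g x0) y = 0 \<longrightarrow> y \<noteq> \<alpha> \<longrightarrow> y \<notin> ball \<alpha> \<epsilon>) \<and> r > 0 \<and> ball x0 r \<subseteq> S \<and>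
    (\<forall>x\<in>ball x0 r. \<forall>y\<in>sphere \<alpha> \<epsilon>. poly (g x) y \<noteq> 0)"
proof -
  obtain \<delta> where \<delta>: "\<delta> > 0" "\<And>y. poly (g x0) y = 0 \<Longrightarrow> y \<noteq> \<alpha> \<Longrightarrow> \<delta> \<le> dist \<alpha> y"
    using finite_set_avoid[OF poly_roots_finite, of "g x0" \<alpha>] \<open>g x0 \<noteq> 0\<close> by blast
  have "poly (g x0) y \<noteq> 0" if "y \<in> sphere \<alpha> (\<delta> / 2)" for y
  proof -
    have "dist \<alpha> y < \<delta>" "y \<noteq> \<alpha>" using that \<delta>(1) by auto
    then show ?thesis using \<delta>(2)[of y] by linarith
  qed
  then obtain r where "r > 0" "ball x0 r \<subseteq> S" "\<forall>x\<in>ball x0 r. \<forall>y\<in>sphere \<alpha> (\<delta> / 2). poly (g x) y \<noteq> 0"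
    using poly_family_no_roots_nearby[OF g, of x0 "sphere \<alpha> (\<delta> / 2)"] S by auto
  moreover have "y \<notin> ball \<alpha> (\<delta> / 2)" if "poly (g x0) y = 0" "y \<noteq> \<alpha>" for y
    using \<delta>(2)[OF that] \<delta>(1) by simp
  ultimately show ?thesis using \<delta>(1) by (intro exI[of _ "\<delta> / 2"] exI[of _ r]) simp
qed

lemma monic_fps_poly_split_at_circle:
  assumes monic: "lead_coeff G = 1" and conv: "conv_coeffs G"
    and family: "poly_family (ball 0 r) d (eval_coeffs G)" "d = degree G" and pos: "r > 0" "\<epsilon> > 0"
    and no_roots: "\<forall>x\<in>ball 0 r. \<forall>y\<in>sphere \<alpha> \<epsilon>. poly (eval_coeffs G x) y \<noteq> 0"
  shows "\<exists>P Q A B. G = P * Q \<and> lead_coeff P = 1 \<and> lead_coeff Q = 1 \<and> conv_coeffs P \<and> conv_coeffs Q \<and>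
    degree P = size A \<and> degree Q = size B \<and> eval_coeffs G 0 = poly_of_roots A * poly_of_roots B \<and>
    set_mset A \<subseteq> ball \<alpha> \<epsilon> \<and> set_mset B \<inter> ball \<alpha> \<epsilon> = {}"
proof -
  have monic_eval: "degree (eval_coeffs G x) = d \<and> lead_coeff (eval_coeffs G x) = 1" for x
    using eval_coeffs_monic[OF monic] family(2) by simp
  obtain A B m n where factors: "\<forall>x\<in>ball 0 r. eval_coeffs G x = poly_of_roots (A x) * poly_of_roots (B x)"
    and sizes: "\<forall>x\<in>ball 0 r. size (A x) = m \<and> size (B x) = n"
    and roots: "\<forall>x\<in>ball 0 r. set_mset (A x) \<subseteq> ball \<alpha> \<epsilon> \<and> set_mset (B x) \<inter> ball \<alpha> \<epsilon> = {}"
    and families: "poly_family (ball 0 r) m (\<lambda>x. poly_of_roots (A x))"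
      "poly_family (ball 0 r) n (\<lambda>x. poly_of_roots (B x))"
    using poly_family_split[OF family(1) monic_eval open_ball convex_ball pos(2)] no_roots by blast
  obtain P where P: "conv_coeffs P" "degree P = m" "lead_coeff P = 1"
    "eventually (\<lambda>x. poly_of_roots (A x) = eval_coeffs P x) (nhds 0)"
    using obtain_eval_coeffs_of_poly_family[OF families(1) pos(1)] sizes lead_coeff_poly_of_roots
    by (metis degree_poly_of_roots)
  obtain Q where Q: "conv_coeffs Q" "degree Q = n" "lead_coeff Q = 1"
    "eventually (\<lambda>x. poly_of_roots (B x) = eval_coeffs Q x) (nhds 0)"
    using obtain_eval_coeffs_of_poly_family[OF families(2) pos(1)] sizes lead_coeff_poly_of_roots
    by (metis degree_poly_of_roots)
  have "eventually (\<lambda>x. x \<in> ball 0 r) (nhds (0::complex))"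
    using pos(1) by (intro eventually_nhds_in_open) auto
  then have "eventually (\<lambda>x. eval_coeffs G x = eval_coeffs (P * Q) x) (nhds 0)"
    using P(4) Q(4) eventually_eval_coeffs_mult[OF P(1) Q(1)]
    by eventually_elim (use factors in simp)
  then have "G = P * Q" using conv P(1) Q(1) conv_coeffs_mult by (intro eval_coeffs_unique)
  moreover have "0 \<in> ball (0::complex) r" using pos(1) by simp
  ultimately show ?thesis
    using P Q factors sizes roots
    by (intro exI[of _ P] exI[of _ Q] exI[of _ "A 0"] exI[of _ "B 0"]) simp
qed

theorem monic_fps_poly_split:
  assumes monic: "lead_coeff G = 1" and conv: "conv_coeffs G"
    and roots: "\<alpha> \<noteq> \<beta>" "poly (eval_coeffs G 0) \<alpha> = 0" "poly (eval_coeffs G 0) \<beta> = 0"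
  obtains P Q where "G = P * Q" "lead_coeff P = 1" "lead_coeff Q = 1" "degree P < degree G" "degree Q < degree G"
    "conv_coeffs P" "conv_coeffs Q"
proof -
  obtain R where R: "R > 0" "poly_family (ball 0 R) (degree G) (eval_coeffs G)"
    using obtain_poly_family_eval_coeffs[OF conv] by auto
  have "eval_coeffs G 0 \<noteq> 0" using eval_coeffs_monic[OF monic, of 0] by auto
  moreover have "0 \<in> ball (0 :: complex) R" using R(1) by simp
  ultimately obtain \<epsilon> r where \<epsilon>: "\<epsilon> > 0" "\<forall>y. poly (eval_coeffs G 0) y = 0 \<longrightarrow> y \<noteq> \<alpha> \<longrightarrow> y \<notin> ball \<alpha> \<epsilon>"
    and r: "r > 0" "ball (0::complex) r \<subseteq> ball 0 R"
    and no_roots: "\<forall>x\<in>ball 0 r. \<forall>y\<in>sphere \<alpha> \<epsilon>. poly (eval_coeffs G x) y \<noteq> 0"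
    using poly_family_isolating_circle[OF R(2) open_ball] by blast
  obtain P Q A B where PQ: "G = P * Q" "lead_coeff P = 1" "lead_coeff Q = 1" "conv_coeffs P" "conv_coeffs Q"
    and AB: "degree P = size A" "degree Q = size B" "eval_coeffs G 0 = poly_of_roots A * poly_of_roots B"
      "set_mset A \<subseteq> ball \<alpha> \<epsilon>" "set_mset B \<inter> ball \<alpha> \<epsilon> = {}"
    using monic_fps_poly_split_at_circle[OF monic conv poly_family_subset[OF R(2) r(2)] refl r(1) \<epsilon>(1) no_roots] by blast
  have "poly (eval_coeffs G 0) y = 0 \<longleftrightarrow> y \<in># A \<or> y \<in># B" for y
    by (simp add: AB(3) poly_poly_of_roots_eq_0_iff)
  moreover have "\<alpha> \<in> ball \<alpha> \<epsilon>" "\<beta> \<notin> ball \<alpha> \<epsilon>" using \<epsilon> roots by simp_all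
  ultimately have "\<alpha> \<in># A" "\<beta> \<in># B" using roots(2,3) AB(4,5) by blast+
  then have "degree P > 0" "degree Q > 0" unfolding AB(1,2) by (auto intro: gr0I)
  moreover have "degree G = degree P + degree Q"
    using PQ(2,3) unfolding PQ(1) by (intro degree_mult_eq) auto
  ultimately show ?thesis using that PQ by simp
qed

section \<open>Puiseux's theorem\<close>

lemma fps_compose_X_power_mult:
  "M > 0 \<Longrightarrow> (f * g) oo fps_X ^ M = (f oo fps_X ^ M) * (g oo fps_X ^ M :: 'a::idom fps)"
  by (simp add: fps_compose_mult_distrib)

lemma fps_X_power_compose_X_power: "N > 0 \<Longrightarrow> fps_X ^ M oo fps_X ^ N = (fps_X ^ (M * N) :: 'a::idom fps)"
  by (simp add: fps_X_power_compose power_mult[symmetric] mult.commute)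

lemma fps_compose_X_power_compose:
  "M > 0 \<Longrightarrow> N > 0 \<Longrightarrow> (f oo fps_X ^ M) oo fps_X ^ N = (f oo fps_X ^ (M * N) :: 'a::idom fps)"
  by (simp add: fps_compose_assoc[symmetric] fps_X_power_compose_X_power)

definition poly_ramify :: "nat \<Rightarrow> 'a::idom fps poly \<Rightarrow> 'a fps poly" where
  "poly_ramify M = map_poly (\<lambda>f. f oo fps_X ^ M)"

lemma coeff_poly_ramify: "coeff (poly_ramify M G) k = coeff G k oo fps_X ^ M"
  by (simp add: poly_ramify_def coeff_map_poly)

lemma poly_ramify_mult: "M > 0 \<Longrightarrow> poly_ramify M (G * H) = poly_ramify M G * poly_ramify M H"
  unfolding poly_ramify_def
  by (rule map_poly_mult_hom) (simp_all add: fps_compose_add_distrib fps_compose_X_power_mult)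

lemma poly_ramify_pcompose:
  assumes "M > 0"
  shows "poly_ramify M (pcompose G H) = pcompose (poly_ramify M G) (poly_ramify M H)"
proof (induction G)
  case (pCons a G)
  have "poly_ramify M (pcompose (pCons a G) H) = [:a oo fps_X ^ M:] + poly_ramify M (H * pcompose G H)"
    by (simp add: pcompose_pCons poly_ramify_def map_poly_add_hom fps_compose_add_distrib map_poly_pCons)
  also have "\<dots> = pcompose (poly_ramify M (pCons a G)) (poly_ramify M H)"
    unfolding poly_ramify_mult[OF assms] pCons.IH by (simp add: pcompose_pCons poly_ramify_def map_poly_pCons)
  finally show ?case .
qed (simp add: poly_ramify_def)

lemma degree_poly_ramify: "M > 0 \<Longrightarrow> degree (poly_ramify M G) = degree G"
  unfolding poly_ramify_def by (rule degree_map_poly) (simp add: fps_compose_eq_0_iff)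

definition puiseux_splits :: "nat \<Rightarrow> complex fps poly \<Rightarrow> bool" where
  "puiseux_splits M G \<longleftrightarrow> (\<exists>Y. (\<forall>y\<in>#Y. fps_conv_radius y > 0) \<and> poly_ramify M G = poly_of_roots Y)"

lemma puiseux_splits_mult:
  assumes "M > 0" "puiseux_splits M P" "puiseux_splits M Q"
  shows "puiseux_splits M (P * Q)"
proof -
  obtain Y Z where "\<forall>y\<in>#Y. fps_conv_radius y > 0" "poly_ramify M P = poly_of_roots Y"
    "\<forall>y\<in>#Z. fps_conv_radius y > 0" "poly_ramify M Q = poly_of_roots Z"
    using assms(2,3) unfolding puiseux_splits_def by blast
  then show ?thesis unfolding puiseux_splits_def poly_ramify_mult[OF assms(1)]
    by (intro exI[of _ "Y + Z"]) auto
qed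

lemma pcompose_poly_of_roots_shift:
  "pcompose (poly_of_roots A) [:- c, 1:] = poly_of_roots (image_mset (\<lambda>a. a + c) A)"
proof (induction A)
  case (add a A)
  have "pcompose [:- a, 1:] [:- c, 1:] = [:- (a + c), 1:]" by (simp add: pcompose_pCons)
  with add show ?case by (simp only: poly_of_roots_add_mset pcompose_mult image_mset_add_mset)
qed (simp add: pcompose_1)

lemma puiseux_splits_shift:
  assumes "M > 0" and splits: "puiseux_splits M (pcompose G [:c, 1:])" and "fps_conv_radius c > 0"
  shows "puiseux_splits M G"
proof -
  define c' where "c' = c oo fps_X ^ M"
  obtain Y where Y: "\<forall>y\<in>#Y. fps_conv_radius y > 0" "poly_ramify M (pcompose G [:c, 1:]) = poly_of_roots Y"
    using splits unfolding puiseux_splits_def by blast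
  have "G = pcompose (pcompose G [:c, 1:]) [:- c, 1:]"
    by (simp add: pcompose_assoc[symmetric] pcompose_pCons)
  then have "poly_ramify M G = pcompose (poly_of_roots Y) (poly_ramify M [:- c, 1:])"
    using poly_ramify_pcompose[OF assms(1), of "pcompose G [:c, 1:]" "[:- c, 1:]"] Y(2) by simp
  also have "poly_ramify M [:- c, 1:] = [:- c', 1:]"
    by (simp add: poly_ramify_def map_poly_pCons c'_def fps_compose_uminus)
  finally have "poly_ramify M G = poly_of_roots (image_mset (\<lambda>y. y + c') Y)"
    by (simp only: pcompose_poly_of_roots_shift)
  moreover have "fps_conv_radius c' > 0"
    unfolding c'_def by (intro fps_conv_radius_pos_compose_X_power assms)
  then have "\<forall>y\<in>#image_mset (\<lambda>y. y + c') Y. fps_conv_radius y > 0"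
    using Y(1) by (auto intro: fps_conv_radius_pos_add)
  ultimately show ?thesis unfolding puiseux_splits_def by blast
qed

lemma coeff_pcompose_shift:
  fixes p :: "'a::comm_ring_1 poly"
  assumes "degree p \<le> Suc n"
  shows "coeff (pcompose p [:c, 1:]) n = coeff p n + of_nat (Suc n) * c * coeff p (Suc n)"
proof -
  have "coeff (pcompose p [:c, 1:]) (Suc n) = coeff p (Suc n) \<and>
      coeff (pcompose p [:c, 1:]) n = coeff p n + of_nat (Suc n) * c * coeff p (Suc n)"
    using assms
  proof (induction p arbitrary: n)
    case (pCons a p)
    define q where "q = pcompose p [:c, 1:]"
    have comp: "pcompose (pCons a p) [:c, 1:] = pCons a q + smult c q"
      by (simp add: pcompose_pCons q_def)
    have degree_p: "degree p \<le> n" using pCons.prems by (simp split: if_splits)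
    then have "degree q \<le> n" using degree_pcompose_le[of p "[:c, 1:]"] by (simp add: q_def)
    then have "coeff q (Suc n) = 0" "coeff p (Suc n) = 0" using degree_p by (simp_all add: coeff_eq_0)
    show ?case
    proof (cases n)
      case 0
      then obtain b where "p = [:b:]" using degree_p degree_eq_zeroE by auto
      then show ?thesis by (simp add: comp q_def 0 pcompose_pCons algebra_simps)
    next
      case (Suc k)
      then show ?thesis
        using pCons.IH[of k] degree_p \<open>coeff q (Suc n) = 0\<close> by (simp add: comp q_def[symmetric] algebra_simps)
    qed
  qed simp
  then show ?thesis ..
qed

lemma obtain_tschirnhaus_shift:
  assumes monic: "degree G = Suc n" "lead_coeff G = 1" and conv: "conv_coeffs G"
  obtains c where "fps_conv_radius c > 0" "degree (pcompose G [:c, 1:]) = Suc n"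
    "lead_coeff (pcompose G [:c, 1:]) = 1" "conv_coeffs (pcompose G [:c, 1:])" "coeff (pcompose G [:c, 1:]) n = 0"
proof
  define c where "c = - fps_const (1 / of_nat (Suc n)) * coeff G n"
  have "of_nat (Suc n) * fps_const (1 / of_nat (Suc n)) = (1 :: complex fps)"
    by (simp flip: fps_of_nat del: of_nat_Suc)
  then have "of_nat (Suc n) * c = - coeff G n"
    by (simp only: c_def mult_minus_left mult_minus_right mult.assoc[symmetric] mult_1)
  then show "coeff (pcompose G [:c, 1:]) n = 0"
    using coeff_pcompose_shift[of G n c] monic by simp
  show "fps_conv_radius c > 0"
    unfolding c_def using conv by (intro fps_conv_radius_pos_mult) (auto simp: conv_coeffs_def)
  then show "conv_coeffs (pcompose G [:c, 1:])" using conv by (intro conv_coeffs_pcompose) auto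
  show "degree (pcompose G [:c, 1:]) = Suc n" using monic(1) by (simp add: degree_pcompose)
  show "lead_coeff (pcompose G [:c, 1:]) = 1"
    using monic lead_coeff_comp[of "[:c, 1:]" G] by simp
qed

lemma obtain_two_roots:
  fixes p :: "complex poly"
  assumes monic: "lead_coeff p = 1" "degree p = Suc n" and "coeff p n = 0" and "p \<noteq> monom 1 (Suc n)"
  obtains \<alpha> \<beta> where "\<alpha> \<noteq> \<beta>" "poly p \<alpha> = 0" "poly p \<beta> = 0"
proof -
  obtain A where A: "p = poly_of_roots A" using complex_monic_eq_poly_of_roots[OF monic(1)] .
  then have "size A = Suc n" using monic(2) by simp
  then obtain a where "a \<in># A" by (metis Suc_neq_Zero multiset_nonemptyE size_empty)
  have "\<exists>b\<in>#A. b \<noteq> a"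
  proof (rule ccontr)
    assume "\<not> (\<exists>b\<in>#A. b \<noteq> a)"
    then have "A = replicate_mset (Suc n) a"
      using \<open>size A = Suc n\<close> by (metis set_mset_subset_singletonD singletonI subsetI)
    then have "p = [:- a, 1:] ^ Suc n" by (simp add: A poly_of_roots_def)
    moreover then have "of_nat (Suc n) * (- a) = 0"
      using coeff_linear_poly_power[of n "Suc n" "- a" 1] \<open>coeff p n = 0\<close> by simp
    then have "a = 0" by (simp del: of_nat_Suc)
    ultimately show False using \<open>p \<noteq> monom 1 (Suc n)\<close> by (simp add: monom_altdef)
  qed
  then show ?thesis
    using that \<open>a \<in># A\<close> poly_poly_of_roots_eq_0_iff[of A] by (auto simp: A)
qed

lemma obtain_least_newton_slope:
  fixes H :: "'a::idom fps poly"
  assumes monic: "degree H = m" "lead_coeff H = 1" and "H \<noteq> monom 1 m"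
  obtains p where "\<And>k. k < m \<Longrightarrow> enat (p * (m - k)) \<le> fps_order (coeff H k oo fps_X ^ fact m)"
    "\<exists>k<m. fps_order (coeff H k oo fps_X ^ fact m) = enat (p * (m - k))"
proof -
  define A where "A = {k. k < m \<and> coeff H k \<noteq> 0}"
  have "A \<noteq> {}"
  proof
    assume "A = {}"
    then have "coeff H k = coeff (monom 1 m) k" for k
      using monic by (cases k m rule: linorder_cases) (auto simp: A_def coeff_eq_0)
    then show False using \<open>H \<noteq> monom 1 m\<close> by (auto intro: poly_eqI)
  qed
  define slope where "slope k = subdegree (coeff H k) * (fact m div (m - k))" for k
  have order: "fps_order (coeff H k oo fps_X ^ fact m) = enat (slope k * (m - k))" if "k \<in> A" for k
  proof -
    have "fact m div (m - k) * (m - k) = (fact m :: nat)"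
      using that by (intro dvd_div_mult_self dvd_fact) (auto simp: A_def)
    then show ?thesis
      using that by (simp add: A_def fps_order_def slope_def mult.assoc fps_compose_eq_0_iff fps_X_power_subdegree)
  qed
  have "Min (slope ` A) \<in> slope ` A" using \<open>A \<noteq> {}\<close> by (intro Min_in) (auto simp: A_def)
  then obtain k where k: "k \<in> A" "Min (slope ` A) = slope k" by blast
  show ?thesis
  proof (rule that)
    show "\<exists>k<m. fps_order (coeff H k oo fps_X ^ fact m) = enat (Min (slope ` A) * (m - k))"
      using k order[OF k(1)] by (intro exI[of _ k]) (simp add: A_def)
    show "enat (Min (slope ` A) * (m - k)) \<le> fps_order (coeff H k oo fps_X ^ fact m)" if "k < m" for k
    proof (cases "k \<in> A")
      case True
      have "Min (slope ` A) \<le> slope k" by (rule Min_le) (use True in \<open>auto simp: A_def\<close>)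
      then show ?thesis using order[OF True] by simp
    next
      case False
      then show ?thesis using that by (simp add: A_def fps_order_def)
    qed
  qed
qed

lemma obtain_newton_polygon_rescaling:
  assumes monic: "degree H = m" "lead_coeff H = 1" and conv: "conv_coeffs H" and "H \<noteq> monom 1 m"
  obtains K p where "degree K = m" "lead_coeff K = 1" "conv_coeffs K"
    "\<And>k. k \<le> m \<Longrightarrow> coeff H k oo fps_X ^ fact m = coeff K k * fps_X ^ (p * (m - k))"
    "\<exists>k<m. fps_nth (coeff K k) 0 \<noteq> 0"
proof -
  obtain p where p: "\<And>k. k < m \<Longrightarrow> enat (p * (m - k)) \<le> fps_order (coeff H k oo fps_X ^ fact m)"
    and attained: "\<exists>k<m. fps_order (coeff H k oo fps_X ^ fact m) = enat (p * (m - k))"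
    by (rule obtain_least_newton_slope[OF monic \<open>H \<noteq> monom 1 m\<close>]) (rule that)
  define h where "h k = fps_shift (p * (m - k)) (coeff H k oo fps_X ^ fact m)" for k
  have scale: "coeff H k oo fps_X ^ fact m = h k * fps_X ^ (p * (m - k))" if "k \<le> m" for k
  proof (cases "k = m")
    case False
    then show ?thesis
      using p[of k] that by (auto simp: h_def fps_eq_iff fps_X_power_mult_right_nth enat_le_fps_order_iff)
  qed (simp add: h_def)
  define K where "K = (\<Sum>k\<le>m. monom (h k) k)"
  have coeff_K: "coeff K k = (if k \<le> m then h k else 0)" for k by (simp add: K_def coeff_sum coeff_monom)
  have "coeff K m = 1" using monic by (simp add: coeff_K h_def)
  then have "degree K = m" "lead_coeff K = 1" by (rule monic_polyI[of _ m]; simp add: coeff_K)+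
  moreover have "fps_conv_radius (h k) > 0" for k
    using fps_conv_radius_pos_compose_X_power[of "coeff H k" "fact m"] conv by (simp add: h_def conv_coeffs_def)
  then have "conv_coeffs K" by (simp add: conv_coeffs_def coeff_K)
  moreover have "\<exists>k<m. fps_nth (coeff K k) 0 \<noteq> 0"
    using attained by (auto simp: coeff_K h_def fps_order_eq_enat_iff)
  ultimately show ?thesis using that[of K p] scale by (simp add: coeff_K)
qed

lemma puiseux_splits_rescale:
  assumes "q > 0" "N > 0" and "degree H = m" "degree K = m"
    and scale: "\<And>k. k \<le> m \<Longrightarrow> coeff H k oo fps_X ^ q = coeff K k * fps_X ^ (p * (m - k))"
    and "puiseux_splits N K"
  shows "puiseux_splits (q * N) H"
proof -
  obtain Y where Y: "\<forall>y\<in>#Y. fps_conv_radius y > 0" "poly_ramify N K = poly_of_roots Y"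
    using assms(6) unfolding puiseux_splits_def by blast
  then have "size Y = m" using \<open>degree K = m\<close> \<open>N > 0\<close> degree_poly_ramify by (metis degree_poly_of_roots)
  define u :: "complex fps" where "u = fps_X ^ (p * N)"
  have "coeff (poly_ramify (q * N) H) k = coeff (poly_of_roots (image_mset ((*) u) Y)) k" for k
  proof (cases "k \<le> m")
    case True
    have "coeff (poly_ramify (q * N) H) k = (coeff K k * fps_X ^ (p * (m - k))) oo fps_X ^ N"
      using assms(1,2) by (simp add: coeff_poly_ramify fps_compose_X_power_compose flip: scale[OF True])
    also have "\<dots> = coeff (poly_of_roots Y) k * u ^ (m - k)"
      using \<open>N > 0\<close> by (simp add: fps_compose_X_power_mult fps_X_power_compose_X_power u_def mult_ac
          flip: Y(2) coeff_poly_ramify power_mult)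
    finally have "coeff (poly_ramify (q * N) H) k * u ^ k = u ^ size Y * coeff (poly_of_roots Y) k"
      using True \<open>size Y = m\<close> by (simp add: mult_ac flip: power_add)
    then show ?thesis by (simp add: coeff_poly_of_roots_scale[symmetric] u_def)
  next
    case False
    then show ?thesis
      using assms(1-3) \<open>size Y = m\<close> by (simp add: coeff_eq_0 degree_poly_ramify)
  qed
  then have "poly_ramify (q * N) H = poly_of_roots (image_mset ((*) u) Y)" by (rule poly_eqI)
  moreover have "\<forall>y\<in>#image_mset ((*) u) Y. fps_conv_radius y > 0"
    using Y(1) by (auto simp: u_def intro!: fps_conv_radius_pos_mult)
  ultimately show ?thesis unfolding puiseux_splits_def by blast
qed

lemma puiseux_splits_tschirnhaus:
  assumes H: "degree H = Suc n" "lead_coeff H = 1" "conv_coeffs H" "coeff H n = 0" and "N > 0"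
    and splits: "\<And>G. degree G < Suc n \<Longrightarrow> lead_coeff G = 1 \<Longrightarrow> conv_coeffs G \<Longrightarrow> puiseux_splits N G"
  shows "puiseux_splits (fact (Suc n) * N) H"
proof (cases "H = monom 1 (Suc n)")
  case True
  then have "H = poly_of_roots (replicate_mset (Suc n) 0)" by (simp add: poly_of_roots_def monom_altdef)
  moreover have "poly_ramify M H = H" for M by (simp add: True poly_ramify_def map_poly_monom)
  ultimately have "poly_ramify (fact (Suc n) * N) H = poly_of_roots (replicate_mset (Suc n) 0)" by metis
  then show ?thesis unfolding puiseux_splits_def by (intro exI[of _ "replicate_mset (Suc n) 0"]) auto
next
  case False
  obtain K p where K: "degree K = Suc n" "lead_coeff K = 1" "conv_coeffs K"
    and scale: "\<And>k. k \<le> Suc n \<Longrightarrow> coeff H k oo fps_X ^ fact (Suc n) = coeff K k * fps_X ^ (p * (Suc n - k))"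
    and "\<exists>k<Suc n. fps_nth (coeff K k) 0 \<noteq> 0"
    by (rule obtain_newton_polygon_rescaling[OF H(1-3) False]) (rule that)
  then have "eval_coeffs K 0 \<noteq> monom 1 (Suc n)"
    by (metis coeff_eval_coeffs coeff_monom eval_fps_at_0 less_irrefl)
  moreover have "coeff K n * fps_X ^ (p * (Suc n - n)) = 0" using scale[of n] H(4) by simp
  then have "coeff (eval_coeffs K 0) n = 0" by (simp add: coeff_eval_coeffs)
  ultimately obtain \<alpha> \<beta> where "\<alpha> \<noteq> \<beta>" "poly (eval_coeffs K 0) \<alpha> = 0" "poly (eval_coeffs K 0) \<beta> = 0"
    using obtain_two_roots[of "eval_coeffs K 0" n] eval_coeffs_monic[OF K(2)] K(1) by metis
  then obtain P Q where PQ: "K = P * Q" "lead_coeff P = 1" "lead_coeff Q = 1" "degree P < Suc n" "degree Q < Suc n"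
    "conv_coeffs P" "conv_coeffs Q"
    using monic_fps_poly_split[OF K(2,3)] K(1) by metis
  then have "puiseux_splits N K" using splits \<open>N > 0\<close> by (simp add: puiseux_splits_mult)
  then show ?thesis by (intro puiseux_splits_rescale[OF _ \<open>N > 0\<close> H(1) K(1) scale]) simp_all
qed

theorem puiseux:
  "\<exists>L>0. \<forall>G M. degree G = m \<longrightarrow> lead_coeff G = 1 \<longrightarrow> conv_coeffs G \<longrightarrow> M > 0 \<longrightarrow> L dvd M \<longrightarrow> puiseux_splits M G"
proof (induction m rule: less_induct)
  case (less m)
  then obtain L where L: "\<And>j. j < m \<Longrightarrow> L j > (0::nat)"
    and splits: "\<And>j G M. j < m \<Longrightarrow> degree G = j \<Longrightarrow> lead_coeff G = 1 \<Longrightarrow> conv_coeffs G \<Longrightarrow> M > 0 \<Longrightarrow> L j dvd M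
      \<Longrightarrow> puiseux_splits M G"
    by metis
  show ?case
  proof (intro exI[of _ "fact m * (\<Prod>j<m. L j)"] conjI allI impI)
    show "fact m * (\<Prod>j<m. L j) > 0" using L by (auto intro!: prod_pos)
  next
    fix G M assume monic: "degree G = m" "lead_coeff G = 1" and conv: "conv_coeffs G"
      and M: "M > 0" "fact m * (\<Prod>j<m. L j) dvd M"
    obtain N where N: "M = fact m * N" "(\<Prod>j<m. L j) dvd N"
      using M(2) by (auto elim!: dvdE simp: mult.assoc)
    have "N > 0" using M(1) N(1) by simp
    show "puiseux_splits M G"
    proof (cases m)
      case 0
      then have "G = 1" using monic by (metis degree_eq_zeroE lead_coeff_pCons(2) one_pCons pCons_0_0 zero_neq_one)
      then show ?thesis unfolding puiseux_splits_def by (intro exI[of _ "{#}"]) (simp add: poly_ramify_def)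
    next
      case (Suc n)
      obtain c where c: "fps_conv_radius c > 0"
        and H: "degree (pcompose G [:c, 1:]) = Suc n" "lead_coeff (pcompose G [:c, 1:]) = 1"
          "conv_coeffs (pcompose G [:c, 1:])" "coeff (pcompose G [:c, 1:]) n = 0"
        by (rule obtain_tschirnhaus_shift[OF monic(1)[unfolded Suc] monic(2) conv]) (rule that)
      have "L j dvd N" if "j < m" for j
        using dvd_trans[OF dvd_prodI N(2), of j] that by auto
      then have "puiseux_splits N P" if "degree P < Suc n" "lead_coeff P = 1" "conv_coeffs P" for P
        using splits[OF _ refl that(2,3) \<open>N > 0\<close>] that(1) Suc by simp
      then have "puiseux_splits M (pcompose G [:c, 1:])"
        unfolding N(1) Suc by (rule puiseux_splits_tschirnhaus[OF H \<open>N > 0\<close>])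
      then show ?thesis by (rule puiseux_splits_shift[OF M(1) _ c])
    qed
  qed
qed

section \<open>Genericity over irreducible sets\<close>

subsection \<open>Polynomial functions\<close>

lemma poly_fun_const: "poly_fun N (\<lambda>z. c)"
  unfolding poly_fun_def by (intro exI[of _ "{\<lambda>_. 0}"] exI[of _ "\<lambda>_. c"]) simp

lemma poly_fun_monomial:
  assumes "\<forall>i\<ge>N. \<alpha> i = 0"
  shows "poly_fun N (\<lambda>z. c * (\<Prod>i<N. z i ^ \<alpha> i))"
  unfolding poly_fun_def using assms by (intro exI[of _ "{\<alpha>}"] exI[of _ "\<lambda>_. c"]) auto

lemma poly_fun_var:
  assumes "i < N"
  shows "poly_fun N (\<lambda>z. z i)"
proof -
  define e where "e j = (if j = i then 1 else 0 :: nat)" for j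
  have "(\<Prod>j<N. z j ^ e j) = (\<Prod>j<N. if j = i then z j else 1)" for z :: "nat \<Rightarrow> complex"
    by (rule prod.cong) (auto simp: e_def)
  then have "1 * (\<Prod>j<N. z j ^ e j) = z i" for z :: "nat \<Rightarrow> complex" using assms by simp
  then show ?thesis using poly_fun_monomial[of N e 1] assms by (simp add: e_def)
qed

lemma poly_fun_add:
  assumes "poly_fun N p" "poly_fun N q"
  shows "poly_fun N (\<lambda>z. p z + q z)"
proof -
  define monomial where "monomial z \<alpha> = (\<Prod>i<N. z i ^ \<alpha> i)" for z :: "nat \<Rightarrow> complex" and \<alpha>
  obtain A a where A: "finite A" "\<forall>\<alpha>\<in>A. \<forall>i\<ge>N. \<alpha> i = 0" and p: "p = (\<lambda>z. \<Sum>\<alpha>\<in>A. a \<alpha> * monomial z \<alpha>)"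
    using assms(1) unfolding poly_fun_def monomial_def by blast
  obtain B b where B: "finite B" "\<forall>\<alpha>\<in>B. \<forall>i\<ge>N. \<alpha> i = 0" and q: "q = (\<lambda>z. \<Sum>\<alpha>\<in>B. b \<alpha> * monomial z \<alpha>)"
    using assms(2) unfolding poly_fun_def monomial_def by blast
  define a' b' where "a' \<alpha> = (if \<alpha> \<in> A then a \<alpha> else 0)" and "b' \<alpha> = (if \<alpha> \<in> B then b \<alpha> else 0)" for \<alpha>
  have "p z = (\<Sum>\<alpha>\<in>A \<union> B. a' \<alpha> * monomial z \<alpha>)" for z
    unfolding p by (rule sum.mono_neutral_cong_left) (use A(1) B(1) in \<open>auto simp: a'_def\<close>)
  moreover have "q z = (\<Sum>\<alpha>\<in>A \<union> B. b' \<alpha> * monomial z \<alpha>)" for z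
    unfolding q by (rule sum.mono_neutral_cong_left) (use A(1) B(1) in \<open>auto simp: b'_def\<close>)
  ultimately have "(\<lambda>z. p z + q z) = (\<lambda>z. \<Sum>\<alpha>\<in>A \<union> B. (a' \<alpha> + b' \<alpha>) * monomial z \<alpha>)"
    by (simp add: distrib_right sum.distrib)
  then show ?thesis unfolding poly_fun_def monomial_def using A B
    by (intro exI[of _ "A \<union> B"] exI[of _ "\<lambda>\<alpha>. a' \<alpha> + b' \<alpha>"]) auto
qed

lemma poly_fun_sum: "(\<And>i. i \<in> I \<Longrightarrow> poly_fun N (f i)) \<Longrightarrow> poly_fun N (\<lambda>z. \<Sum>i\<in>I. f i z)"
  by (induction I rule: infinite_finite_induct) (auto intro: poly_fun_add poly_fun_const)

lemma poly_fun_mult: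
  assumes "poly_fun N p" "poly_fun N q"
  shows "poly_fun N (\<lambda>z. p z * q z)"
proof -
  obtain A a where A: "finite A" "\<forall>\<alpha>\<in>A. \<forall>i\<ge>N. \<alpha> i = 0" and p: "p = (\<lambda>z. \<Sum>\<alpha>\<in>A. a \<alpha> * (\<Prod>i<N. z i ^ \<alpha> i))"
    using assms(1) unfolding poly_fun_def by blast
  obtain B b where B: "finite B" "\<forall>\<alpha>\<in>B. \<forall>i\<ge>N. \<alpha> i = 0" and q: "q = (\<lambda>z. \<Sum>\<alpha>\<in>B. b \<alpha> * (\<Prod>i<N. z i ^ \<alpha> i))"
    using assms(2) unfolding poly_fun_def by blast
  have "(\<lambda>z. p z * q z) = (\<lambda>z. \<Sum>\<alpha>\<in>A. \<Sum>\<beta>\<in>B. (a \<alpha> * b \<beta>) * (\<Prod>i<N. z i ^ (\<alpha> i + \<beta> i)))"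
    unfolding p q sum_product by (simp add: power_add prod.distrib mult_ac)
  moreover have "poly_fun N \<dots>" using A B by (intro poly_fun_sum poly_fun_monomial) auto
  ultimately show ?thesis by simp
qed

lemma zclosed_zeros:
  assumes "poly_fun N p"
  shows "zclosed N {z \<in> aff N. p z = 0}"
  unfolding zclosed_def using assms by (intro exI[of _ "{p}"]) auto

lemma zclosed_empty: "zclosed N {}"
  using zclosed_zeros[OF poly_fun_const[of N 1]] by simp

lemma zclosed_Un:
  assumes "zclosed N F" "zclosed N G"
  shows "zclosed N (F \<union> G)"
proof -
  obtain P where P: "\<forall>p\<in>P. poly_fun N p" and F: "F = {z \<in> aff N. \<forall>p\<in>P. p z = 0}"
    using assms(1) unfolding zclosed_def by blast
  obtain Q where Q: "\<forall>p\<in>Q. poly_fun N p" and G: "G = {z \<in> aff N. \<forall>p\<in>Q. p z = 0}"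
    using assms(2) unfolding zclosed_def by blast
  define S where "S = (\<lambda>(p, q). \<lambda>z. p z * q z) ` (P \<times> Q)"
  have "F \<union> G = {z \<in> aff N. \<forall>p\<in>S. p z = 0}"
    unfolding F G S_def by auto
  moreover have "\<forall>p\<in>S. poly_fun N p" using P Q by (auto simp: S_def intro: poly_fun_mult)
  ultimately show ?thesis unfolding zclosed_def by blast
qed

lemma zopen_zdense_Diff:
  assumes "zirreducible N Z" "zclosed N F" "\<not> Z \<subseteq> F"
  shows "zopen_in N Z (Z - F)" "zdense_in N Z (Z - F)"
proof -
  show "zopen_in N Z (Z - F)" unfolding zopen_in_def using assms(2) by blast
  have "Z \<subseteq> G" if "zclosed N G" "Z - F \<subseteq> G" for G
  proof -
    have "Z \<subseteq> F \<union> G" using that(2) by blast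
    then show ?thesis using assms that(1) unfolding zirreducible_def by blast
  qed
  then show "zdense_in N Z (Z - F)" unfolding zdense_in_def by blast
qed

subsection \<open>Functions of a parameter\<close>

text \<open>A parameter \<open>(z, l)\<close> consists of a coefficient vector \<open>z\<close> and the slope \<open>l = a / b\<close> of the direction of the
  polar \<open>a f\<^sub>x + b f\<^sub>y\<close>.\<close>

definition param_fun :: "nat \<Rightarrow> ((nat \<Rightarrow> complex) \<times> complex \<Rightarrow> complex) \<Rightarrow> bool" where
  "param_fun N h \<longleftrightarrow> (\<exists>P :: (nat \<Rightarrow> complex) \<Rightarrow> complex poly.
     (\<forall>k. poly_fun N (\<lambda>z. coeff (P z) k)) \<and> (\<forall>z l. h (z, l) = poly (P z) l))"

lemma param_fun_poly_fun:
  assumes "poly_fun N p"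
  shows "param_fun N (\<lambda>s. p (fst s))"
proof -
  have "poly_fun N (\<lambda>z. coeff [:p z:] k)" for k
    using assms by (cases k) (simp_all add: poly_fun_const)
  then show ?thesis unfolding param_fun_def by (intro exI[of _ "\<lambda>z. [:p z:]"]) auto
qed

lemma param_fun_const: "param_fun N (\<lambda>s. c)"
  using param_fun_poly_fun[OF poly_fun_const] by simp

lemma param_fun_slope: "param_fun N snd"
  unfolding param_fun_def by (intro exI[of _ "\<lambda>z. [:0, 1:]"]) (auto intro: poly_fun_const)

lemma param_fun_add:
  assumes "param_fun N g" "param_fun N h"
  shows "param_fun N (\<lambda>s. g s + h s)"
proof -
  obtain P where P: "\<forall>k. poly_fun N (\<lambda>z. coeff (P z) k)" "\<forall>z l. g (z, l) = poly (P z) l"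
    using assms(1) unfolding param_fun_def by blast
  obtain Q where Q: "\<forall>k. poly_fun N (\<lambda>z. coeff (Q z) k)" "\<forall>z l. h (z, l) = poly (Q z) l"
    using assms(2) unfolding param_fun_def by blast
  show ?thesis unfolding param_fun_def using P Q
    by (intro exI[of _ "\<lambda>z. P z + Q z"]) (auto intro: poly_fun_add)
qed

lemma param_fun_mult:
  assumes "param_fun N g" "param_fun N h"
  shows "param_fun N (\<lambda>s. g s * h s)"
proof -
  obtain P where P: "\<forall>k. poly_fun N (\<lambda>z. coeff (P z) k)" "\<forall>z l. g (z, l) = poly (P z) l"
    using assms(1) unfolding param_fun_def by blast
  obtain Q where Q: "\<forall>k. poly_fun N (\<lambda>z. coeff (Q z) k)" "\<forall>z l. h (z, l) = poly (Q z) l"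
    using assms(2) unfolding param_fun_def by blast
  show ?thesis unfolding param_fun_def using P Q
    by (intro exI[of _ "\<lambda>z. P z * Q z"]) (auto simp: coeff_mult intro!: poly_fun_sum poly_fun_mult)
qed

lemma param_fun_sum: "(\<And>i. i \<in> I \<Longrightarrow> param_fun N (f i)) \<Longrightarrow> param_fun N (\<lambda>s. \<Sum>i\<in>I. f i s)"
  by (induction I rule: infinite_finite_induct) (auto intro: param_fun_add param_fun_const)

definition param_fps :: "nat \<Rightarrow> ((nat \<Rightarrow> complex) \<times> complex \<Rightarrow> complex fps) \<Rightarrow> bool" where
  "param_fps N S \<longleftrightarrow> (\<forall>i. param_fun N (\<lambda>s. fps_nth (S s) i))"

lemma param_fps_const: "param_fps N (\<lambda>s. f)"
  by (simp add: param_fps_def param_fun_const)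

lemma param_fps_add: "param_fps N S \<Longrightarrow> param_fps N T \<Longrightarrow> param_fps N (\<lambda>s. S s + T s)"
  by (simp add: param_fps_def param_fun_add)

lemma param_fps_mult: "param_fps N S \<Longrightarrow> param_fps N T \<Longrightarrow> param_fps N (\<lambda>s. S s * T s)"
  by (auto simp: param_fps_def fps_mult_nth intro!: param_fun_sum param_fun_mult)

lemma param_fps_uminus: "param_fps N S \<Longrightarrow> param_fps N (\<lambda>s. - S s)"
  using param_fps_mult[OF param_fps_const[of N "-1"]] by simp

lemma param_fps_diff: "param_fps N S \<Longrightarrow> param_fps N T \<Longrightarrow> param_fps N (\<lambda>s. S s - T s)"
  using param_fps_add[OF _ param_fps_uminus, of N S T] by simp

lemma param_fps_sum: "(\<And>i. i \<in> I \<Longrightarrow> param_fps N (f i)) \<Longrightarrow> param_fps N (\<lambda>s. \<Sum>i\<in>I. f i s)"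
  by (induction I rule: infinite_finite_induct) (auto intro: param_fps_add param_fps_const)

lemma param_fps_prod: "(\<And>i. i \<in> I \<Longrightarrow> param_fps N (f i)) \<Longrightarrow> param_fps N (\<lambda>s. \<Prod>i\<in>I. f i s)"
  by (induction I rule: infinite_finite_induct) (auto intro: param_fps_mult param_fps_const)

subsection \<open>Generic properties\<close>

definition generic_on :: "nat \<Rightarrow> (nat \<Rightarrow> complex) set \<Rightarrow> ((nat \<Rightarrow> complex) \<times> complex \<Rightarrow> bool) \<Rightarrow> bool" where
  "generic_on N Z Q \<longleftrightarrow> (\<exists>F. zclosed N F \<and> \<not> Z \<subseteq> F \<and> (\<forall>z\<in>Z - F. finite {l. \<not> Q (z, l)}))"

lemma generic_on_mono:
  assumes "generic_on N Z Q" "\<And>s. Q s \<Longrightarrow> Q' s"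
  shows "generic_on N Z Q'"
proof -
  have "{l. \<not> Q' (z, l)} \<subseteq> {l. \<not> Q (z, l)}" for z using assms(2) by blast
  then show ?thesis using assms(1) unfolding generic_on_def by (meson finite_subset)
qed

lemma generic_on_always:
  assumes "Z \<noteq> {}" "\<And>z l. z \<in> Z \<Longrightarrow> Q (z, l)"
  shows "generic_on N Z Q"
  unfolding generic_on_def using assms zclosed_empty by (intro exI[of _ "{}"]) auto

lemma generic_on_conj:
  assumes Z: "zirreducible N Z" and "generic_on N Z Q" "generic_on N Z Q'"
  shows "generic_on N Z (\<lambda>s. Q s \<and> Q' s)"
proof -
  obtain F where F: "zclosed N F" "\<not> Z \<subseteq> F" "\<And>z. z \<in> Z - F \<Longrightarrow> finite {l. \<not> Q (z, l)}"
    using assms(2) unfolding generic_on_def by blast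
  obtain G where G: "zclosed N G" "\<not> Z \<subseteq> G" "\<And>z. z \<in> Z - G \<Longrightarrow> finite {l. \<not> Q' (z, l)}"
    using assms(3) unfolding generic_on_def by blast
  have "\<not> Z \<subseteq> F \<union> G" using Z F G unfolding zirreducible_def by blast
  moreover have "finite {l. \<not> (Q (z, l) \<and> Q' (z, l))}" if "z \<in> Z - (F \<union> G)" for z
  proof -
    have "{l. \<not> (Q (z, l) \<and> Q' (z, l))} = {l. \<not> Q (z, l)} \<union> {l. \<not> Q' (z, l)}" by auto
    then show ?thesis using F(3)[of z] G(3)[of z] that by simp
  qed
  ultimately show ?thesis unfolding generic_on_def using zclosed_Un[OF F(1) G(1)] by blast
qed

lemma generic_on_ball:
  assumes Z: "zirreducible N Z" and "finite I" "\<And>i. i \<in> I \<Longrightarrow> generic_on N Z (Q i)"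
  shows "generic_on N Z (\<lambda>s. \<forall>i\<in>I. Q i s)"
  using assms(2,3)
proof (induction I rule: finite_induct)
  case empty
  then show ?case using Z by (intro generic_on_always) (auto simp: zirreducible_def)
next
  case (insert i I)
  then show ?case using generic_on_conj[OF Z, of "Q i" "\<lambda>s. \<forall>i\<in>I. Q i s"] by simp
qed

lemma generic_on_nonzero:
  assumes "param_fun N h" "Z \<subseteq> aff N" "z0 \<in> Z" "h (z0, l0) \<noteq> 0"
  shows "generic_on N Z (\<lambda>s. h s \<noteq> 0)"
proof -
  obtain P where P: "\<And>k. poly_fun N (\<lambda>z. coeff (P z) k)" "\<And>z l. h (z, l) = poly (P z) l"
    using assms(1) unfolding param_fun_def by blast
  have "P z0 \<noteq> 0" using assms(4) P(2) by auto
  then obtain k where k: "coeff (P z0) k \<noteq> 0" by (metis leading_coeff_0_iff)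
  define F where "F = {z \<in> aff N. coeff (P z) k = 0}"
  have "zclosed N F" unfolding F_def using P(1) by (rule zclosed_zeros)
  moreover have "\<not> Z \<subseteq> F" using assms(3) k by (auto simp: F_def)
  moreover have "finite {l. \<not> h (z, l) \<noteq> 0}" if "z \<in> Z - F" for z
  proof -
    have "P z \<noteq> 0" using that assms(2) by (auto simp: F_def)
    then show ?thesis using poly_roots_finite by (simp add: P(2))
  qed
  ultimately show ?thesis unfolding generic_on_def by blast
qed

theorem generic_on_fps_order:
  assumes Z: "zirreducible N Z" and S: "param_fps N S"
  obtains d where "generic_on N Z (\<lambda>s. fps_order (S s) = d)"
proof -
  have "Z \<noteq> {}" "Z \<subseteq> aff N" using Z by (auto simp: zirreducible_def)
  define d where "d = (INF s\<in>Z \<times> UNIV. fps_order (S s))"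
  have lower: "d \<le> fps_order (S (z, l))" if "z \<in> Z" for z l
    unfolding d_def using that by (intro INF_lower) auto
  have "generic_on N Z (\<lambda>s. fps_order (S s) = d)"
  proof (cases d)
    case infinity
    then show ?thesis using lower \<open>Z \<noteq> {}\<close> by (intro generic_on_always) auto
  next
    case (enat n)
    have "d \<in> (\<lambda>s. fps_order (S s)) ` (Z \<times> UNIV)"
      unfolding d_def using \<open>Z \<noteq> {}\<close> by (auto intro: wellorder_InfI)
    then obtain z0 l0 where "z0 \<in> Z" "fps_order (S (z0, l0)) = enat n" using enat by auto
    then have "generic_on N Z (\<lambda>s. fps_nth (S s) n \<noteq> 0)"
      using S \<open>Z \<subseteq> aff N\<close> by (intro generic_on_nonzero) (auto simp: param_fps_def fps_order_eq_enat_iff)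
    then obtain F where F: "zclosed N F" "\<not> Z \<subseteq> F" "\<forall>z\<in>Z - F. finite {l. \<not> fps_nth (S (z, l)) n \<noteq> 0}"
      unfolding generic_on_def by blast
    have "{l. fps_order (S (z, l)) \<noteq> d} \<subseteq> {l. \<not> fps_nth (S (z, l)) n \<noteq> 0}" if "z \<in> Z" for z
      using lower[OF that] by (auto simp: enat enat_le_fps_order_iff fps_order_eq_enat_iff)
    then have "\<forall>z\<in>Z - F. finite {l. fps_order (S (z, l)) \<noteq> d}" using F(3) by (meson DiffD1 finite_subset)
    then show ?thesis using F(1,2) unfolding generic_on_def by blast
  qed
  then show ?thesis by (rule that)
qed

section \<open>Contact orders from symmetric functions\<close>

subsection \<open>Least orders and power sums\<close>

lemma fps_order_mult: "fps_order (f * g) = fps_order f + fps_order g" for f g :: "'a::idom fps"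
  by (auto simp: fps_order_def)

lemma fps_order_1 [simp]: "fps_order (1 :: 'a::zero_neq_one fps) = 0"
  by (simp add: fps_order_def zero_enat_def)

lemma fps_order_power: "fps_order (f ^ n) = of_nat n * fps_order f" for f :: "'a::idom fps"
  by (induction n) (simp_all add: fps_order_mult algebra_simps)

lemma fps_order_prod: "fps_order (\<Prod>i\<in>I. f i) = (\<Sum>i\<in>I. fps_order (f i))" for f :: "'i \<Rightarrow> 'a::idom fps"
  by (induction I rule: infinite_finite_induct) (simp_all add: fps_order_mult)

lemma fps_order_compose_X_power:
  fixes f :: "'a::idom fps"
  assumes "M > 0"
  shows "fps_order (f oo fps_X ^ M) = of_nat M * fps_order f"
proof (cases "f = 0")
  case True
  have "of_nat M * (\<infinity> :: enat) = \<infinity>" using assms by (simp add: of_nat_eq_enat)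
  then show ?thesis using True by (simp add: fps_order_def)
next
  case False
  then show ?thesis
    using assms by (simp add: fps_order_def fps_compose_eq_0_iff fps_X_power_subdegree of_nat_eq_enat mult.commute)
qed

lemma fps_order_sum_ge:
  assumes "\<And>i. i \<in> I \<Longrightarrow> d \<le> fps_order (f i)"
  shows "d \<le> fps_order (\<Sum>i\<in>I. f i :: 'a::comm_monoid_add fps)"
proof (cases d)
  case (enat n)
  then show ?thesis using assms by (auto simp: enat_le_fps_order_iff fps_sum_nth intro!: sum.neutral)
next
  case infinity
  then have "(\<Sum>i\<in>I. f i) = 0" using assms by (intro sum.neutral) auto
  then show ?thesis by (simp add: fps_order_def)
qed

lemma fps_nth_power_lowest:
  fixes f :: "'a::idom fps"
  assumes "enat n \<le> fps_order f"
  shows "fps_nth (f ^ l) (l * n) = fps_nth f n ^ l"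
proof -
  have "f = fps_shift n f * fps_X ^ n"
    using assms by (intro fps_ext) (auto simp: fps_X_power_mult_right_nth enat_le_fps_order_iff)
  then have "f ^ l = fps_shift n f ^ l * fps_X ^ (l * n)"
    by (metis power_mult_distrib power_mult mult.commute)
  moreover have "fps_nth (fps_shift n f ^ l) 0 = fps_nth f n ^ l"
    by (induction l) (simp_all add: fps_mult_nth_0)
  ultimately show ?thesis by (simp add: fps_X_power_mult_right_nth)
qed

lemma power_sums_eq_0_imp:
  fixes A :: "'a::{idom, ring_char_0} multiset"
  assumes "\<forall>l\<in>{1..size A}. (\<Sum>a\<in>#A. a ^ l) = 0" and "a \<in># A"
  shows "a = 0"
proof -
  define e where "e = coeff (reflect_poly (poly_of_roots A))"
  have vanishes: "e (Suc n) = 0" if "Suc n \<le> size A" for n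
  proof -
    have "(\<Sum>a\<in>#A. a ^ Suc (n - i)) = 0" if "i \<in> {0..n}" for i
      using assms(1) that \<open>Suc n \<le> size A\<close> by (simp del: power_Suc)
    then have "of_nat (Suc n) * e (Suc n) = 0"
      using newton_identity[of n A] by (simp add: e_def del: power_Suc of_nat_Suc)
    then show ?thesis by (simp del: of_nat_Suc)
  qed
  have "coeff (poly_of_roots A) k = 0" if "k < size A" for k
  proof -
    have "e (size A - k) = 0" using vanishes[of "size A - Suc k"] that by (simp add: Suc_diff_Suc)
    then show ?thesis using that by (simp add: e_def coeff_reflect_poly split: if_splits)
  qed
  moreover have "coeff (poly_of_roots A) (size A) = 1" using lead_coeff_poly_of_roots[of A] by simp
  ultimately have "coeff (poly_of_roots A) k = coeff (monom 1 (size A)) k" for k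
    by (cases k "size A" rule: linorder_cases) (auto simp: coeff_eq_0)
  then have "poly_of_roots A = monom 1 (size A)" by (rule poly_eqI)
  then show ?thesis using poly_poly_of_roots_eq_0_iff[of A a] assms(2) by (simp add: poly_monom)
qed

lemma fps_order_power_sum_ge:
  fixes f :: "'i \<Rightarrow> 'a::idom fps"
  shows "of_nat l * (INF i\<in>I. fps_order (f i)) \<le> fps_order (\<Sum>i\<in>I. f i ^ l)"
  by (rule fps_order_sum_ge) (auto simp: fps_order_power intro!: mult_left_mono INF_lower)

lemma ex_fps_order_power_sum_eq:
  fixes f :: "'i \<Rightarrow> 'a::{idom, ring_char_0} fps"
  assumes "finite I" and INF: "(INF i\<in>I. fps_order (f i)) = enat n"
  shows "\<exists>l\<in>{1..card I}. fps_order (\<Sum>i\<in>I. f i ^ l) = of_nat l * enat n"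
proof -
  have lower: "enat n \<le> fps_order (f i)" if "i \<in> I" for i
    using INF_lower[OF that, of "\<lambda>i. fps_order (f i)"] INF by simp
  have "I \<noteq> {}" using INF by (auto simp: top_enat_def)
  then have "(INF i\<in>I. fps_order (f i)) \<in> (\<lambda>i. fps_order (f i)) ` I" by (auto intro: wellorder_InfI)
  then obtain i where i: "i \<in> I" "fps_order (f i) = enat n" using INF by auto
  define A where "A = image_mset (\<lambda>i. fps_nth (f i) n) (mset_set I)"
  have "fps_nth (f i) n \<noteq> 0" using i(2) by (simp add: fps_order_eq_enat_iff)
  moreover have "fps_nth (f i) n \<in># A" using i(1) \<open>finite I\<close> by (simp add: A_def)
  moreover have "size A = card I" by (simp add: A_def)
  ultimately obtain l where l: "l \<in> {1..card I}" "(\<Sum>a\<in>#A. a ^ l) \<noteq> 0"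
    using power_sums_eq_0_imp by metis
  have "fps_nth (\<Sum>i\<in>I. f i ^ l) (l * n) = (\<Sum>a\<in>#A. a ^ l)"
    using fps_nth_power_lowest[OF lower]
    by (simp add: fps_sum_nth A_def sum_unfold_sum_mset[symmetric] image_mset.compositionality o_def)
  then have "fps_order (\<Sum>i\<in>I. f i ^ l) \<le> enat (l * n)"
    using l(2) enat_le_fps_order_iff[of "Suc (l * n)" "\<Sum>i\<in>I. f i ^ l"] by (metis Suc_ile_eq lessI not_less)
  moreover have "of_nat l * enat n \<le> fps_order (\<Sum>i\<in>I. f i ^ l)"
    using fps_order_power_sum_ge[of l f I] INF by simp
  ultimately have "fps_order (\<Sum>i\<in>I. f i ^ l) = of_nat l * enat n"
    by (simp add: of_nat_eq_enat antisym)
  then show ?thesis using l(1) by blast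
qed

theorem INF_fps_order_eq_if_power_sums:
  fixes f g :: "'i \<Rightarrow> 'a::{idom, ring_char_0} fps"
  assumes "finite I"
    and "\<And>l. l \<in> {1..card I} \<Longrightarrow> fps_order (\<Sum>i\<in>I. f i ^ l) = fps_order (\<Sum>i\<in>I. g i ^ l)"
  shows "(INF i\<in>I. fps_order (f i)) = (INF i\<in>I. fps_order (g i))"
proof -
  have INF_le: "(INF i\<in>I. fps_order (g i)) \<le> (INF i\<in>I. fps_order (f i))"
    if "\<And>l. l \<in> {1..card I} \<Longrightarrow> fps_order (\<Sum>i\<in>I. f i ^ l) = fps_order (\<Sum>i\<in>I. g i ^ l)"
    for f g :: "'i \<Rightarrow> 'a fps"
  proof (cases "INF i\<in>I. fps_order (f i)")
    case (enat n)
    obtain l where l: "l \<in> {1..card I}" "fps_order (\<Sum>i\<in>I. f i ^ l) = of_nat l * enat n"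
      using ex_fps_order_power_sum_eq[OF assms(1) enat] by blast
    then have "of_nat l * (INF i\<in>I. fps_order (g i)) \<le> of_nat l * enat n"
      using that fps_order_power_sum_ge[of l g I] by simp
    then show ?thesis
      using l(1) enat by (cases "INF i\<in>I. fps_order (g i)") (auto simp: of_nat_eq_enat)
  qed simp
  show ?thesis using INF_le[of f g] INF_le[of g f] assms(2) by (simp add: antisym)
qed

subsection \<open>Contact orders of selections of roots\<close>

definition index_pairs :: "nat \<Rightarrow> (nat \<times> nat) set" where
  "index_pairs r = {(i, j). i < j \<and> j < r}"

definition contact_product :: "(nat \<times> nat \<Rightarrow> nat) \<Rightarrow> nat \<Rightarrow> (nat \<Rightarrow> 'a::comm_ring_1) \<Rightarrow> 'a" where
  "contact_product w r v = (\<Prod>p\<in>index_pairs r. (v (fst p) - v (snd p)) ^ w p)"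

definition contact_order :: "(nat \<times> nat \<Rightarrow> nat) \<Rightarrow> nat \<Rightarrow> 'i set \<Rightarrow> ('i \<Rightarrow> 'a::comm_ring_1 fps) \<Rightarrow> enat" where
  "contact_order w r I y = (INF \<phi>\<in>{..<r} \<rightarrow>\<^sub>E I. fps_order (contact_product w r (y \<circ> \<phi>)))"

lemma finite_index_pairs [simp]: "finite (index_pairs r)"
  by (rule finite_subset[of _ "{..<r} \<times> {..<r}"]) (auto simp: index_pairs_def)

lemma fps_order_contact_product:
  fixes v :: "nat \<Rightarrow> 'a::idom fps"
  shows "fps_order (contact_product w r v)
    = (\<Sum>p\<in>index_pairs r. of_nat (w p) * fps_order (v (fst p) - v (snd p)))"
  by (simp add: contact_product_def fps_order_prod fps_order_power)

lemma contact_product_eq_0_iff: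
  fixes v :: "nat \<Rightarrow> 'a::idom"
  assumes "\<And>p. w p > 0"
  shows "contact_product w r v = 0 \<longleftrightarrow> \<not> inj_on v {..<r}"
proof -
  have "inj_on v {..<r} \<longleftrightarrow> (\<forall>p\<in>index_pairs r. v (fst p) \<noteq> v (snd p))"
  proof
    assume "inj_on v {..<r}"
    then show "\<forall>p\<in>index_pairs r. v (fst p) \<noteq> v (snd p)" by (auto simp: index_pairs_def inj_on_def)
  next
    assume "\<forall>p\<in>index_pairs r. v (fst p) \<noteq> v (snd p)"
    then show "inj_on v {..<r}" by (intro linorder_inj_onI) (auto simp: index_pairs_def)
  qed
  then show ?thesis using assms by (auto simp: contact_product_def)
qed

lemma contact_order_finite_iff:
  fixes y :: "'i \<Rightarrow> 'a::idom fps"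
  assumes "finite I" "\<And>p. w p > 0"
  shows "contact_order w r I y \<noteq> \<infinity> \<longleftrightarrow> r \<le> card (y ` I)"
proof
  assume "contact_order w r I y \<noteq> \<infinity>"
  then have "\<exists>\<phi>\<in>{..<r} \<rightarrow>\<^sub>E I. fps_order (contact_product w r (y \<circ> \<phi>)) \<noteq> \<infinity>"
    unfolding contact_order_def top_enat_def[symmetric] INF_top_conv by blast
  then obtain \<phi> where \<phi>: "\<phi> \<in> {..<r} \<rightarrow>\<^sub>E I" "inj_on (y \<circ> \<phi>) {..<r}"
    using contact_product_eq_0_iff[of w, OF assms(2)] by auto
  have "card {..<r} \<le> card (y ` I)"
    using \<phi> assms(1) by (intro card_inj_on_le[OF \<phi>(2)]) auto
  then show "r \<le> card (y ` I)" by simp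
next
  assume "r \<le> card (y ` I)"
  then obtain T where T: "T \<subseteq> y ` I" "card T = r" "finite T"
    by (rule obtain_subset_with_card_n)
  then obtain f where f: "bij_betw f {..<r} T"
    using ex_bij_betw_nat_finite[of T] by (auto simp: atLeast0LessThan)
  define \<phi> where "\<phi> = (\<lambda>i\<in>{..<r}. inv_into I y (f i))"
  have image: "f i \<in> y ` I" if "i < r" for i using f T(1) that by (auto simp: bij_betw_def)
  have "\<phi> \<in> {..<r} \<rightarrow>\<^sub>E I" using image by (auto simp: \<phi>_def intro: inv_into_into)
  have "inj_on (y \<circ> \<phi>) {..<r} \<longleftrightarrow> inj_on f {..<r}"
    using image by (intro inj_on_cong) (simp add: \<phi>_def f_inv_into_f)
  then have "fps_order (contact_product w r (y \<circ> \<phi>)) \<noteq> \<infinity>"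
    using f contact_product_eq_0_iff[of w r "y \<circ> \<phi>", OF assms(2)] by (simp add: bij_betw_def)
  moreover have "contact_order w r I y \<le> fps_order (contact_product w r (y \<circ> \<phi>))"
    unfolding contact_order_def using \<open>\<phi> \<in> {..<r} \<rightarrow>\<^sub>E I\<close> by (rule INF_lower)
  ultimately show "contact_order w r I y \<noteq> \<infinity>" by (cases "contact_order w r I y") auto
qed

lemma obtain_contact_order_minimizer:
  fixes y :: "'i \<Rightarrow> 'a::idom fps"
  assumes "finite I" "\<And>p. w p > 0"
  obtains v where "inj_on v {..<card (y ` I)}" "v ` {..<card (y ` I)} = y ` I"
    "fps_order (contact_product w (card (y ` I)) v) = contact_order w (card (y ` I)) I y"
proof -
  define r where "r = card (y ` I)"
  have finite: "contact_order w r I y \<noteq> \<infinity>" using contact_order_finite_iff[of I w r y, OF assms] by (simp add: r_def)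
  then have "{..<r} \<rightarrow>\<^sub>E I \<noteq> {}" by (auto simp: contact_order_def top_enat_def)
  then have "contact_order w r I y \<in> (\<lambda>\<phi>. fps_order (contact_product w r (y \<circ> \<phi>))) ` ({..<r} \<rightarrow>\<^sub>E I)"
    unfolding contact_order_def by (auto intro: wellorder_InfI)
  then obtain \<phi> where \<phi>: "\<phi> \<in> {..<r} \<rightarrow>\<^sub>E I" "fps_order (contact_product w r (y \<circ> \<phi>)) = contact_order w r I y"
    by auto
  then have inj: "inj_on (y \<circ> \<phi>) {..<r}"
    using finite contact_product_eq_0_iff[of w r "y \<circ> \<phi>", OF assms(2)] by (auto simp flip: \<phi>(2))
  moreover have "(y \<circ> \<phi>) ` {..<r} = y ` I"
    using \<phi>(1) assms(1) card_image[OF inj] by (intro card_subset_eq) (auto simp: r_def)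
  ultimately show ?thesis using that[of "y \<circ> \<phi>"] \<phi>(2) by (simp add: r_def)
qed

lemma fps_order_diff_le_contact_order:
  fixes y :: "'i \<Rightarrow> 'a::idom fps"
  assumes "finite I" "a \<in> y ` I" "b \<in> y ` I" "a \<noteq> b"
  shows "fps_order (a - b) \<le> contact_order (\<lambda>p. 1) (card (y ` I)) I y"
proof -
  obtain v where v: "v ` {..<card (y ` I)} = y ` I"
    and order: "fps_order (contact_product (\<lambda>p. 1) (card (y ` I)) v) = contact_order (\<lambda>p. 1) (card (y ` I)) I y"
    by (rule obtain_contact_order_minimizer[of I "\<lambda>p. 1" y, OF assms(1) zero_less_one]) (rule that)
  have "a \<in> v ` {..<card (y ` I)}" "b \<in> v ` {..<card (y ` I)}" using assms(2,3) by (simp_all add: v)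
  then obtain i j where ij: "i < card (y ` I)" "j < card (y ` I)" "a = v i" "b = v j" by auto
  then have "i \<noteq> j" using assms(4) by auto
  define p where "p = (min i j, max i j)"
  have "p \<in> index_pairs (card (y ` I))" using ij \<open>i \<noteq> j\<close> by (auto simp: p_def index_pairs_def min_def max_def)
  then have "fps_order (v (fst p) - v (snd p)) \<le> contact_order (\<lambda>p. 1) (card (y ` I)) I y"
    unfolding order[symmetric] fps_order_contact_product
    using member_le_sum[of p "index_pairs (card (y ` I))" "\<lambda>p. fps_order (v (fst p) - v (snd p))"] by simp
  moreover have "fps_order (v (fst p) - v (snd p)) = fps_order (a - b)"
    using fps_order_minus_commute[of a b] by (auto simp: p_def ij min_def max_def)
  ultimately show ?thesis by simp
qed

lemma sum_digits_less:
  fixes d :: "'i \<Rightarrow> nat" and c :: "'i \<Rightarrow> nat"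
  assumes "finite I" "inj_on c I" "\<And>i. i \<in> I \<Longrightarrow> d i < B" "\<And>i. i \<in> I \<Longrightarrow> c i < n" "B > 0"
  shows "(\<Sum>i\<in>I. B ^ c i * d i) < B ^ n"
proof -
  have "(\<Sum>i\<in>I. B ^ c i * d i) \<le> (\<Sum>i\<in>I. B ^ c i * (B - 1))"
    using assms(3) by (intro sum_mono mult_left_mono) force+
  also have "\<dots> = (\<Sum>k\<in>c ` I. B ^ k * (B - 1))" by (simp add: sum.reindex[OF assms(2)])
  also have "\<dots> \<le> (\<Sum>k<n. B ^ k * (B - 1))" using assms(4) by (intro sum_mono2) auto
  also have "\<dots> < B ^ n"
  proof -
    obtain b where "B = Suc b" using \<open>B > 0\<close> gr0_conv_Suc by blast
    have "(\<Sum>k<n. Suc b ^ k * b) + 1 = Suc b ^ n" by (induction n) (simp_all add: algebra_simps)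
    then show ?thesis unfolding \<open>B = Suc b\<close> by simp
  qed
  finally show ?thesis .
qed

lemma sum_digits_inject:
  fixes d d' :: "'i \<Rightarrow> nat" and c :: "'i \<Rightarrow> nat"
  assumes "finite I" "inj_on c I" "\<And>i. i \<in> I \<Longrightarrow> d i < B" "\<And>i. i \<in> I \<Longrightarrow> d' i < B"
    and "(\<Sum>i\<in>I. B ^ c i * d i) = (\<Sum>i\<in>I. B ^ c i * d' i)" and "i \<in> I"
  shows "d i = d' i"
  using assms
proof (induction I arbitrary: i rule: finite_ranking_induct[where f = c])
  case (insert j I)
  show ?case
  proof (cases "j \<in> I")
    case True
    then show ?thesis using insert by (simp add: insert_absorb)
  next
    case False
    define S where "S d = (\<Sum>i\<in>I. B ^ c i * d i)" for d :: "'i \<Rightarrow> nat"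
    have "c i < c j" if "i \<in> I" for i
      using insert.hyps(2)[OF that] insert.prems(1) that False by (metis inj_onD insertCI le_neq_implies_less)
    then have small: "S d < B ^ c j" "S d' < B ^ c j"
      unfolding S_def using insert.prems insert.hyps(1)
      by (intro sum_digits_less; force intro: inj_on_subset[OF insert.prems(1)])+
    have eq: "B ^ c j * d j + S d = B ^ c j * d' j + S d'"
      using insert.prems(4) insert.hyps(1) False by (simp add: S_def)
    have "B > 0" using insert.prems(2)[of j] by simp
    then have "d j = (B ^ c j * d j + S d) div B ^ c j" using small by simp
    also have "\<dots> = d' j" unfolding eq using small \<open>B > 0\<close> by simp
    finally have "d j = d' j" .
    moreover from this have "S d = S d'" using eq by simp
    then have "d i = d' i" if "i \<in> I" for i
      using insert.IH[of i] insert.prems that inj_on_subset[OF insert.prems(1)] by (auto simp: S_def)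
    ultimately show ?thesis using insert.prems(5) by auto
  qed
qed simp

text \<open>The digits of the least order to base \<open>B\<close> are the contact orders.\<close>

definition digit_weight :: "nat \<Rightarrow> nat \<Rightarrow> nat \<times> nat \<Rightarrow> nat" where
  "digit_weight B r p = B ^ (fst p * r + snd p)"

lemma inj_on_index_pairs_code: "inj_on (\<lambda>p. fst p * r + snd p) (index_pairs r)"
proof (rule inj_onI)
  fix p q assume pq: "p \<in> index_pairs r" "q \<in> index_pairs r" and code: "fst p * r + snd p = fst q * r + snd q"
  have "snd p < r" "snd q < r" using pq by (auto simp: index_pairs_def)
  then have "fst p = fst q" using arg_cong[OF code, of "\<lambda>n. n div r"] by simp
  then show "p = q" using code by (simp add: prod_eq_iff)
qed

lemma contact_equiv_enumerations:
  assumes "\<And>p. p \<in> index_pairs r \<Longrightarrow> fps_order (v (fst p) - v (snd p)) = fps_order (v' (fst p) - v' (snd p))"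
  shows "contact_equiv 1 (v ` {..<r}) (v' ` {..<r})"
proof (rule contact_iso_imp_equiv)
  show "contact_iso 1 (v ` {..<r}) (v' ` {..<r}) ((\<lambda>i. (v i, v' i)) ` {..<r})"
  proof (rule contact_isoI)
    show "Domain ((\<lambda>i. (v i, v' i)) ` {..<r}) = v ` {..<r}" "Range ((\<lambda>i. (v i, v' i)) ` {..<r}) = v' ` {..<r}"
      by (simp_all add: Domain_fst Range_snd image_image)
    fix a a' b b' assume "(a, a') \<in> (\<lambda>i. (v i, v' i)) ` {..<r}" "(b, b') \<in> (\<lambda>i. (v i, v' i)) ` {..<r}"
    then obtain i j where ij: "i < r" "j < r" "a = v i" "a' = v' i" "b = v j" "b' = v' j" by auto
    have less: "fps_order (v i - v j) = fps_order (v' i - v' j)" if "i < j" "j < r" for i j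
      using assms[of "(i, j)"] that by (simp add: index_pairs_def)
    show "fps_order (a - b) = fps_order (a' - b')"
      using less[of i j] less[of j i] ij
      by (cases i j rule: linorder_cases)
        (auto simp: fps_order_minus_commute[of "v i"] fps_order_minus_commute[of "v' i"])
  qed auto
qed

lemma obtain_enumeration_with_digits:
  fixes y :: "'i \<Rightarrow> complex fps"
  assumes "finite I" and card: "card (y ` I) = r" and bound: "contact_order (\<lambda>p. 1) r I y < enat B"
  obtains v d where "v ` {..<r} = y ` I"
    "\<And>p. p \<in> index_pairs r \<Longrightarrow> fps_order (v (fst p) - v (snd p)) = enat (d p) \<and> d p < B"
    "contact_order (digit_weight B r) r I y = enat (\<Sum>p\<in>index_pairs r. digit_weight B r p * d p)"
proof -
  have "B > 0" using bound by (cases B) (auto simp flip: zero_enat_def)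
  then have weights: "digit_weight B r p > 0" for p by (simp add: digit_weight_def)
  obtain v where v: "inj_on v {..<r}" "v ` {..<r} = y ` I"
    "fps_order (contact_product (digit_weight B r) r v) = contact_order (digit_weight B r) r I y"
    using obtain_contact_order_minimizer[of I "digit_weight B r" y, OF assms(1) weights] card by auto
  define d where "d p = the_enat (fps_order (v (fst p) - v (snd p)))" for p
  have order: "fps_order (v (fst p) - v (snd p)) = enat (d p) \<and> d p < B" if "p \<in> index_pairs r" for p
  proof -
    have "fst p < r" "snd p < r" "fst p \<noteq> snd p" using that by (auto simp: index_pairs_def)
    then have "v (fst p) \<in> y ` I" "v (snd p) \<in> y ` I" "v (fst p) \<noteq> v (snd p)"
      using v(1,2) by (auto simp: inj_on_def)
    then have "fps_order (v (fst p) - v (snd p)) < enat B"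
      using fps_order_diff_le_contact_order[OF assms(1), of "v (fst p)" y "v (snd p)"] card bound by simp
    then show ?thesis by (cases "fps_order (v (fst p) - v (snd p))") (auto simp: d_def)
  qed
  have "contact_order (digit_weight B r) r I y = (\<Sum>p\<in>index_pairs r. of_nat (digit_weight B r p * d p))"
    unfolding v(3)[symmetric] fps_order_contact_product
    by (rule sum.cong) (use order in \<open>simp_all add: of_nat_eq_enat\<close>)
  also have "\<dots> = of_nat (\<Sum>p\<in>index_pairs r. digit_weight B r p * d p)" by (rule of_nat_sum[symmetric])
  also have "\<dots> = enat (\<Sum>p\<in>index_pairs r. digit_weight B r p * d p)" by (rule of_nat_eq_enat)
  finally show ?thesis using that v(2) order by blast
qed

theorem contact_equiv_if_contact_orders_eq:
  fixes y y' :: "'i \<Rightarrow> complex fps"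
  assumes "finite I" and card: "card (y ` I) = r" "card (y' ` I) = r"
    and bound: "contact_order (\<lambda>p. 1) r I y < enat B" "contact_order (\<lambda>p. 1) r I y' < enat B"
    and digits: "contact_order (digit_weight B r) r I y = contact_order (digit_weight B r) r I y'"
  shows "contact_equiv 1 (y ` I) (y' ` I)"
proof -
  obtain v d where v: "v ` {..<r} = y ` I"
    "\<And>p. p \<in> index_pairs r \<Longrightarrow> fps_order (v (fst p) - v (snd p)) = enat (d p) \<and> d p < B"
    "contact_order (digit_weight B r) r I y = enat (\<Sum>p\<in>index_pairs r. digit_weight B r p * d p)"
    by (rule obtain_enumeration_with_digits[OF assms(1) card(1) bound(1)]) (rule that)
  obtain v' d' where v': "v' ` {..<r} = y' ` I"
    "\<And>p. p \<in> index_pairs r \<Longrightarrow> fps_order (v' (fst p) - v' (snd p)) = enat (d' p) \<and> d' p < B"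
    "contact_order (digit_weight B r) r I y' = enat (\<Sum>p\<in>index_pairs r. digit_weight B r p * d' p)"
    by (rule obtain_enumeration_with_digits[OF assms(1) card(2) bound(2)]) (rule that)
  have "(\<Sum>p\<in>index_pairs r. B ^ (fst p * r + snd p) * d p) = (\<Sum>p\<in>index_pairs r. B ^ (fst p * r + snd p) * d' p)"
    using digits unfolding v(3) v'(3) by (simp only: enat.inject digit_weight_def)
  then have "d p = d' p" if "p \<in> index_pairs r" for p
    using sum_digits_inject[OF finite_index_pairs inj_on_index_pairs_code _ _ _ that] v(2) v'(2) by blast
  then have "contact_equiv 1 (v ` {..<r}) (v' ` {..<r})"
    using v(2) v'(2) by (intro contact_equiv_enumerations) simp
  then show ?thesis unfolding v(1) v'(1) .
qed

subsection \<open>Sums over selections\<close>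

inductive monomial_sum :: "nat \<Rightarrow> ((nat \<Rightarrow> 'a::comm_ring_1) \<Rightarrow> 'a) \<Rightarrow> bool" for r where
  zero: "monomial_sum r (\<lambda>v. 0)"
| add_monomial: "monomial_sum r H \<Longrightarrow> monomial_sum r (\<lambda>v. of_int c * (\<Prod>i<r. v i ^ e i) + H v)"

lemma monomial_sum_add:
  assumes "monomial_sum r H" "monomial_sum r K"
  shows "monomial_sum r (\<lambda>v. H v + K v)"
  using assms
proof (induction H rule: monomial_sum.induct)
  case (add_monomial H c e)
  then show ?case using monomial_sum.add_monomial[of r "\<lambda>v. H v + K v" c e] by (simp add: add.assoc)
qed simp

lemma monomial_sum_mult:
  assumes "monomial_sum r H" "monomial_sum r K"
  shows "monomial_sum r (\<lambda>v. H v * K v)"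
  using assms(1)
proof (induction H rule: monomial_sum.induct)
  case zero
  show ?case by (simp add: monomial_sum.zero)
next
  case (add_monomial H c e)
  have "monomial_sum r (\<lambda>v. of_int c * (\<Prod>i<r. v i ^ e i) * K v)"
    using assms(2)
  proof (induction K rule: monomial_sum.induct)
    case zero
    show ?case by (simp add: monomial_sum.zero)
  next
    case (add_monomial K c' e')
    then show ?case
      using monomial_sum.add_monomial[OF add_monomial.IH, of "c * c'" "\<lambda>i. e i + e' i"]
      by (simp add: distrib_left power_add prod.distrib mult_ac)
  qed
  then show ?case using monomial_sum_add[OF _ add_monomial.IH] by (simp add: distrib_right)
qed

lemma monomial_sum_const: "monomial_sum r (\<lambda>v. of_int c)"
  using monomial_sum.add_monomial[OF monomial_sum.zero, of r c "\<lambda>i. 0"] by simp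

lemma monomial_sum_var:
  assumes "i < r"
  shows "monomial_sum r (\<lambda>v. v i :: 'a::comm_ring_1)"
proof -
  define e where "e j = (if j = i then 1 else 0 :: nat)" for j
  have "(\<Prod>j<r. v j ^ e j) = (\<Prod>j<r. if j = i then v j else 1)" for v :: "nat \<Rightarrow> 'a"
    by (rule prod.cong) (auto simp: e_def)
  then have "(\<lambda>v :: nat \<Rightarrow> 'a. of_int 1 * (\<Prod>j<r. v j ^ e j) + 0) = (\<lambda>v. v i)"
    using assms by simp
  moreover have "monomial_sum r (\<lambda>v :: nat \<Rightarrow> 'a. of_int 1 * (\<Prod>j<r. v j ^ e j) + 0)"
    by (intro monomial_sum.intros)
  ultimately show ?thesis by (simp only:)
qed

lemma monomial_sum_diff:
  assumes "monomial_sum r H" "monomial_sum r K"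
  shows "monomial_sum r (\<lambda>v. H v - K v)"
  using monomial_sum_add[OF assms(1) monomial_sum_mult[OF monomial_sum_const[of r "-1"] assms(2)]] by simp

lemma monomial_sum_power: "monomial_sum r H \<Longrightarrow> monomial_sum r (\<lambda>v. H v ^ n)"
  using monomial_sum_const[of r 1] by (induction n) (auto intro: monomial_sum_mult)

lemma monomial_sum_prod: "(\<And>i. i \<in> A \<Longrightarrow> monomial_sum r (H i)) \<Longrightarrow> monomial_sum r (\<lambda>v. \<Prod>i\<in>A. H i v)"
  using monomial_sum_const[of r 1]
  by (induction A rule: infinite_finite_induct) (auto intro: monomial_sum_mult)

lemma monomial_sum_contact_product: "monomial_sum r (\<lambda>v. contact_product w r v ^ l)"
  unfolding contact_product_def
  by (intro monomial_sum_power monomial_sum_prod monomial_sum_diff monomial_sum_var) (auto simp: index_pairs_def)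

subsection \<open>Families of monic polynomials\<close>

lemma newton_power_sum_poly_ramify:
  fixes p :: "'a::idom fps poly"
  assumes "L > 0"
  shows "newton_power_sum (poly_ramify L p) k = newton_power_sum p k oo fps_X ^ L"
proof (induction k rule: less_induct)
  case (less k)
  have of_nat: "of_nat n oo f = of_nat n" for n and f :: "'a fps"
    by (simp flip: fps_of_nat)
  show ?case
  proof (cases k)
    case 0
    then show ?thesis using assms by (simp add: degree_poly_ramify of_nat)
  next
    case (Suc n)
    have reflect: "coeff (reflect_poly (poly_ramify L p)) j = coeff (reflect_poly p) j oo fps_X ^ L" for j
      using assms by (simp add: coeff_reflect_poly degree_poly_ramify coeff_poly_ramify)
    have "(\<Sum>i\<in>{1..n}. coeff (reflect_poly (poly_ramify L p)) i * newton_power_sum (poly_ramify L p) (Suc n - i))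
       = (\<Sum>i\<in>{1..n}. coeff (reflect_poly p) i * newton_power_sum p (Suc n - i)) oo fps_X ^ L"
      unfolding fps_compose_sum_distrib
      by (rule sum.cong) (use less.IH Suc assms in \<open>auto simp: fps_compose_X_power_mult reflect\<close>)
    then show ?thesis unfolding Suc newton_power_sum.simps
      using assms by (simp only: fps_compose_sub_distrib fps_compose_uminus fps_compose_X_power_mult of_nat reflect)
  qed
qed

lemma multiset_eq_image_mset_lessThan:
  obtains y where "A = image_mset y (mset_set {..<size A})"
proof -
  obtain xs where "A = mset xs" by (metis ex_mset)
  then have "A = image_mset ((!) xs) (mset [0..<length xs])" by (metis map_nth mset_map)
  then show ?thesis using that \<open>A = mset xs\<close> by (simp add: atLeast0LessThan)
qed

locale monic_param_family =
  fixes N m L :: nat and P :: "(nat \<Rightarrow> complex) \<times> complex \<Rightarrow> complex fps poly"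
  assumes param_coeff: "\<And>k. param_fps N (\<lambda>s. coeff (P s) k)"
    and degree: "\<And>s. degree (P s) = m"
    and L_pos: "L > 0"
begin

definition ramified_roots :: "(nat \<Rightarrow> complex) \<times> complex \<Rightarrow> (nat \<Rightarrow> complex fps) \<Rightarrow> bool" where
  "ramified_roots s y \<longleftrightarrow> poly_ramify L (P s) = poly_of_roots (image_mset y (mset_set {..<m}))"

lemma param_newton_power_sum: "param_fps N (\<lambda>s. newton_power_sum (P s) k)"
proof (induction k rule: less_induct)
  case (less k)
  have reflect: "param_fps N (\<lambda>s. coeff (reflect_poly (P s)) j)" for j
    by (cases "j > m") (simp_all add: coeff_reflect_poly degree param_coeff param_fps_const)
  show ?case
  proof (cases k)
    case 0
    then show ?thesis by (simp add: param_fps_const degree)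
  next
    case (Suc n)
    show ?thesis unfolding Suc newton_power_sum.simps using less.IH Suc
      by (intro param_fps_diff param_fps_uminus param_fps_mult param_fps_sum param_fps_const reflect) auto
  qed
qed

lemma ramified_roots_power_sum:
  assumes "ramified_roots s y"
  shows "(\<Sum>j<m. y j ^ k) = newton_power_sum (P s) k oo fps_X ^ L"
proof -
  have "(\<Sum>j<m. y j ^ k) = (\<Sum>a\<in>#image_mset y (mset_set {..<m}). a ^ k)"
    by (simp add: sum_unfold_sum_mset image_mset.compositionality o_def)
  also have "\<dots> = newton_power_sum (poly_ramify L (P s)) k"
    using assms by (simp add: power_sum_eq_newton_power_sum ramified_roots_def)
  finally show ?thesis by (simp add: newton_power_sum_poly_ramify[OF L_pos])
qed

lemma sum_over_selections:
  assumes "monomial_sum r H"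
  shows "\<exists>T. param_fps N T \<and> (\<forall>s y. ramified_roots s y \<longrightarrow>
    (\<Sum>\<phi>\<in>{..<r} \<rightarrow>\<^sub>E {..<m}. H (y \<circ> \<phi>)) = T s oo fps_X ^ L)"
  using assms
proof (induction H rule: monomial_sum.induct)
  case zero
  show ?case by (intro exI[of _ "\<lambda>s. 0"]) (simp add: param_fps_const)
next
  case (add_monomial H c e)
  then obtain T where T: "param_fps N T"
    "\<And>s y. ramified_roots s y \<Longrightarrow> (\<Sum>\<phi>\<in>{..<r} \<rightarrow>\<^sub>E {..<m}. H (y \<circ> \<phi>)) = T s oo fps_X ^ L"
    by blast
  define T' where "T' s = of_int c * (\<Prod>i<r. newton_power_sum (P s) (e i)) + T s" for s
  have "param_fps N T'"
    unfolding T'_def[abs_def]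
    by (intro param_fps_add param_fps_mult param_fps_prod param_fps_const param_newton_power_sum T(1))
  moreover have "(\<Sum>\<phi>\<in>{..<r} \<rightarrow>\<^sub>E {..<m}. of_int c * (\<Prod>i<r. (y \<circ> \<phi>) i ^ e i) + H (y \<circ> \<phi>)) = T' s oo fps_X ^ L"
    if roots: "ramified_roots s y" for s y
  proof -
    have "(\<Sum>\<phi>\<in>{..<r} \<rightarrow>\<^sub>E {..<m}. \<Prod>i<r. (y \<circ> \<phi>) i ^ e i) = (\<Prod>i<r. \<Sum>j<m. y j ^ e i)"
      by (simp add: prod_sum_PiE o_def)
    also have "\<dots> = (\<Prod>i<r. newton_power_sum (P s) (e i)) oo fps_X ^ L"
      using L_pos by (simp add: ramified_roots_power_sum[OF roots] fps_compose_prod_distrib)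
    finally have "(\<Sum>\<phi>\<in>{..<r} \<rightarrow>\<^sub>E {..<m}. of_int c * (\<Prod>i<r. (y \<circ> \<phi>) i ^ e i))
        = of_int c * ((\<Prod>i<r. newton_power_sum (P s) (e i)) oo fps_X ^ L)"
      by (simp only: sum_distrib_left[symmetric])
    moreover have "of_int c = (of_int c :: complex fps) oo fps_X ^ L" by (simp flip: fps_of_int)
    ultimately show ?thesis
      using L_pos T(2)[OF roots]
      by (simp add: T'_def sum.distrib fps_compose_add_distrib fps_compose_X_power_mult)
  qed
  ultimately show ?case by blast
qed

lemma generic_contact_product_power_sum_order:
  assumes Z: "zirreducible N Z"
  shows "\<exists>d. generic_on N Z (\<lambda>s. \<forall>y. ramified_roots s y \<longrightarrow>
    fps_order (\<Sum>\<phi>\<in>{..<r} \<rightarrow>\<^sub>E {..<m}. contact_product w r (y \<circ> \<phi>) ^ l) = d)"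
proof -
  obtain T where T: "param_fps N T"
    "\<And>s y. ramified_roots s y \<Longrightarrow> (\<Sum>\<phi>\<in>{..<r} \<rightarrow>\<^sub>E {..<m}. contact_product w r (y \<circ> \<phi>) ^ l) = T s oo fps_X ^ L"
    using sum_over_selections[OF monomial_sum_contact_product[of r w l]] by blast
  obtain d where "generic_on N Z (\<lambda>s. fps_order (T s) = d)" using generic_on_fps_order[OF Z T(1)] .
  then have "generic_on N Z (\<lambda>s. \<forall>y. ramified_roots s y \<longrightarrow>
      fps_order (\<Sum>\<phi>\<in>{..<r} \<rightarrow>\<^sub>E {..<m}. contact_product w r (y \<circ> \<phi>) ^ l) = of_nat L * d)"
  proof (rule generic_on_mono)
    fix s assume "fps_order (T s) = d"
    then show "\<forall>y. ramified_roots s y \<longrightarrow>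
        fps_order (\<Sum>\<phi>\<in>{..<r} \<rightarrow>\<^sub>E {..<m}. contact_product w r (y \<circ> \<phi>) ^ l) = of_nat L * d"
      using T(2)[of s] by (simp add: fps_order_compose_X_power[OF L_pos])
  qed
  then show ?thesis by blast
qed

lemma generic_on_constant:
  assumes "generic_on N Z Q"
    and "\<And>s y s' y'. Q s \<Longrightarrow> ramified_roots s y \<Longrightarrow> Q s' \<Longrightarrow> ramified_roots s' y' \<Longrightarrow> h y = h y'"
  shows "\<exists>d. generic_on N Z (\<lambda>s. \<forall>y. ramified_roots s y \<longrightarrow> h y = d)"
proof -
  have "\<exists>d. \<forall>s. Q s \<longrightarrow> (\<forall>y. ramified_roots s y \<longrightarrow> h y = d)"
  proof (cases "\<exists>s y. Q s \<and> ramified_roots s y")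
    case True
    then obtain s0 y0 where "Q s0" "ramified_roots s0 y0" by auto
    then have "\<forall>s. Q s \<longrightarrow> (\<forall>y. ramified_roots s y \<longrightarrow> h y = h y0)"
      by (intro allI impI) (rule assms(2))
    then show ?thesis by (rule exI)
  qed simp
  then obtain d where d: "\<forall>s. Q s \<longrightarrow> (\<forall>y. ramified_roots s y \<longrightarrow> h y = d)" ..
  have "generic_on N Z (\<lambda>s. \<forall>y. ramified_roots s y \<longrightarrow> h y = d)"
    by (rule generic_on_mono[OF assms(1)]) (use d in blast)
  then show ?thesis by (rule exI)
qed

lemma generic_contact_order:
  assumes Z: "zirreducible N Z"
  shows "\<exists>d. generic_on N Z (\<lambda>s. \<forall>y. ramified_roots s y \<longrightarrow> contact_order w r {..<m} y = d)"
proof -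
  define \<Phi> where "\<Phi> = ({..<r} \<rightarrow>\<^sub>E {..<m})"
  define \<sigma> where "\<sigma> l y = (\<Sum>\<phi>\<in>\<Phi>. contact_product w r (y \<circ> \<phi>) ^ l)" for l and y :: "nat \<Rightarrow> complex fps"
  obtain d where d: "generic_on N Z (\<lambda>s. \<forall>y. ramified_roots s y \<longrightarrow> fps_order (\<sigma> l y) = d l)" for l
    using choice[of "\<lambda>l d. generic_on N Z (\<lambda>s. \<forall>y. ramified_roots s y \<longrightarrow> fps_order (\<sigma> l y) = d)"]
      generic_contact_product_power_sum_order[OF Z, of w r] unfolding \<sigma>_def \<Phi>_def by blast
  define Q where "Q s \<longleftrightarrow> (\<forall>l\<in>{1..card \<Phi>}. \<forall>y. ramified_roots s y \<longrightarrow> fps_order (\<sigma> l y) = d l)" for s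
  show ?thesis
  proof (rule generic_on_constant)
    show "generic_on N Z Q" unfolding Q_def[abs_def] using d by (intro generic_on_ball[OF Z]) auto
    fix s s' y y' assume roots: "Q s" "ramified_roots s y" "Q s'" "ramified_roots s' y'"
    show "contact_order w r {..<m} y = contact_order w r {..<m} y'"
      unfolding contact_order_def \<Phi>_def[symmetric]
    proof (rule INF_fps_order_eq_if_power_sums)
      show "finite \<Phi>" by (simp add: \<Phi>_def finite_PiE)
      show "fps_order (\<Sum>\<phi>\<in>\<Phi>. contact_product w r (y \<circ> \<phi>) ^ l) = fps_order (\<Sum>\<phi>\<in>\<Phi>. contact_product w r (y' \<circ> \<phi>) ^ l)"
        if "l \<in> {1..card \<Phi>}" for l
        unfolding \<sigma>_def[symmetric] using roots[unfolded Q_def] that by metis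
    qed
  qed
qed

lemma generic_card_roots:
  assumes Z: "zirreducible N Z"
  shows "\<exists>r B. generic_on N Z (\<lambda>s. \<forall>y. ramified_roots s y \<longrightarrow>
    card (y ` {..<m}) = r \<and> contact_order (\<lambda>p. 1) r {..<m} y < enat B)"
proof -
  define unit where "unit = (\<lambda>p :: nat \<times> nat. 1 :: nat)"
  obtain d where d: "generic_on N Z (\<lambda>s. \<forall>y. ramified_roots s y \<longrightarrow> contact_order unit r {..<m} y = d r)" for r
    using choice[of "\<lambda>r d. generic_on N Z (\<lambda>s. \<forall>y. ramified_roots s y \<longrightarrow> contact_order unit r {..<m} y = d)"]
      generic_contact_order[OF Z] by blast
  define Q where "Q s \<longleftrightarrow> (\<forall>r\<in>{..m}. \<forall>y. ramified_roots s y \<longrightarrow> contact_order unit r {..<m} y = d r)" for s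
  have generic_Q: "generic_on N Z Q" unfolding Q_def[abs_def] using d by (intro generic_on_ball[OF Z]) auto
  have card_iff: "r \<le> card (y ` {..<m}) \<longleftrightarrow> r \<le> m \<and> d r \<noteq> \<infinity>" if "Q s" "ramified_roots s y" for s y r
    using contact_order_finite_iff[of "{..<m}" unit r y] card_image_le[of "{..<m}" y] that
    by (cases "r \<le> m") (auto simp: Q_def unit_def)
  have "\<exists>r. generic_on N Z (\<lambda>s. \<forall>y. ramified_roots s y \<longrightarrow> card (y ` {..<m}) = r)"
    using generic_Q
  proof (rule generic_on_constant)
    fix s s' y y' assume "Q s" "ramified_roots s y" "Q s'" "ramified_roots s' y'"
    then show "card (y ` {..<m}) = card (y' ` {..<m})" using card_iff by (metis le_antisym order_refl)
  qed
  then obtain r where r: "generic_on N Z (\<lambda>s. \<forall>y. ramified_roots s y \<longrightarrow> card (y ` {..<m}) = r)" ..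
  obtain B where B: "d r < \<infinity> \<Longrightarrow> d r < enat B" by (cases "d r") auto
  have "generic_on N Z (\<lambda>s. Q s \<and> (\<forall>y. ramified_roots s y \<longrightarrow> card (y ` {..<m}) = r))"
    by (rule generic_on_conj[OF Z generic_Q r])
  then have "generic_on N Z (\<lambda>s. \<forall>y. ramified_roots s y \<longrightarrow>
      card (y ` {..<m}) = r \<and> contact_order (\<lambda>p. 1) r {..<m} y < enat B)"
  proof (rule generic_on_mono, intro allI impI)
    fix s y assume s: "Q s \<and> (\<forall>y. ramified_roots s y \<longrightarrow> card (y ` {..<m}) = r)" and y: "ramified_roots s y"
    then have "r \<le> m" "d r \<noteq> \<infinity>" using card_iff[of s y r] by auto
    then show "card (y ` {..<m}) = r \<and> contact_order (\<lambda>p. 1) r {..<m} y < enat B"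
      using s y B by (auto simp: Q_def unit_def)
  qed
  then show ?thesis by blast
qed

lemma ramified_roots_multiset:
  assumes "poly_ramify L (P s) = poly_of_roots Y"
  shows "\<exists>y. ramified_roots s y \<and> y ` {..<m} = set_mset Y"
proof -
  have "size Y = m" using assms degree degree_poly_ramify[OF L_pos] by (metis degree_poly_of_roots)
  then obtain y where "Y = image_mset y (mset_set {..<m})" using multiset_eq_image_mset_lessThan[of Y] by metis
  then show ?thesis using assms by (auto simp: ramified_roots_def)
qed

theorem generic_contact_equiv:
  assumes Z: "zirreducible N Z"
  obtains Q where "generic_on N Z Q"
    "\<And>s s' Y Y'. Q s \<Longrightarrow> Q s' \<Longrightarrow> poly_ramify L (P s) = poly_of_roots Y \<Longrightarrow> poly_ramify L (P s') = poly_of_roots Y'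
      \<Longrightarrow> contact_equiv 1 (set_mset Y) (set_mset Y')"
proof -
  obtain r B where card: "generic_on N Z (\<lambda>s. \<forall>y. ramified_roots s y \<longrightarrow>
      card (y ` {..<m}) = r \<and> contact_order (\<lambda>p. 1) r {..<m} y < enat B)"
    using generic_card_roots[OF Z] by blast
  obtain d where digits: "generic_on N Z (\<lambda>s. \<forall>y. ramified_roots s y \<longrightarrow> contact_order (digit_weight B r) r {..<m} y = d)"
    using generic_contact_order[OF Z] by blast
  show ?thesis
  proof (rule that[OF generic_on_conj[OF Z card digits]], elim conjE)
    fix s s' Y Y'
    assume generic: "\<forall>y. ramified_roots s y \<longrightarrow> card (y ` {..<m}) = r \<and> contact_order (\<lambda>p. 1) r {..<m} y < enat B"
      "\<forall>y. ramified_roots s y \<longrightarrow> contact_order (digit_weight B r) r {..<m} y = d"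
      "\<forall>y. ramified_roots s' y \<longrightarrow> card (y ` {..<m}) = r \<and> contact_order (\<lambda>p. 1) r {..<m} y < enat B"
      "\<forall>y. ramified_roots s' y \<longrightarrow> contact_order (digit_weight B r) r {..<m} y = d"
    assume Y: "poly_ramify L (P s) = poly_of_roots Y" "poly_ramify L (P s') = poly_of_roots Y'"
    obtain y where y: "ramified_roots s y" "y ` {..<m} = set_mset Y" using ramified_roots_multiset[OF Y(1)] by blast
    obtain y' where y': "ramified_roots s' y'" "y' ` {..<m} = set_mset Y'" using ramified_roots_multiset[OF Y(2)] by blast
    have "contact_equiv 1 (y ` {..<m}) (y' ` {..<m})"
      using generic(1,2)[rule_format, OF y(1)] generic(3,4)[rule_format, OF y'(1)]
      by (intro contact_equiv_if_contact_orders_eq[OF finite_lessThan, of y m r y' B]) simp_all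
    then show "contact_equiv 1 (set_mset Y) (set_mset Y')" unfolding y(2) y'(2) .
  qed
qed

end

section \<open>Homeomorphisms from contact data\<close>

subsection \<open>Germs of sets\<close>

definition germ_homeomorphism ::
  "'a::topological_space \<Rightarrow> 'a set \<Rightarrow> 'a set \<Rightarrow> 'a set \<Rightarrow> 'a set \<Rightarrow> ('a \<Rightarrow> 'a) \<Rightarrow> ('a \<Rightarrow> 'a) \<Rightarrow> bool" where
  "germ_homeomorphism p S T U V \<phi> \<psi> \<longleftrightarrow> open U \<and> open V \<and> p \<in> U \<and> homeomorphism U V \<phi> \<psi> \<and> \<phi> p = p \<and>
     \<phi> ` (U \<inter> S) = V \<inter> T"

definition germ_equiv :: "'a::topological_space \<Rightarrow> 'a set \<Rightarrow> 'a set \<Rightarrow> bool" where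
  "germ_equiv p S T \<longleftrightarrow> (\<exists>U V \<phi> \<psi>. germ_homeomorphism p S T U V \<phi> \<psi>)"

lemma top_equiv_iff_germ_equiv: "top_equiv g h \<longleftrightarrow> germ_equiv (0, 0) {p. g p = 0} {p. h p = 0}"
  by (simp add: top_equiv_def germ_equiv_def germ_homeomorphism_def)

lemma germ_homeomorphism_sym:
  assumes "germ_homeomorphism p S T U V \<phi> \<psi>"
  shows "germ_homeomorphism p T S V U \<psi> \<phi>"
proof -
  have hom: "homeomorphism U V \<phi> \<psi>" and p: "p \<in> U" "\<phi> p = p" and image: "\<phi> ` (U \<inter> S) = V \<inter> T"
    using assms by (auto simp: germ_homeomorphism_def)
  have inverse: "\<psi> (\<phi> x) = x" "\<phi> x \<in> V" if "x \<in> U" for x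
    using hom that by (auto simp: homeomorphism_def)
  have "\<psi> ` (V \<inter> T) = (\<lambda>x. x) ` (U \<inter> S)"
    unfolding image[symmetric] image_image by (rule image_cong) (use inverse in auto)
  then show ?thesis
    using assms homeomorphism_symD[OF hom] inverse[OF p(1)] p(2) by (auto simp: germ_homeomorphism_def)
qed

lemma germ_homeomorphism_restrict:
  assumes "germ_homeomorphism p S T U V \<phi> \<psi>" and W: "open W" "p \<in> W"
  shows "germ_homeomorphism p S T (U \<inter> \<phi> -` W) (V \<inter> W) \<phi> \<psi>"
proof -
  have hom: "homeomorphism U V \<phi> \<psi>" and U: "open U" and image: "\<phi> ` (U \<inter> S) = V \<inter> T" "\<phi> ` U = V"
    using assms(1) by (auto simp: germ_homeomorphism_def homeomorphism_def)
  have "open (U \<inter> \<phi> -` W)"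
    using hom U W(1) by (simp add: continuous_open_preimage homeomorphism_def)
  moreover have image_vimage: "\<phi> ` (A \<inter> \<phi> -` W) = \<phi> ` A \<inter> W" for A by blast
  have "\<phi> ` (U \<inter> \<phi> -` W) = V \<inter> W" unfolding image_vimage image(2) ..
  then have "homeomorphism (U \<inter> \<phi> -` W) (V \<inter> W) \<phi> \<psi>"
    by (intro homeomorphism_of_subsets[OF hom _ Int_lower1]) simp_all
  moreover have "\<phi> ` (U \<inter> \<phi> -` W \<inter> S) = V \<inter> W \<inter> T"
    using image_vimage[of "U \<inter> S"] image(1) by (simp add: Int_ac)
  ultimately show ?thesis using assms by (simp add: germ_homeomorphism_def open_Int)
qed

lemma germ_homeomorphism_compose:
  assumes "germ_homeomorphism p S T U V \<phi> \<psi>" "germ_homeomorphism p T X V W \<phi>' \<psi>'"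
  shows "germ_homeomorphism p S X U W (\<phi>' \<circ> \<phi>) (\<psi> \<circ> \<psi>')"
proof -
  have "(\<phi>' \<circ> \<phi>) ` (U \<inter> S) = \<phi>' ` \<phi> ` (U \<inter> S)" by (rule image_comp[symmetric])
  then show ?thesis
    using assms homeomorphism_compose[of U V \<phi> \<psi> W \<phi>' \<psi>'] unfolding germ_homeomorphism_def by simp
qed

lemma germ_equiv_local:
  assumes "open U" "p \<in> U" "U \<inter> S = U \<inter> T"
  shows "germ_equiv p S T"
proof -
  have "germ_homeomorphism p S T U U id id"
    using assms by (simp add: germ_homeomorphism_def homeomorphism_def)
  then show ?thesis unfolding germ_equiv_def by blast
qed

lemma germ_equiv_sym: "germ_equiv p S T \<Longrightarrow> germ_equiv p T S"
  unfolding germ_equiv_def using germ_homeomorphism_sym by blast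

lemma germ_equiv_trans [trans]:
  assumes "germ_equiv p S T" "germ_equiv p T X"
  shows "germ_equiv p S X"
proof -
  obtain U V \<phi> \<psi> where ST: "germ_homeomorphism p S T U V \<phi> \<psi>"
    using assms(1) unfolding germ_equiv_def by blast
  obtain U' V' \<phi>' \<psi>' where TX: "germ_homeomorphism p T X U' V' \<phi>' \<psi>'"
    using assms(2) unfolding germ_equiv_def by blast
  have V: "open V" "p \<in> V" and U': "open U'" "p \<in> U'"
    using ST TX germ_homeomorphism_sym[OF ST] by (simp_all add: germ_homeomorphism_def)
  have "germ_homeomorphism p S T (U \<inter> \<phi> -` U') (V \<inter> U') \<phi> \<psi>"
    by (rule germ_homeomorphism_restrict[OF ST U'])
  moreover have "germ_homeomorphism p T X (V \<inter> U') (V' \<inter> \<psi>' -` V) \<phi>' \<psi>'"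
    unfolding Int_commute[of V U']
    by (rule germ_homeomorphism_sym[OF germ_homeomorphism_restrict[OF germ_homeomorphism_sym[OF TX] V]])
  ultimately have "germ_homeomorphism p S X (U \<inter> \<phi> -` U') (V' \<inter> \<psi>' -` V) (\<phi>' \<circ> \<phi>) (\<psi> \<circ> \<psi>')"
    by (rule germ_homeomorphism_compose)
  then show ?thesis unfolding germ_equiv_def by blast
qed

subsection \<open>McShane extension\<close>

lemma continuous_on_Min_image:
  fixes f :: "'i \<Rightarrow> 'a::topological_space \<Rightarrow> real"
  assumes "finite I" "I \<noteq> {}" "\<And>i. i \<in> I \<Longrightarrow> continuous_on S (f i)"
  shows "continuous_on S (\<lambda>x. Min ((\<lambda>i. f i x) ` I))"
  using assms
proof (induction I rule: finite_ne_induct)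
  case (insert i I)
  have "(\<lambda>x. Min ((\<lambda>i. f i x) ` insert i I)) = (\<lambda>x. min (f i x) (Min ((\<lambda>i. f i x) ` I)))"
    using insert by (auto simp: fun_eq_iff)
  then show ?case using insert by (auto intro!: continuous_on_min)
qed simp

definition mcshane :: "real \<Rightarrow> ('a::metric_space \<times> real) set \<Rightarrow> 'a \<Rightarrow> real" where
  "mcshane c D v = Min ((\<lambda>(a, d). d + c * dist v a) ` D)"

lemma mcshane_interpolates:
  assumes "finite D" "(a, d) \<in> D" and "\<And>b e. (b, e) \<in> D \<Longrightarrow> \<bar>e - d\<bar> \<le> c * dist a b"
  shows "mcshane c D a = d"
  unfolding mcshane_def
proof (rule Min_eqI)
  show "d \<in> (\<lambda>(a', d). d + c * dist a a') ` D" using assms(2) by force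
  show "d \<le> z" if "z \<in> (\<lambda>(a', d). d + c * dist a a') ` D" for z using that assms(3) by force
qed (use assms(1) in simp)

lemma mcshane_Lipschitz:
  assumes "finite D" "D \<noteq> {}" "c \<ge> 0"
  shows "\<bar>mcshane c D v - mcshane c D w\<bar> \<le> c * dist v w"
proof -
  have upper: "mcshane c D v \<le> mcshane c D w + c * dist v w" for v w
  proof -
    have "mcshane c D w \<in> (\<lambda>(a, d). d + c * dist w a) ` D"
      unfolding mcshane_def using assms by (intro Min_in) auto
    then obtain a d where D: "(a, d) \<in> D" "mcshane c D w = d + c * dist w a" by auto
    have "mcshane c D v \<le> d + c * dist v a"
      unfolding mcshane_def using assms(1) D(1) by (intro Min_le) force+
    also have "\<dots> \<le> d + c * (dist w a + dist v w)"
      using assms(3) dist_triangle[of v a w] by (intro add_left_mono mult_left_mono) auto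
    finally show ?thesis using D(2) by (simp add: algebra_simps)
  qed
  show ?thesis using upper[of v w] upper[of w v] by (simp add: dist_commute abs_le_iff)
qed

lemma continuous_on_mcshane:
  assumes "finite I" "I \<noteq> {}" "\<And>i. i \<in> I \<Longrightarrow> continuous_on S (a i)" "\<And>i. i \<in> I \<Longrightarrow> continuous_on S (d i)"
    "continuous_on S v"
  shows "continuous_on S (\<lambda>p. mcshane c ((\<lambda>i. (a i p, d i p)) ` I) (v p))"
  unfolding mcshane_def image_image prod.case using assms
  by (intro continuous_on_Min_image continuous_intros) auto

definition complex_mcshane :: "real \<Rightarrow> (complex \<times> complex) set \<Rightarrow> complex \<Rightarrow> complex" where
  "complex_mcshane c D v = Complex (mcshane c ((\<lambda>(a, d). (a, Re d)) ` D) v) (mcshane c ((\<lambda>(a, d). (a, Im d)) ` D) v)"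

lemma complex_mcshane_interpolates:
  assumes "finite D" "(a, d) \<in> D" and lip: "\<And>b e. (b, e) \<in> D \<Longrightarrow> cmod (e - d) \<le> c * dist a b"
  shows "complex_mcshane c D a = d"
proof -
  have "mcshane c ((\<lambda>(a, d). (a, \<pi> d)) ` D) a = \<pi> d"
    if bound: "\<And>z. \<bar>\<pi> z\<bar> \<le> cmod z" and diff: "\<And>z w. \<pi> (z - w) = \<pi> z - \<pi> w" for \<pi>
  proof (rule mcshane_interpolates)
    show "\<bar>e - \<pi> d\<bar> \<le> c * dist a b" if "(b, e) \<in> (\<lambda>(a, d). (a, \<pi> d)) ` D" for b e
    proof -
      from that obtain e' where e: "(b, e') \<in> D" "e = \<pi> e'" by auto
      have "\<bar>e - \<pi> d\<bar> \<le> cmod (e' - d)" using bound[of "e' - d"] by (simp add: e diff)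
      then show ?thesis using lip[OF e(1)] by simp
    qed
  qed (use assms in force)+
  from this[of Re] this[of Im] show ?thesis
    by (simp add: complex_mcshane_def abs_Re_le_cmod abs_Im_le_cmod complex_eq_iff)
qed

lemma complex_mcshane_Lipschitz:
  assumes "finite D" "D \<noteq> {}" "c \<ge> 0"
  shows "cmod (complex_mcshane c D v - complex_mcshane c D w) \<le> 2 * c * dist v w"
proof -
  have "cmod (complex_mcshane c D v - complex_mcshane c D w)
      \<le> \<bar>mcshane c ((\<lambda>(a, d). (a, Re d)) ` D) v - mcshane c ((\<lambda>(a, d). (a, Re d)) ` D) w\<bar>
        + \<bar>mcshane c ((\<lambda>(a, d). (a, Im d)) ` D) v - mcshane c ((\<lambda>(a, d). (a, Im d)) ` D) w\<bar>"
    by (rule order_trans[OF cmod_le]) (simp add: complex_mcshane_def)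
  also have "\<dots> \<le> c * dist v w + c * dist v w"
    using assms by (intro add_mono mcshane_Lipschitz) auto
  finally show ?thesis by simp
qed

lemma continuous_on_complex_mcshane:
  assumes "finite I" "I \<noteq> {}" "\<And>i. i \<in> I \<Longrightarrow> continuous_on S (a i)" "\<And>i. i \<in> I \<Longrightarrow> continuous_on S (d i)"
    "continuous_on S v"
  shows "continuous_on S (\<lambda>p. complex_mcshane c ((\<lambda>i. (a i p, d i p)) ` I) (v p))"
  unfolding complex_mcshane_def Complex_eq image_image prod.case using assms
  by (intro continuous_intros continuous_on_mcshane) auto

subsection \<open>The covering \<open>t \<mapsto> t ^ L\<close>\<close>

lemma power_eq_imp_cis_mult:
  fixes s t :: complex
  assumes "L > 0" "s ^ L = t ^ L"
  obtains k where "s = cis (2 * pi / L) ^ k * t"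
proof (cases "t = 0")
  case True
  then have "s = 0" using assms by (simp add: power_0_left)
  then show ?thesis using True that[of 0] by simp
next
  case False
  then have "(s / t) ^ L = 1" using assms by (simp add: power_divide)
  then obtain k where "s / t = cis (2 * pi * real k / real L)"
    using Complex.bij_betw_roots_unity[of L] assms unfolding bij_betw_def by blast
  also have "\<dots> = cis (2 * pi / L) ^ k" unfolding Complex.DeMoivre by (rule arg_cong[of _ _ cis]) simp
  finally show ?thesis using that False by (simp add: field_simps)
qed

lemma cis_rotation_invariant_eq:
  fixes P :: "complex \<Rightarrow> 'a set"
  assumes "L > 0" and rot: "\<And>t. P (cis (2 * pi / L) * t) \<subseteq> P t" and "s ^ L = t ^ L"
  shows "P s = P t"
proof -
  have subset: "P (cis (2 * pi / L) ^ k * t) \<subseteq> P t" for k t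
  proof (induction k)
    case (Suc k)
    then show ?case using rot[of "cis (2 * pi / L) ^ k * t"] by (simp add: mult.assoc)
  qed simp
  show ?thesis
    using power_eq_imp_cis_mult[OF assms(1,3)] power_eq_imp_cis_mult[OF assms(1) assms(3)[symmetric]] subset
    by (metis subset_antisym)
qed

lemma open_map_power_prod:
  fixes W :: "(complex \<times> complex) set"
  assumes "L > 0" "open W"
  shows "open ((\<lambda>(t, v). (t ^ L, v)) ` W)"
proof (rule openI)
  fix p assume "p \<in> (\<lambda>(t, v). (t ^ L, v)) ` W"
  then obtain t v where tv: "(t, v) \<in> W" "p = (t ^ L, v)" by auto
  obtain U V where UV: "open U" "open V" "(t, v) \<in> U \<times> V" "U \<times> V \<subseteq> W"
    using assms(2) tv(1) by (auto elim!: open_prod_elim)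
  have "\<not> (\<lambda>t::complex. t ^ L) constant_on UNIV"
    using assms(1) unfolding constant_on_def by (metis UNIV_I power_one zero_neq_one zero_power)
  then have "open ((\<lambda>t. t ^ L) ` U)"
    using UV by (intro open_mapping_thm[of _ UNIV]) (auto intro!: holomorphic_intros)
  then have "open (((\<lambda>t. t ^ L) ` U) \<times> V)" using UV by (intro open_Times)
  moreover have "((\<lambda>t. t ^ L) ` U) \<times> V \<subseteq> (\<lambda>(t, v). (t ^ L, v)) ` W" using UV by force
  moreover have "p \<in> ((\<lambda>t. t ^ L) ` U) \<times> V" using UV tv by auto
  ultimately show "\<exists>e>0. ball p e \<subseteq> (\<lambda>(t, v). (t ^ L, v)) ` W"
    by (meson open_contains_ball subset_trans)
qed

lemma continuous_on_open_image:
  fixes q :: "'a::topological_space \<Rightarrow> 'b::topological_space" and K :: "'b \<Rightarrow> 'c::topological_space"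
  assumes "open U" and open_map: "\<And>A. open A \<Longrightarrow> A \<subseteq> U \<Longrightarrow> open (q ` A)" and "continuous_on U (K \<circ> q)"
  shows "continuous_on (q ` U) K"
  unfolding continuous_on_open_vimage[OF open_map[OF \<open>open U\<close> subset_refl]]
proof (intro allI impI)
  fix B :: "'c set" assume "open B"
  then have "open ((K \<circ> q) -` B \<inter> U)" using assms by (metis continuous_on_open_vimage)
  then have "open (q ` ((K \<circ> q) -` B \<inter> U))" by (rule open_map) simp
  moreover have "K -` B \<inter> q ` U = q ` ((K \<circ> q) -` B \<inter> U)" by auto
  ultimately show "open (K -` B \<inter> q ` U)" by simp
qed

lemma image_power_ball:
  assumes "L > 0" "r > 0"
  shows "(\<lambda>(t, v). (t ^ L, v)) ` (ball 0 r \<times> UNIV) = ball (0 :: complex) (r ^ L) \<times> (UNIV :: 'a set)"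
proof -
  have "x \<in> (\<lambda>t. t ^ L) ` ball 0 r \<longleftrightarrow> x \<in> ball 0 (r ^ L)" for x :: complex
  proof -
    obtain t where t: "x = t ^ L" using exists_complex_root[of L x] assms(1) by auto
    have "cmod s < r" if "x = s ^ L" "cmod x < r ^ L" for s
      using that assms(2) by (auto simp: norm_power intro: power_less_imp_less_base)
    moreover have "cmod x < r ^ L" if "x = s ^ L" "cmod s < r" for s
      using that assms(1) by (simp add: norm_power power_strict_mono)
    ultimately show ?thesis using t by (auto simp: image_iff)
  qed
  then have "(\<lambda>t. t ^ L) ` ball 0 r = ball (0 :: complex) (r ^ L)" by blast
  then show ?thesis using image_paired_Times[of "\<lambda>t :: complex. t ^ L" "\<lambda>v :: 'a. v" "ball 0 r" UNIV] by simp
qed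

subsection \<open>Perturbations of the identity\<close>

lemma fibrewise_contraction_homeomorphism:
  fixes K :: "complex \<times> complex \<Rightarrow> complex"
  assumes U: "open U" and K: "continuous_on U K" and "c < 1"
    and contraction: "\<And>x v w. (x, v) \<in> U \<Longrightarrow> (x, w) \<in> U \<Longrightarrow> cmod (K (x, v) - K (x, w)) \<le> c * dist v w"
  defines "F \<equiv> \<lambda>(x, v). (x, v + K (x, v))"
  shows "open (F ` U)" "\<exists>\<psi>. homeomorphism U (F ` U) F \<psi>"
proof -
  have cont: "continuous_on U F"
    unfolding F_def case_prod_beta using K by (auto intro!: continuous_intros)
  have inj: "inj_on F U"
  proof (rule inj_onI)
    fix p q assume pq: "p \<in> U" "q \<in> U" "F p = F q"
    then obtain x v w where xvw: "p = (x, v)" "q = (x, w)" "v + K (x, v) = w + K (x, w)"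
      by (cases p; cases q) (auto simp: F_def)
    then have "v - w = K (x, w) - K (x, v)" by (simp add: algebra_simps)
    then have "dist v w = cmod (K (x, v) - K (x, w))" by (simp add: dist_norm norm_minus_commute)
    also have "\<dots> \<le> c * dist v w" using contraction pq(1,2) xvw(1,2) by simp
    finally have "(1 - c) * dist v w \<le> 0" by (simp add: algebra_simps)
    then show "p = q" using xvw \<open>c < 1\<close> by (simp add: mult_le_0_iff)
  qed
  show "open (F ` U)" using invariance_of_domain_gen[OF U cont inj] by simp
  show "\<exists>\<psi>. homeomorphism U (F ` U) F \<psi>"
    using invariance_of_domain_homeomorphism[OF U cont _ inj] by auto
qed

definition ramified_curve :: "nat \<Rightarrow> (complex \<Rightarrow> complex) set \<Rightarrow> (complex \<times> complex) set" where
  "ramified_curve L F = {(t ^ L, f t) | t f. f \<in> F}"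

lemma mem_ramified_curve_iff:
  assumes "L > 0" and rot: "\<And>f. f \<in> F \<Longrightarrow> (\<lambda>t. f (cis (2 * pi / L) * t)) \<in> F"
  shows "(t ^ L, v) \<in> ramified_curve L F \<longleftrightarrow> (\<exists>f\<in>F. v = f t)"
proof
  define P where "P t = (\<lambda>f. f t) ` F" for t
  have rot_P: "P (cis (2 * pi / L) * s) \<subseteq> P s" for s using rot by (force simp: P_def)
  assume "(t ^ L, v) \<in> ramified_curve L F"
  then obtain s f where f: "f \<in> F" "v = f s" "s ^ L = t ^ L" by (force simp: ramified_curve_def)
  then have "v \<in> P s" by (simp add: P_def)
  also have "P s = P t" by (rule cis_rotation_invariant_eq[of L P, OF assms(1) rot_P f(3)])
  finally show "\<exists>f\<in>F. v = f t" by (auto simp: P_def)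
qed (auto simp: ramified_curve_def)

text \<open>McShane's formula depends only on the set of pairs (root, displacement) in a fibre, so it descends from the
  \<open>t\<close>-disc to the disc of \<open>x = t ^ L\<close>.\<close>

locale fibrewise_Lipschitz_displacement =
  fixes R :: "((complex \<Rightarrow> complex) \<times> (complex \<Rightarrow> complex)) set" and L :: nat and r c :: real
  assumes finite: "finite R" and nonempty: "R \<noteq> {}"
    and L: "L > 0" and r: "r > 0" and c: "0 \<le> c" "c < 1/2"
    and rot: "\<And>y y'. (y, y') \<in> R \<Longrightarrow> (\<lambda>t. y (cis (2 * pi / L) * t), \<lambda>t. y' (cis (2 * pi / L) * t)) \<in> R"
    and cont: "\<And>y y'. (y, y') \<in> R \<Longrightarrow> continuous_on (ball 0 r) y \<and> continuous_on (ball 0 r) y'"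
    and zero: "\<And>y y'. (y, y') \<in> R \<Longrightarrow> y 0 = 0 \<and> y' 0 = 0"
    and Lipschitz: "\<And>t y y' z z'. cmod t < r \<Longrightarrow> (y, y') \<in> R \<Longrightarrow> (z, z') \<in> R \<Longrightarrow>
       cmod ((y' t - y t) - (z' t - z t)) \<le> c * dist (y t) (z t)"
begin

definition displacements :: "complex \<Rightarrow> (complex \<times> complex) set" where
  "displacements t = (\<lambda>p. (fst p t, snd p t - fst p t)) ` R"

definition displacement_field :: "complex \<times> complex \<Rightarrow> complex" where
  "displacement_field = (\<lambda>(x, v). complex_mcshane c (displacements (SOME t. t ^ L = x)) v)"

lemma displacements_finite: "finite (displacements t)" "displacements t \<noteq> {}"
  using finite nonempty by (simp_all add: displacements_def)

lemma displacements_rot: "displacements (cis (2 * pi / L) * t) \<subseteq> displacements t"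
proof
  fix d assume "d \<in> displacements (cis (2 * pi / L) * t)"
  then obtain y y' where "(y, y') \<in> R"
    "d = (y (cis (2 * pi / L) * t), y' (cis (2 * pi / L) * t) - y (cis (2 * pi / L) * t))"
    by (auto simp: displacements_def)
  then show "d \<in> displacements t" unfolding displacements_def
    by (intro image_eqI[where x = "(\<lambda>t. y (cis (2 * pi / L) * t), \<lambda>t. y' (cis (2 * pi / L) * t))"] rot) simp_all
qed

lemma displacement_field_power: "displacement_field (t ^ L, v) = complex_mcshane c (displacements t) v"
proof -
  have "(SOME s. s ^ L = t ^ L) ^ L = t ^ L" by (rule someI[of "\<lambda>s. s ^ L = t ^ L" t]) simp
  then have "displacements (SOME s. s ^ L = t ^ L) = displacements t"
    by (rule cis_rotation_invariant_eq[of L displacements, OF L displacements_rot])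
  then show ?thesis by (simp add: displacement_field_def)
qed

lemma displacement_field_Lipschitz: "cmod (displacement_field (x, v) - displacement_field (x, w)) \<le> 2 * c * dist v w"
  unfolding displacement_field_def prod.case by (rule complex_mcshane_Lipschitz[OF displacements_finite c(1)])

lemma continuous_on_displacement_field: "continuous_on (ball 0 (r ^ L) \<times> UNIV) displacement_field"
proof -
  have "continuous_on (ball 0 r \<times> UNIV) (\<lambda>q. fst p (fst q))" "continuous_on (ball 0 r \<times> UNIV) (\<lambda>q. snd p (fst q))"
    if "p \<in> R" for p using that cont[of "fst p" "snd p"]
    by (auto intro!: continuous_on_compose2[of "ball 0 r" "fst p"] continuous_on_compose2[of "ball 0 r" "snd p"]
        continuous_intros)
  then have "continuous_on (ball 0 r \<times> UNIV) (\<lambda>q. complex_mcshane c (displacements (fst q)) (snd q))"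
    unfolding displacements_def using finite nonempty
    by (intro continuous_on_complex_mcshane continuous_intros)
  moreover have "displacement_field \<circ> (\<lambda>(t, v). (t ^ L, v)) = (\<lambda>q. complex_mcshane c (displacements (fst q)) (snd q))"
    by (auto simp: fun_eq_iff displacement_field_power)
  ultimately show ?thesis
    unfolding image_power_ball[OF L r, symmetric]
    by (intro continuous_on_open_image open_map_power_prod[OF L]) (auto intro: open_Times)
qed

lemma displacement_field_root:
  assumes "cmod t < r" "(y, y') \<in> R"
  shows "displacement_field (t ^ L, y t) = y' t - y t"
  unfolding displacement_field_power
proof (rule complex_mcshane_interpolates[OF displacements_finite(1)])
  show "(y t, y' t - y t) \<in> displacements t" using assms(2) by (force simp: displacements_def)
  show "cmod (e - (y' t - y t)) \<le> c * dist (y t) b" if "(b, e) \<in> displacements t" for b e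
  proof -
    from that obtain z z' where z: "(z, z') \<in> R" "b = z t" "e = z' t - z t" by (auto simp: displacements_def)
    then show ?thesis using Lipschitz[OF assms(1) z(1) assms(2)] by (simp add: dist_commute)
  qed
qed

lemma mem_ramified_curve_fst_iff: "(t ^ L, v) \<in> ramified_curve L (fst ` R) \<longleftrightarrow> (\<exists>y y'. (y, y') \<in> R \<and> v = y t)"
proof -
  have "(\<lambda>t. y (cis (2 * pi / L) * t)) \<in> fst ` R" if "y \<in> fst ` R" for y
  proof -
    from that obtain y' where "(y, y') \<in> R" by auto
    then show ?thesis using rot image_iff by fastforce
  qed
  then show ?thesis by (subst mem_ramified_curve_iff[OF L]) (auto simp: Bex_def)
qed

lemma mem_ramified_curve_snd_iff: "(t ^ L, v) \<in> ramified_curve L (snd ` R) \<longleftrightarrow> (\<exists>y y'. (y, y') \<in> R \<and> v = y' t)"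
proof -
  have "(\<lambda>t. y' (cis (2 * pi / L) * t)) \<in> snd ` R" if "y' \<in> snd ` R" for y'
  proof -
    from that obtain y where "(y, y') \<in> R" by auto
    then show ?thesis using rot image_iff by fastforce
  qed
  then show ?thesis by (subst mem_ramified_curve_iff[OF L]) (auto simp: Bex_def)
qed

definition displace :: "complex \<times> complex \<Rightarrow> complex \<times> complex" where
  "displace = (\<lambda>(x, v). (x, v + displacement_field (x, v)))"

lemma displace_root: "cmod t < r \<Longrightarrow> (y, y') \<in> R \<Longrightarrow> displace (t ^ L, y t) = (t ^ L, y' t)"
  by (simp add: displace_def displacement_field_root)

lemma image_displace_ramified_curve:
  defines "U \<equiv> ball 0 (r ^ L) \<times> UNIV"
  shows "displace ` (U \<inter> ramified_curve L (fst ` R)) = displace ` U \<inter> ramified_curve L (snd ` R)"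
proof -
  have U_cases: "\<exists>t v. cmod t < r \<and> p = (t ^ L, v)" if "p \<in> U" for p
    using that unfolding U_def image_power_ball[OF L r, symmetric] by auto
  show ?thesis
  proof (intro equalityI subsetI)
    fix q assume "q \<in> displace ` (U \<inter> ramified_curve L (fst ` R))"
    then obtain p where p: "p \<in> U" "p \<in> ramified_curve L (fst ` R)" "q = displace p" by blast
    obtain t v where t: "cmod t < r" "p = (t ^ L, v)" using U_cases[OF p(1)] by blast
    then obtain y y' where y: "(y, y') \<in> R" "v = y t" using p(2) mem_ramified_curve_fst_iff by blast
    then have "q = (t ^ L, y' t)" using displace_root p(3) t by simp
    then show "q \<in> displace ` U \<inter> ramified_curve L (snd ` R)"
      using p(1,3) y(1) mem_ramified_curve_snd_iff by blast
  next
    fix q assume q: "q \<in> displace ` U \<inter> ramified_curve L (snd ` R)"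
    then obtain p where p: "p \<in> U" "q = displace p" by blast
    obtain t v where t: "cmod t < r" "p = (t ^ L, v)" using U_cases[OF p(1)] by blast
    then have "q = (t ^ L, v + displacement_field (t ^ L, v))" using p(2) by (simp add: displace_def)
    then obtain y y' where y: "(y, y') \<in> R" "q = (t ^ L, y' t)"
      using q mem_ramified_curve_snd_iff by blast
    have "(t ^ L, y t) \<in> U" using p(1) t(2) by (simp add: U_def)
    moreover have "(t ^ L, y t) \<in> ramified_curve L (fst ` R)" using mem_ramified_curve_fst_iff y(1) by blast
    ultimately show "q \<in> displace ` (U \<inter> ramified_curve L (fst ` R))"
      using displace_root[OF t(1) y(1)] y(2) by (metis IntI imageI)
  qed
qed

theorem germ_equiv_displacement:
  "germ_equiv (0, 0) (ramified_curve L (fst ` R)) (ramified_curve L (snd ` R))"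
proof -
  define U where "U = ball (0 :: complex) (r ^ L) \<times> (UNIV :: complex set)"
  have U: "open U" "(0, 0) \<in> U" using r by (simp_all add: U_def open_Times)
  have "2 * c < 1" using c by simp
  note homeo = fibrewise_contraction_homeomorphism[OF U(1) continuous_on_displacement_field[folded U_def] this
      displacement_field_Lipschitz, folded displace_def]
  obtain \<psi> where "homeomorphism U (displace ` U) displace \<psi>" using homeo(2) ..
  moreover have "displace (0, 0) = (0, 0)"
  proof -
    obtain y y' where "(y, y') \<in> R" using nonempty by auto
    then show ?thesis using displace_root[of 0 y y'] zero[of y y'] L r by (simp add: power_0_left)
  qed
  ultimately have "germ_homeomorphism (0, 0) (ramified_curve L (fst ` R)) (ramified_curve L (snd ` R))
      U (displace ` U) displace \<psi>"
    using homeo(1) U image_displace_ramified_curve by (simp add: germ_homeomorphism_def U_def)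
  then show ?thesis unfolding germ_equiv_def by blast
qed

end

subsection \<open>Curves with contact-equivalent roots\<close>

lemma has_fps_expansion_imp_eventually_le:
  fixes f g :: "complex \<Rightarrow> complex"
  assumes f: "f has_fps_expansion A" and g: "g has_fps_expansion B" and "fps_order A \<le> fps_order B"
  shows "\<exists>K. eventually (\<lambda>t. cmod (g t) \<le> K * cmod (f t)) (nhds 0)"
proof (cases "B = 0")
  case True
  then have "eventually (\<lambda>t. g t = 0) (nhds 0)" using g by (simp add: has_fps_expansion_0_iff)
  then show ?thesis by (intro exI[of _ 0]) (auto elim: eventually_mono)
next
  case False
  then have "A \<noteq> 0" and order: "subdegree A \<le> subdegree B"
    using assms(3) by (auto simp: fps_order_def split: if_splits)
  define q where "q t = (if t = 0 then fps_nth B (subdegree A) / fps_nth A (subdegree A) else g t / f t)" for t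
  have q: "q has_fps_expansion B / A"
    unfolding q_def by (rule has_fps_expansion_divide[OF g f order \<open>A \<noteq> 0\<close> refl])
  then have "(\<lambda>t. q t * f t) has_fps_expansion (B / A) * A"
    using f by (rule has_fps_expansion_mult)
  moreover have "A dvd B" using \<open>A \<noteq> 0\<close> False order by (simp add: fps_dvd_iff)
  ultimately have "eventually (\<lambda>t. q t * f t = g t) (nhds 0)"
    using has_fps_expansion_eventually_eq g by simp
  moreover have "isCont q 0"
    using has_fps_expansion_imp_analytic_0[OF q] by (rule analytic_at_imp_isCont)
  then have "((\<lambda>t. cmod (q t)) \<longlongrightarrow> cmod (q 0)) (nhds 0)"
    by (intro tendsto_norm) (simp add: continuous_within tendsto_nhds_iff)
  then have "eventually (\<lambda>t. cmod (q t) < cmod (q 0) + 1) (nhds 0)" by (rule order_tendstoD) simp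
  ultimately have "eventually (\<lambda>t. cmod (g t) \<le> (cmod (q 0) + 1) * cmod (f t)) (nhds 0)"
    by eventually_elim (metis less_imp_le mult_right_mono norm_ge_zero norm_mult)
  then show ?thesis by blast
qed

definition fps_blend :: "complex \<Rightarrow> complex fps \<Rightarrow> complex fps \<Rightarrow> complex fps" where
  "fps_blend u x x' = fps_const (1 - u) * x + fps_const u * x'"

lemma fps_nth_blend [simp]: "fps_nth (fps_blend u x x') n = (1 - u) * fps_nth x n + u * fps_nth x' n"
  by (simp add: fps_blend_def)

lemma finite_fps_order_blend_neq:
  assumes "fps_order x = fps_order x'"
  shows "finite {u. fps_order (fps_blend u x x') \<noteq> fps_order x}"
proof (cases "fps_order x")
  case (enat n)
  define a a' where "a = fps_nth x n" and "a' = fps_nth x' n"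
  have order: "a \<noteq> 0" "\<forall>k<n. fps_nth x k = 0" "\<forall>k<n. fps_nth x' k = 0"
    using assms enat fps_order_eq_enat_iff[of x n] fps_order_eq_enat_iff[of x' n] by (auto simp: a_def)
  have "u = a / (a - a')" if "fps_order (fps_blend u x x') \<noteq> fps_order x" for u
  proof -
    have "(1 - u) * a + u * a' = 0"
      using that order(2,3) enat by (simp add: fps_order_eq_enat_iff a_def a'_def)
    then have "u * (a - a') = a" by (simp add: algebra_simps)
    then show ?thesis using order(1) by (metis mult_zero_right nonzero_mult_div_cancel_right)
  qed
  then have "{u. fps_order (fps_blend u x x') \<noteq> fps_order x} \<subseteq> {a / (a - a')}" by blast
  then show ?thesis by (rule finite_subset) simp
next
  case infinity
  then have "x = 0" "x' = 0" using assms fps_order_eq_infinity_iff by metis+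
  then have "fps_blend u x x' = 0" for u by (simp add: fps_blend_def)
  then show ?thesis using \<open>x = 0\<close> by simp
qed

lemma eval_fps_rot: "eval_fps (fps_rot w x) t = eval_fps x (w * t)"
  by (simp add: eval_fps_def power_mult_distrib mult_ac)

definition puiseux_curve :: "nat \<Rightarrow> complex fps set \<Rightarrow> (complex \<times> complex) set" where
  "puiseux_curve L Y = ramified_curve L (eval_fps ` Y)"

lemma mem_puiseux_curve_iff:
  assumes "L > 0" "fps_rot (cis (2 * pi / L)) ` Y \<subseteq> Y"
  shows "(t ^ L, v) \<in> puiseux_curve L Y \<longleftrightarrow> (\<exists>y\<in>Y. v = eval_fps y t)"
proof -
  have "(\<lambda>t. f (cis (2 * pi / L) * t)) \<in> eval_fps ` Y" if "f \<in> eval_fps ` Y" for f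
  proof -
    from that obtain y where y: "y \<in> Y" "f = eval_fps y" by auto
    then have "(\<lambda>t. f (cis (2 * pi / L) * t)) = eval_fps (fps_rot (cis (2 * pi / L)) y)"
      by (simp add: eval_fps_rot[abs_def])
    then show ?thesis using assms(2) y(1) by auto
  qed
  then show ?thesis unfolding puiseux_curve_def using mem_ramified_curve_iff[OF assms(1)] by auto
qed

lemma eventually_analytic_at:
  assumes "f analytic_on {z}"
  shows "eventually (\<lambda>w. f analytic_on {w}) (nhds z)"
proof -
  obtain S where S: "open S" "z \<in> S" "f holomorphic_on S" using assms by (auto simp: analytic_at)
  then have "f analytic_on {w}" if "w \<in> S" for w using that by (auto simp: analytic_at)
  then show ?thesis using eventually_nhds_in_open[OF S(1,2)] by (auto elim: eventually_mono)
qed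

definition blend :: "complex \<Rightarrow> complex fps \<times> complex fps \<Rightarrow> complex \<Rightarrow> complex" where
  "blend u p t = (1 - u) * eval_fps (fst p) t + u * eval_fps (snd p) t"

definition relative_displacement ::
  "complex fps \<times> complex fps \<Rightarrow> complex fps \<times> complex fps \<Rightarrow> complex \<Rightarrow> complex" where
  "relative_displacement p q t = (eval_fps (snd p) t - eval_fps (fst p) t) - (eval_fps (snd q) t - eval_fps (fst q) t)"

locale contact_correspondence =
  fixes L :: nat and Y Y' :: "complex fps set" and R :: "(complex fps \<times> complex fps) set"
  assumes L: "L > 0" and iso: "contact_iso (cis (2 * pi / L)) Y Y' R"
    and finite: "finite R" and nonempty: "R \<noteq> {}"
    and conv: "\<And>x. x \<in> Y \<union> Y' \<Longrightarrow> fps_conv_radius x > 0"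
    and zero: "\<And>x. x \<in> Y \<union> Y' \<Longrightarrow> fps_nth x 0 = 0"
begin

definition degenerate :: "complex set" where
  "degenerate = (\<Union>p\<in>R. \<Union>q\<in>R.
     {u. fps_order (fps_blend u (fst p - fst q) (snd p - snd q)) \<noteq> fps_order (fst p - fst q)})"

lemma order_eq: "p \<in> R \<Longrightarrow> q \<in> R \<Longrightarrow> fps_order (fst p - fst q) = fps_order (snd p - snd q)"
  using contact_iso_order[OF iso] by simp

lemma finite_degenerate: "finite degenerate"
  unfolding degenerate_def using finite by (intro finite_UN_I finite_fps_order_blend_neq order_eq)

lemma zero_one_notin_degenerate: "0 \<notin> degenerate" "1 \<notin> degenerate"
  using order_eq by (auto simp: degenerate_def fps_blend_def)

lemma eval_has_fps_expansion:
  assumes "p \<in> R"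
  shows "eval_fps (fst p) has_fps_expansion fst p" "eval_fps (snd p) has_fps_expansion snd p"
  using contact_iso_mem[OF iso, of "fst p" "snd p"] assms conv by (simp_all add: eval_fps_has_fps_expansion_self)

lemma blend_has_fps_expansion:
  assumes "p \<in> R"
  shows "blend u p has_fps_expansion fps_blend u (fst p) (snd p)"
  unfolding blend_def[abs_def] fps_blend_def
  by (intro has_fps_expansion_add has_fps_expansion_cmult_left eval_has_fps_expansion assms)

lemma eventually_displacement_le:
  assumes u: "u \<notin> degenerate" and pq: "p \<in> R" "q \<in> R"
  shows "\<exists>K. \<forall>\<^sub>F t in nhds 0. cmod (relative_displacement p q t)
    \<le> K * dist (blend u p t) (blend u q t)"
  unfolding dist_norm
proof (rule has_fps_expansion_imp_eventually_le)
  show "(\<lambda>t. blend u p t - blend u q t) has_fps_expansion fps_blend u (fst p) (snd p) - fps_blend u (fst q) (snd q)"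
    by (intro has_fps_expansion_diff blend_has_fps_expansion pq)
  show "relative_displacement p q has_fps_expansion (snd p - fst p) - (snd q - fst q)"
    unfolding relative_displacement_def[abs_def] by (intro has_fps_expansion_diff eval_has_fps_expansion pq)
  have "fps_order (fps_blend u (fst p) (snd p) - fps_blend u (fst q) (snd q))
      = fps_order (fps_blend u (fst p - fst q) (snd p - snd q))"
    by (simp add: fps_blend_def algebra_simps)
  also have "\<dots> = fps_order (fst p - fst q)" using u pq unfolding degenerate_def by blast
  also have "\<dots> \<le> fps_order ((snd p - snd q) - (fst p - fst q))"
  proof (cases "fps_order (fst p - fst q)")
    case (enat n)
    have "enat n \<le> fps_order (fst p - fst q)" "enat n \<le> fps_order (snd p - snd q)"
      using enat order_eq[OF pq] by simp_all
    then have "enat n \<le> fps_order ((snd p - snd q) - (fst p - fst q))" by (simp add: enat_le_fps_order_iff)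
    then show ?thesis using enat by simp
  qed (use order_eq[OF pq] in \<open>simp add: fps_order_def split: if_splits\<close>)
  also have "(snd p - snd q) - (fst p - fst q) = (snd p - fst p) - (snd q - fst q)" by simp
  finally show "fps_order (fps_blend u (fst p) (snd p) - fps_blend u (fst q) (snd q))
      \<le> fps_order ((snd p - fst p) - (snd q - fst q))" .
qed

lemma blend_rot:
  assumes "p \<in> R"
  shows "\<exists>q\<in>R. \<forall>u. blend u q = (\<lambda>t. blend u p (cis (2 * pi / L) * t))"
  using contact_iso_rot[OF iso, of "fst p" "snd p"] assms
  by (intro bexI[of _ "(fps_rot (cis (2 * pi / L)) (fst p), fps_rot (cis (2 * pi / L)) (snd p))"])
    (auto simp: blend_def[abs_def] eval_fps_rot)

lemma uniform_displacement_bound: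
  assumes u: "u \<notin> degenerate"
  obtains K r where "K > 0" "r > 0"
    "\<And>t p q. cmod t < r \<Longrightarrow> p \<in> R \<Longrightarrow> q \<in> R \<Longrightarrow>
      cmod (relative_displacement p q t) \<le> K * dist (blend u p t) (blend u q t)"
    "\<And>p v. p \<in> R \<Longrightarrow> continuous_on (ball 0 r) (blend v p)"
proof -
  have "\<forall>z\<in>R \<times> R. \<exists>K. \<forall>\<^sub>F t in nhds 0. cmod (relative_displacement (fst z) (snd z) t) \<le> K * dist (blend u (fst z) t) (blend u (snd z) t)"
    using eventually_displacement_le[OF u] by auto
  from bchoice[OF this] obtain k where k: "\<And>p q. p \<in> R \<Longrightarrow> q \<in> R \<Longrightarrow>
      \<forall>\<^sub>F t in nhds 0. cmod (relative_displacement p q t) \<le> k (p, q) * dist (blend u p t) (blend u q t)" by auto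
  define K where "K = max 1 (Max (k ` (R \<times> R)))"
  have "\<forall>\<^sub>F t in nhds 0. \<forall>p\<in>R. eval_fps (fst p) analytic_on {t} \<and> eval_fps (snd p) analytic_on {t}"
    using finite eval_has_fps_expansion has_fps_expansion_imp_analytic_0
    by (intro eventually_ball_finite ballI eventually_conj eventually_analytic_at) blast+
  moreover have "\<forall>\<^sub>F t in nhds 0. \<forall>p\<in>R. \<forall>q\<in>R. cmod (relative_displacement p q t) \<le> k (p, q) * dist (blend u p t) (blend u q t)"
    using finite k by (intro eventually_ball_finite ballI) auto
  ultimately have "\<forall>\<^sub>F t in nhds 0. (\<forall>p\<in>R. eval_fps (fst p) analytic_on {t} \<and> eval_fps (snd p) analytic_on {t})
      \<and> (\<forall>p\<in>R. \<forall>q\<in>R. cmod (relative_displacement p q t) \<le> k (p, q) * dist (blend u p t) (blend u q t))"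
    by (rule eventually_conj)
  then obtain r where r: "r > 0" "\<And>t. cmod t < r \<Longrightarrow> (\<forall>p\<in>R. eval_fps (fst p) analytic_on {t} \<and> eval_fps (snd p) analytic_on {t})
      \<and> (\<forall>p\<in>R. \<forall>q\<in>R. cmod (relative_displacement p q t) \<le> k (p, q) * dist (blend u p t) (blend u q t))"
    unfolding eventually_nhds_metric dist_0_norm by (auto simp: dist_norm)
  show ?thesis
  proof (rule that[of K r])
    fix t p q assume t: "cmod t < r" and pq: "p \<in> R" "q \<in> R"
    have "k (p, q) \<le> Max (k ` (R \<times> R))" using finite pq by (intro Max_ge) auto
    then have "k (p, q) \<le> K" by (simp add: K_def)
    then show "cmod (relative_displacement p q t) \<le> K * dist (blend u p t) (blend u q t)"
      using r(2)[OF t] pq by (meson mult_right_mono order_trans zero_le_dist)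
  next
    show "continuous_on (ball 0 r) (blend v p)" if "p \<in> R" for p v
      unfolding blend_def[abs_def] using r(2) that
      by (intro continuous_at_imp_continuous_on ballI isCont_add isCont_mult continuous_const analytic_at_imp_isCont) auto
  qed (use r(1) in \<open>simp_all add: K_def\<close>)
qed

definition blend_curve :: "complex \<Rightarrow> (complex \<times> complex) set" where
  "blend_curve u = ramified_curve L (blend u ` R)"

lemma germ_equiv_blend_curve_near:
  assumes u: "u \<notin> degenerate"
  shows "\<exists>\<epsilon>>0. \<forall>v. dist u v < \<epsilon> \<longrightarrow> germ_equiv (0, 0) (blend_curve u) (blend_curve v)"
proof -
  obtain K r where K: "K > 0" and r: "r > 0"
    and bound: "\<And>t p q. cmod t < r \<Longrightarrow> p \<in> R \<Longrightarrow> q \<in> R \<Longrightarrow>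
      cmod (relative_displacement p q t) \<le> K * dist (blend u p t) (blend u q t)"
    and cont: "\<And>p v. p \<in> R \<Longrightarrow> continuous_on (ball 0 r) (blend v p)"
    by (rule uniform_displacement_bound[OF u]) (rule that)
  have "germ_equiv (0, 0) (blend_curve u) (blend_curve v)" if v: "dist u v < 1 / (4 * K)" for v
  proof -
    define S where "S = (\<lambda>p. (blend u p, blend v p)) ` R"
    interpret fibrewise_Lipschitz_displacement S L r "1/4"
    proof
      show "(\<lambda>t. y (cis (2 * pi / L) * t), \<lambda>t. y' (cis (2 * pi / L) * t)) \<in> S" if "(y, y') \<in> S" for y y'
      proof -
        from that obtain p where p: "p \<in> R" "y = blend u p" "y' = blend v p" by (auto simp: S_def)
        obtain q where "q \<in> R" "\<And>u. blend u q = (\<lambda>t. blend u p (cis (2 * pi / L) * t))"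
          using blend_rot[OF p(1)] by blast
        then show ?thesis unfolding S_def p(2,3) by (intro image_eqI[of _ _ q]) simp_all
      qed
      fix t y y' z z' assume t: "cmod t < r" and "(y, y') \<in> S" "(z, z') \<in> S"
      then obtain p q where pq: "p \<in> R" "q \<in> R" "y = blend u p" "y' = blend v p" "z = blend u q" "z' = blend v q"
        by (auto simp: S_def)
      have "(y' t - y t) - (z' t - z t)
          = (v - u) * relative_displacement p q t"
        by (simp add: pq blend_def relative_displacement_def algebra_simps)
      then have "cmod ((y' t - y t) - (z' t - z t)) \<le> cmod (v - u) * (K * dist (y t) (z t))"
        using bound[OF t pq(1,2)] by (simp add: norm_mult pq mult_left_mono)
      also have "\<dots> \<le> 1 / (4 * K) * (K * dist (y t) (z t))"
        using v K by (intro mult_right_mono) (simp_all add: dist_norm norm_minus_commute)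
      finally show "cmod ((y' t - y t) - (z' t - z t)) \<le> 1/4 * dist (y t) (z t)" using K by simp
    next
      show "y 0 = 0 \<and> y' 0 = 0" if "(y, y') \<in> S" for y y'
        using that contact_iso_mem[OF iso] zero by (force simp: S_def blend_def eval_fps_at_0)
    qed (use finite nonempty L r cont in \<open>auto simp: S_def\<close>)
    show ?thesis using germ_equiv_displacement by (simp add: blend_curve_def S_def image_image)
  qed
  then show ?thesis using K by (intro exI[of _ "1 / (4 * K)"]) simp
qed

lemma germ_equiv_blend_curve_0_1: "germ_equiv (0, 0) (blend_curve 0) (blend_curve 1)"
proof (rule connected_equivalence_relation[of "UNIV - degenerate" _ _
      "\<lambda>u v. germ_equiv (0, 0) (blend_curve u) (blend_curve v)"])
  show "connected (UNIV - degenerate)"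
    using connected_open_delete_finite[of "UNIV :: complex set"] finite_degenerate convex_connected[OF convex_UNIV]
    by simp
  show "0 \<in> UNIV - degenerate" "1 \<in> UNIV - degenerate" using zero_one_notin_degenerate by auto
  show "\<exists>T. openin (top_of_set (UNIV - degenerate)) T \<and> u \<in> T \<and> (\<forall>v\<in>T. germ_equiv (0, 0) (blend_curve u) (blend_curve v))"
    if "u \<in> UNIV - degenerate" for u
  proof -
    obtain \<epsilon> where "\<epsilon> > 0" "\<And>v. dist u v < \<epsilon> \<Longrightarrow> germ_equiv (0, 0) (blend_curve u) (blend_curve v)"
      using germ_equiv_blend_curve_near[of u] \<open>u \<in> UNIV - degenerate\<close> by blast
    then show ?thesis using \<open>u \<in> UNIV - degenerate\<close>
      by (intro exI[of _ "(UNIV - degenerate) \<inter> ball u \<epsilon>"]) (auto intro: openin_open_Int)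
  qed
qed (use germ_equiv_sym germ_equiv_trans in blast)+

end

theorem germ_equiv_puiseux_curve:
  assumes "finite Y" "Y \<noteq> {}" "L > 0"
    and equiv: "contact_equiv (cis (2 * pi / L)) Y Y'"
    and "\<And>x. x \<in> Y \<union> Y' \<Longrightarrow> fps_conv_radius x > 0"
    and "\<And>x. x \<in> Y \<union> Y' \<Longrightarrow> fps_nth x 0 = 0"
  shows "germ_equiv (0, 0) (puiseux_curve L Y) (puiseux_curve L Y')"
proof -
  obtain R where R: "contact_iso (cis (2 * pi / L)) Y Y' R" using equiv by (auto simp: contact_equiv_def)
  have image: "fst ` R = Y" "snd ` R = Y'"
    using contact_iso_Domain[OF R] contact_iso_Range[OF R] by (simp_all add: Domain_fst Range_snd)
  have "inj_on fst R" by (rule inj_onI) (use contact_iso_eq[OF R] in \<open>auto simp: prod_eq_iff\<close>)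
  then have "finite R" using assms(1) image(1) finite_imageD by blast
  moreover have "R \<noteq> {}" using assms(2) image(1) by auto
  ultimately interpret contact_correspondence L Y Y' R
    using assms R by unfold_locales auto
  have "blend 0 ` R = eval_fps ` Y" "blend 1 ` R = eval_fps ` Y'"
    unfolding image[symmetric] image_image by (simp_all add: blend_def[abs_def])
  then show ?thesis using germ_equiv_blend_curve_0_1 by (simp add: blend_curve_def puiseux_curve_def)
qed

section \<open>Puiseux roots of the polar\<close>

subsection \<open>Substitutions in polynomials over power series\<close>

lemma fps_rot_0 [simp]: "fps_rot w 0 = 0"
  by (simp add: fps_eq_iff)

lemma fps_rot_add: "fps_rot w (f + g) = fps_rot w f + fps_rot w g"
  by (simp add: fps_eq_iff distrib_left)

lemma fps_rot_mult: "fps_rot w (f * g) = fps_rot w f * fps_rot w g" for f :: "'a::idom fps"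
  by (simp add: fps_rot_def fps_compose_mult_distrib)

lemma poly_map_poly_fps_rot:
  fixes P :: "'a::idom fps poly"
  shows "poly (map_poly (fps_rot w) P) (fps_rot w y) = fps_rot w (poly P y)"
  by (induction P) (simp_all add: map_poly_pCons fps_rot_add fps_rot_mult)

lemma fps_rot_compose_X_power:
  fixes f :: "'a::idom fps"
  assumes "w ^ M = 1" "M > 0"
  shows "fps_rot w (f oo fps_X ^ M) = f oo fps_X ^ M"
  using assms by (auto simp: fps_eq_iff fps_nth_compose_X_power power_mult elim!: dvdE)

lemma map_poly_fps_rot_poly_ramify:
  fixes P :: "'a::idom fps poly"
  assumes "w ^ M = 1" "M > 0"
  shows "map_poly (fps_rot w) (poly_ramify M P) = poly_ramify M P"
  by (rule poly_eqI) (simp add: coeff_map_poly coeff_poly_ramify fps_rot_compose_X_power[OF assms])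

lemma poly_ramify_roots_rot:
  assumes "poly_ramify M P = poly_of_roots Y" "w ^ M = 1" "M > 0"
  shows "fps_rot w ` set_mset Y \<subseteq> set_mset Y"
proof
  fix x assume "x \<in> fps_rot w ` set_mset Y"
  then obtain y where "y \<in># Y" "x = fps_rot w y" by auto
  then have "poly (poly_ramify M P) x = 0"
    using poly_map_poly_fps_rot[of w "poly_ramify M P" y] poly_poly_of_roots_eq_0_iff[of Y y]
    unfolding map_poly_fps_rot_poly_ramify[OF assms(2,3)] by (simp add: assms(1))
  then show "x \<in># Y" unfolding assms(1) poly_poly_of_roots_eq_0_iff .
qed

lemma fps_nth_0_poly: "fps_nth (poly P y) 0 = poly (map_poly (\<lambda>f. fps_nth f 0) P) (fps_nth y 0)"
  for P :: "'a::comm_ring_1 fps poly"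
  by (induction P) (simp_all add: map_poly_pCons fps_mult_nth_0)

lemma poly_ramify_roots_nth_0:
  fixes P :: "'a::idom fps poly"
  assumes roots: "poly_ramify M P = poly_of_roots Y" and "M > 0" and "lead_coeff P = 1"
    and low: "\<And>k. k < degree P \<Longrightarrow> fps_nth (coeff P k) 0 = 0" and "y \<in># Y"
  shows "fps_nth y 0 = 0"
proof -
  have "fps_nth (coeff P k) 0 = (if k = degree P then 1 else 0)" for k
    using low[of k] assms(3) by (cases k "degree P" rule: linorder_cases) (simp_all add: coeff_eq_0)
  then have "map_poly (\<lambda>f. fps_nth f 0) (poly_ramify M P) = monom 1 (degree P)"
    by (intro poly_eqI) (simp add: coeff_map_poly coeff_poly_ramify)
  moreover have "poly (poly_ramify M P) y = 0"
    using assms(5) by (simp add: roots poly_poly_of_roots_eq_0_iff)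
  ultimately have "fps_nth y 0 ^ degree P = 0"
    using fps_nth_0_poly[of "poly_ramify M P" y] by (simp add: poly_monom)
  then show ?thesis by simp
qed

definition fps_unramify :: "nat \<Rightarrow> 'a::zero fps \<Rightarrow> 'a fps" where
  "fps_unramify n f = Abs_fps (\<lambda>j. fps_nth f (n * j))"

lemma fps_nth_unramify [simp]: "fps_nth (fps_unramify n f) j = fps_nth f (n * j)"
  by (simp add: fps_unramify_def)

definition poly_unramify :: "nat \<Rightarrow> 'a::zero fps poly \<Rightarrow> 'a fps poly" where
  "poly_unramify n = map_poly (fps_unramify n)"

lemma coeff_poly_unramify: "coeff (poly_unramify n P) k = fps_unramify n (coeff P k)"
  by (simp add: poly_unramify_def coeff_map_poly fps_eq_iff)

lemma poly_unramify_ramify: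
  assumes "n > 0"
  shows "poly_unramify n (poly_ramify n P) = P"
  using assms by (simp add: poly_eq_iff fps_eq_iff coeff_poly_unramify coeff_poly_ramify fps_nth_compose_X_power)

subsection \<open>Zero sets of expanded functions\<close>

definition has_poly_expansion :: "(complex \<times> complex \<Rightarrow> complex) \<Rightarrow> complex fps poly \<Rightarrow> bool" where
  "has_poly_expansion f P \<longleftrightarrow> conv_coeffs P \<and> (\<forall>\<^sub>F x in nhds 0. \<forall>y. f (x, y) = poly (eval_coeffs P x) y)"

lemma filterlim_power_nhds_0: "L > 0 \<Longrightarrow> filterlim (\<lambda>t::complex. t ^ L) (nhds 0) (nhds 0)"
  using isCont_power[OF continuous_ident, of "0 :: complex" L]
  by (simp add: continuous_within tendsto_nhds_iff power_0_left)

lemma has_fps_expansion_compose_X_power: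
  assumes "f has_fps_expansion F" "L > 0"
  shows "(\<lambda>t. f (t ^ L)) has_fps_expansion (F oo fps_X ^ L :: complex fps)"
  using has_fps_expansion_compose[OF assms(1) has_fps_expansion_fps_X_power[of L]] assms(2)
  by (simp add: o_def fps_X_power_nth)

lemma eventually_eval_coeffs_poly_ramify:
  assumes "conv_coeffs P" "L > 0"
  shows "\<forall>\<^sub>F t in nhds 0. eval_coeffs P (t ^ L) = eval_coeffs (poly_ramify L P) t"
proof (rule eventually_eq_eval_coeffs(2))
  show "(\<lambda>t. coeff (eval_coeffs P (t ^ L)) k) has_fps_expansion coeff (poly_ramify L P) k" for k
    unfolding coeff_poly_ramify using assms by (intro has_fps_expansion_compose_X_power conv_coeffs_imp_expansion)
qed (rule always_eventually, rule allI, rule degree_eval_coeffs_le)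

lemma conv_coeffs_poly_of_roots:
  assumes "\<forall>y\<in>#Y. fps_conv_radius y > 0"
  shows "conv_coeffs (poly_of_roots Y)"
  using assms
proof (induction Y)
  case (add y Y)
  then have "conv_coeffs [:- y, 1:]" "conv_coeffs (poly_of_roots Y)" by simp_all
  then show ?case unfolding poly_of_roots_add_mset by (rule conv_coeffs_mult)
qed (simp add: one_pCons)

lemma eventually_eval_coeffs_poly_of_roots:
  assumes "\<forall>y\<in>#Y. fps_conv_radius y > 0"
  shows "\<forall>\<^sub>F t in nhds 0. eval_coeffs (poly_of_roots Y) t = poly_of_roots (image_mset (\<lambda>y. eval_fps y t) Y)"
  using assms
proof (induction Y)
  case empty
  show ?case by (simp add: eval_coeffs_def one_pCons map_poly_pCons)
next
  case (add y Y)
  then have IH: "\<forall>\<^sub>F t in nhds 0. eval_coeffs (poly_of_roots Y) t = poly_of_roots (image_mset (\<lambda>y. eval_fps y t) Y)"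
    and conv: "conv_coeffs [:- y, 1:]" "conv_coeffs (poly_of_roots Y)"
    by (simp_all add: conv_coeffs_poly_of_roots)
  have "\<forall>\<^sub>F t in nhds 0. eval_fps (- y) t = - eval_fps y t"
    using add.prems
    by (intro has_fps_expansion_eventually_eq[of _ "- y"] has_fps_expansion_minus eval_fps_has_fps_expansion_self)
      simp_all
  then show ?case
    using IH eventually_eval_coeffs_mult[OF conv]
  proof eventually_elim
    case (elim t)
    have "eval_coeffs [:- y, 1:] t = [:- eval_fps y t, 1:]"
      using elim(1) by (simp add: eval_coeffs_def map_poly_pCons)
    then show ?case using elim(2,3) by (simp only: poly_of_roots_add_mset image_mset_add_mset)
  qed
qed

theorem germ_equiv_zero_set_puiseux_curve:
  assumes g: "has_poly_expansion g (smult u P)" and P: "conv_coeffs P"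
    and u: "fps_conv_radius u > 0" "fps_nth u 0 \<noteq> 0" and L: "L > 0"
    and Y: "poly_ramify L P = poly_of_roots Y" "\<forall>y\<in>#Y. fps_conv_radius y > 0"
  shows "germ_equiv (0, 0) {p. g p = 0} (puiseux_curve L (set_mset Y))"
proof -
  have "\<forall>\<^sub>F x in nhds 0. eval_coeffs (smult u P) x = eval_coeffs [:u:] x * eval_coeffs P x"
    using eventually_eval_coeffs_mult[of "[:u:]" P] u(1) P by simp
  moreover have "\<forall>\<^sub>F x in nhds 0. eval_fps u x \<noteq> 0"
    using has_fps_expansion_imp_analytic_0[OF eval_fps_has_fps_expansion_self[OF u(1)]] u(2)
    by (intro tendsto_imp_eventually_ne[where c = "eval_fps u 0"])
      (auto simp: eval_fps_at_0 dest!: analytic_at_imp_isCont simp: continuous_within tendsto_nhds_iff)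
  moreover have "\<forall>\<^sub>F x in nhds 0. \<forall>y. g (x, y) = poly (eval_coeffs (smult u P) x) y"
    using g by (simp add: has_poly_expansion_def)
  ultimately have "\<forall>\<^sub>F x in nhds 0. \<forall>y. g (x, y) = 0 \<longleftrightarrow> poly (eval_coeffs P x) y = 0"
    by eventually_elim (simp add: eval_coeffs_def map_poly_pCons)
  from eventually_compose_filterlim[OF this filterlim_power_nhds_0[OF L]]
  have "\<forall>\<^sub>F t in nhds 0. \<forall>y. g (t ^ L, y) = 0 \<longleftrightarrow> (\<exists>x\<in>#Y. y = eval_fps x t)"
    using eventually_eval_coeffs_poly_ramify[OF P L] eventually_eval_coeffs_poly_of_roots[OF Y(2)]
    unfolding Y(1) by eventually_elim (auto simp: poly_poly_of_roots_eq_0_iff)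
  then obtain r where r: "r > 0" "\<And>t y. cmod t < r \<Longrightarrow> g (t ^ L, y) = 0 \<longleftrightarrow> (\<exists>x\<in>#Y. y = eval_fps x t)"
    unfolding eventually_nhds_metric by (auto simp: dist_norm)
  have rot: "fps_rot (cis (2 * pi / L)) ` set_mset Y \<subseteq> set_mset Y"
    using poly_ramify_roots_rot[OF Y(1), of "cis (2 * pi / L)"] L by (simp add: Complex.DeMoivre)
  show ?thesis
  proof (rule germ_equiv_local)
    define U where "U = ball (0 :: complex) (r ^ L) \<times> (UNIV :: complex set)"
    show "open U" "(0, 0) \<in> U" using r(1) by (auto simp: U_def open_Times)
    have "g p = 0 \<longleftrightarrow> p \<in> puiseux_curve L (set_mset Y)" if "p \<in> U" for p
    proof -
      from that obtain t v where "cmod t < r" "p = (t ^ L, v)"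
        unfolding U_def image_power_ball[OF L r(1), symmetric] by auto
      then show ?thesis using r(2) mem_puiseux_curve_iff[OF L rot] by simp
    qed
    then show "U \<inter> {p. g p = 0} = U \<inter> puiseux_curve L (set_mset Y)" by blast
  qed
qed

subsection \<open>The equation of the branch\<close>

definition branch_fps :: "nat \<Rightarrow> nat \<Rightarrow> (nat \<Rightarrow> complex) \<Rightarrow> complex fps" where
  "branch_fps v1 N z = fps_X ^ v1 + (\<Sum>j<N. fps_const (z j) * fps_X ^ (v1 + 1 + j))"

lemma byp_has_fps_expansion: "byp v1 N z has_fps_expansion branch_fps v1 N z"
  unfolding byp_def[abs_def] branch_fps_def by (intro fps_expansion_intros)

lemma fps_nth_branch_fps_low: "k < v1 \<Longrightarrow> fps_nth (branch_fps v1 N z) k = 0"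
  by (auto simp: branch_fps_def fps_sum_nth intro!: sum.neutral)

definition fps_conjugates :: "nat \<Rightarrow> complex fps \<Rightarrow> complex fps multiset" where
  "fps_conjugates n y = image_mset (\<lambda>k. fps_rot (cis (2 * pi / n) ^ k) y) (mset_set {..<n})"

definition branch_poly :: "nat \<Rightarrow> nat \<Rightarrow> nat \<Rightarrow> (nat \<Rightarrow> complex) \<Rightarrow> complex fps poly" where
  "branch_poly v0 v1 N z = poly_unramify v0 (poly_of_roots (fps_conjugates v0 (branch_fps v1 N z)))"

lemma value_semigroup_rot:
  assumes "w ^ n = 1" and rot: "\<forall>\<^sub>F t in nhds 0. Y (w * t) = Y t" and "i \<in> value_semigroup (bx n) Y"
  shows "w ^ i = 1"
proof -
  obtain F h where h: "h analytic_on {0}" "h 0 \<noteq> 0" "\<forall>\<^sub>F t in nhds 0. F (bx n t, Y t) = t ^ i * h t"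
    using assms(3) unfolding value_semigroup_def ord0_def by blast
  have "isCont (\<lambda>t. w * t) 0" by (intro continuous_intros)
  then have "filterlim (\<lambda>t. w * t) (nhds 0) (nhds 0)" by (simp add: continuous_within tendsto_nhds_iff)
  from eventually_compose_filterlim[OF h(3) this]
  have "\<forall>\<^sub>F t in nhds 0. t ^ i * h t = (w * t) ^ i * h (w * t)"
    using h(3) rot by eventually_elim (metis (no_types) assms(1) bx_def mult_1 power_mult_distrib)
  then have "\<forall>\<^sub>F t in at 0. t ^ i * h t = (w * t) ^ i * h (w * t)" by (simp add: eventually_nhds_conv_at)
  then have eq: "\<forall>\<^sub>F t in at 0. h t = w ^ i * h (w * t)"
    using eventually_neq_at_within[of 0 0 UNIV] by eventually_elim (auto simp: power_mult_distrib)
  have cont: "isCont h 0" using h(1) by (rule analytic_at_imp_isCont)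
  then have "isCont (\<lambda>t. w ^ i * h (w * t)) 0"
    by (intro continuous_intros isCont_o2[of 0 "\<lambda>t. w * t" h]) auto
  then have "((\<lambda>t. w ^ i * h (w * t)) \<longlongrightarrow> w ^ i * h 0) (at 0)" using isContD by fastforce
  moreover have "((\<lambda>t. w ^ i * h (w * t)) \<longlongrightarrow> h 0) (at 0)"
    by (rule Lim_transform_eventually[OF isContD[OF cont] eq])
  ultimately have "w ^ i * h 0 = h 0" by (rule tendsto_unique[OF trivial_limit_at])
  then show ?thesis using h(2) by simp
qed

lemma has_fps_expansion_rot_invariant:
  assumes "f has_fps_expansion F" "fps_rot w F = F"
  shows "\<forall>\<^sub>F t in nhds 0. f (w * t) = f t"
proof -
  have "isCont (\<lambda>t. w * t) 0" by (intro continuous_intros)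
  then have "filterlim (\<lambda>t. w * t) (nhds 0) (nhds 0)" by (simp add: continuous_within tendsto_nhds_iff)
  moreover have eval: "\<forall>\<^sub>F t in nhds 0. eval_fps F t = f t" using assms(1) by (simp add: has_fps_expansion_def)
  ultimately have "\<forall>\<^sub>F t in nhds 0. eval_fps F (w * t) = f (w * t)" by (rule eventually_compose_filterlim[rotated])
  with eval show ?thesis by eventually_elim (metis assms(2) eval_fps_rot)
qed

lemma rot_invariant_imp_eq_1:
  assumes Y: "Y has_fps_expansion y" and "w ^ n = 1" "fps_rot w y = y"
    and cofinite: "finite (UNIV - value_semigroup (bx n) Y)"
  shows "w = 1"
proof -
  obtain b where b: "\<forall>x\<in>UNIV - value_semigroup (bx n) Y. x < b"
    using finite_nat_set_iff_bounded cofinite by blast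
  then have "b \<in> value_semigroup (bx n) Y" "Suc b \<in> value_semigroup (bx n) Y"
    by (metis DiffI UNIV_I less_irrefl, metis DiffI UNIV_I Suc_lessD less_irrefl)
  then have "w ^ b = 1" "w ^ Suc b = 1"
    using value_semigroup_rot[of w n Y, OF assms(2) has_fps_expansion_rot_invariant[OF Y assms(3)]] by blast+
  then show ?thesis by simp
qed

lemma inj_on_fps_conjugates:
  assumes Y: "Y has_fps_expansion y" and "n > 0" and cofinite: "finite (UNIV - value_semigroup (bx n) Y)"
  shows "inj_on (\<lambda>k. fps_rot (cis (2 * pi / n) ^ k) y) {..<n}"
proof (rule linorder_inj_onI)
  fix k l assume kl: "k < l" "k \<in> {..<n}" "l \<in> {..<n}"
  define w where "w = cis (2 * pi / n)"
  have w: "w ^ n = 1" "w \<noteq> 0" using assms(2) by (simp_all add: w_def Complex.DeMoivre)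
  show "fps_rot (cis (2 * pi / n) ^ k) y \<noteq> fps_rot (cis (2 * pi / n) ^ l) y"
  proof
    assume "fps_rot (cis (2 * pi / n) ^ k) y = fps_rot (cis (2 * pi / n) ^ l) y"
    then have "fps_rot (w ^ (n - k)) (fps_rot (w ^ k) y) = fps_rot (w ^ (n - k)) (fps_rot (w ^ l) y)"
      by (simp add: w_def)
    moreover have "w ^ (n - k) * w ^ l = w ^ (l - k)"
    proof -
      have "w ^ (n - k) * w ^ l = w ^ (n + (l - k))" using kl by (simp flip: power_add)
      then show ?thesis by (simp add: power_add w(1))
    qed
    ultimately have "fps_rot (w ^ (l - k)) y = y"
      using kl w(1) by (simp add: fps_rot_rot flip: power_add)
    moreover have "(w ^ (l - k)) ^ n = 1" using w(1) by (metis mult.commute power_mult power_one)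
    ultimately have "w ^ (l - k) = 1" using rot_invariant_imp_eq_1[OF Y _ _ cofinite] by blast
    then have eq: "cis (2 * pi * real (l - k) / real n) = cis (2 * pi * real 0 / real n)"
      by (simp add: w_def Complex.DeMoivre mult_ac)
    have inj: "inj_on (\<lambda>k. cis (2 * pi * real k / real n)) {..<n}"
      using Complex.bij_betw_roots_unity[OF assms(2)] by (simp add: bij_betw_def)
    have "l - k = 0" by (rule inj_onD[OF inj eq]) (use kl in auto)
    then show False using kl by simp
  qed
qed auto

lemma weierstrass_eq_has_poly_expansion:
  assumes "weierstrass_eq n X Y f"
  obtains W where "degree W = n" "lead_coeff W = 1" "has_poly_expansion f W" "\<forall>\<^sub>F t in nhds 0. f (X t, Y t) = 0"
proof -
  obtain a where a: "\<And>k. k < n \<Longrightarrow> a k analytic_on {0}" "f = (\<lambda>(x, y). y ^ n + (\<Sum>k<n. a k x * y ^ k))"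
    and zero: "\<forall>\<^sub>F t in nhds 0. f (X t, Y t) = 0"
    using assms unfolding weierstrass_eq_def by blast
  define p where "p x = monom 1 n + (\<Sum>k<n. monom (a k x) k)" for x
  define W where "W = monom 1 n + (\<Sum>k<n. monom (fps_expansion (a k) 0) k)"
  have coeff_p: "coeff (p x) k = (if k = n then 1 else if k < n then a k x else 0)" for x k
    by (auto simp: p_def coeff_sum coeff_monom)
  have coeff_W: "coeff W k = (if k = n then 1 else if k < n then fps_expansion (a k) 0 else 0)" for k
    by (auto simp: W_def coeff_sum coeff_monom)
  have W: "degree W = n" "lead_coeff W = 1" by (rule monic_polyI[of _ n]; simp add: coeff_W)+
  have expansion: "(\<lambda>x. coeff (p x) k) has_fps_expansion coeff W k" for k
    using a(1) analytic_at_imp_has_fps_expansion_0[of "a k"] by (auto simp: coeff_p coeff_W)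
  have degree: "\<forall>\<^sub>F x in nhds 0. degree (p x) \<le> n"
    by (intro always_eventually allI degree_le) (simp add: coeff_p)
  have "\<forall>\<^sub>F x in nhds 0. \<forall>y. f (x, y) = poly (eval_coeffs W x) y"
    using eventually_eq_eval_coeffs(2)[OF expansion degree]
  proof eventually_elim
    case (elim x)
    then show ?case unfolding elim[symmetric] by (simp add: a(2) p_def poly_monom poly_sum)
  qed
  then have "has_poly_expansion f W"
    using eventually_eq_eval_coeffs(1)[OF expansion degree] by (simp add: has_poly_expansion_def)
  with W show ?thesis using zero by (rule that)
qed

lemma poly_ramify_root:
  assumes f: "has_poly_expansion f W" and "n > 0"
    and Y: "Y has_fps_expansion y" and zero: "\<forall>\<^sub>F t in nhds 0. f (t ^ n, Y t) = 0"
  shows "poly (poly_ramify n W) y = 0"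
proof -
  have conv: "conv_coeffs W" and eval: "\<forall>\<^sub>F x in nhds 0. \<forall>y. f (x, y) = poly (eval_coeffs W x) y"
    using f by (simp_all add: has_poly_expansion_def)
  have "(\<lambda>t. \<Sum>k\<le>degree W. coeff (eval_coeffs W (t ^ n)) k * Y t ^ k) has_fps_expansion
      (\<Sum>k\<le>degree W. coeff (poly_ramify n W) k * y ^ k)"
    unfolding coeff_poly_ramify
    by (intro has_fps_expansion_sum has_fps_expansion_mult has_fps_expansion_power Y
        has_fps_expansion_compose_X_power conv_coeffs_imp_expansion conv \<open>n > 0\<close>)
  also have "(\<Sum>k\<le>degree W. coeff (poly_ramify n W) k * y ^ k) = poly (poly_ramify n W) y"
    using poly_eq_sum_coeff[of "poly_ramify n W" "degree W" y] \<open>n > 0\<close> by (simp add: degree_poly_ramify)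
  finally have expansion: "(\<lambda>t. poly (eval_coeffs W (t ^ n)) (Y t)) has_fps_expansion poly (poly_ramify n W) y"
    by (simp add: poly_eq_sum_coeff[OF degree_eval_coeffs_le])
  have "\<forall>\<^sub>F t in nhds 0. poly (eval_coeffs W (t ^ n)) (Y t) = 0"
    using eventually_compose_filterlim[OF eval filterlim_power_nhds_0[OF \<open>n > 0\<close>]] zero by eventually_elim simp
  then have "(\<lambda>t. poly (eval_coeffs W (t ^ n)) (Y t)) has_fps_expansion 0" by (simp add: has_fps_expansion_0_iff)
  then show ?thesis using expansion fps_expansion_unique_complex by blast
qed

theorem weierstrass_eq_has_branch_poly_expansion:
  assumes v0: "v0 > 0" and cofinite: "finite (UNIV - value_semigroup (bx v0) (byp v1 N z))"
    and f: "weierstrass_eq v0 (bx v0) (byp v1 N z) f"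
  shows "has_poly_expansion f (branch_poly v0 v1 N z)"
proof -
  define y where "y = branch_fps v1 N z"
  obtain W where W: "degree W = v0" "lead_coeff W = 1" "has_poly_expansion f W"
    and zero: "\<forall>\<^sub>F t in nhds 0. f (bx v0 t, byp v1 N z t) = 0"
    by (rule weierstrass_eq_has_poly_expansion[OF f]) (rule that)
  have root: "poly (poly_ramify v0 W) y = 0"
    unfolding y_def using zero
    by (intro poly_ramify_root[OF W(3) v0 byp_has_fps_expansion]) (simp add: bx_def)
  have "poly_ramify v0 W = poly_of_roots (fps_conjugates v0 y)"
    unfolding fps_conjugates_def
  proof (rule monic_eq_poly_of_distinct_roots)
    show "inj_on (\<lambda>k. fps_rot (cis (2 * pi / v0) ^ k) y) {..<v0}"
      unfolding y_def by (rule inj_on_fps_conjugates[OF byp_has_fps_expansion v0 cofinite])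
    show "poly (poly_ramify v0 W) (fps_rot (cis (2 * pi / v0) ^ k) y) = 0" for k
    proof -
      have "(cis (2 * pi / v0) ^ k) ^ v0 = (cis (2 * pi / v0) ^ v0) ^ k" by (simp add: mult.commute flip: power_mult)
      also have "\<dots> = 1" using v0 by (simp add: Complex.DeMoivre)
      finally show ?thesis
        using poly_map_poly_fps_rot[of "cis (2 * pi / v0) ^ k" "poly_ramify v0 W" y] root v0
        by (simp add: map_poly_fps_rot_poly_ramify)
    qed
  qed (use W v0 in \<open>simp_all add: degree_poly_ramify coeff_poly_ramify\<close>)
  then have "W = branch_poly v0 v1 N z"
    unfolding branch_poly_def y_def using poly_unramify_ramify[OF v0, of W] by simp
  then show ?thesis using W(3) by simp
qed

subsection \<open>The equation of the polar\<close>

definition polar_poly :: "complex \<Rightarrow> complex \<Rightarrow> complex fps poly \<Rightarrow> complex fps poly" where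
  "polar_poly a b P = smult (fps_const a) (map_poly fps_deriv P) + smult (fps_const b) (pderiv P)"

lemma coeff_polar_poly:
  "coeff (polar_poly a b P) k = fps_const a * fps_deriv (coeff P k) + fps_const b * (of_nat (Suc k) * coeff P (Suc k))"
  by (simp add: polar_poly_def coeff_map_poly coeff_pderiv)

lemma eventually_polar_eq_poly:
  assumes f: "\<forall>\<^sub>F x in nhds 0. \<forall>y. f (x, y) = poly (p x) y" and p: "poly_family (ball 0 r) d p" and "r > 0"
  shows "\<forall>\<^sub>F x in nhds 0. \<forall>y. polar f a b (x, y) = poly (smult a (poly_family_deriv d p x) + smult b (pderiv (p x))) y"
proof -
  have "\<forall>\<^sub>F x in nhds 0. x \<in> ball 0 r" using \<open>r > 0\<close> by (intro eventually_nhds_in_open) auto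
  then show ?thesis
    using f[THEN eventually_eventually[THEN iffD2]]
  proof eventually_elim
    case (elim x)
    have "deriv (\<lambda>s. f (s, y)) x = poly (poly_family_deriv d p x) y" for y
    proof -
      have "\<forall>\<^sub>F s in nhds x. f (s, y) = poly (p s) y" using elim(2) by eventually_elim simp
      then have "deriv (\<lambda>s. f (s, y)) x = deriv (\<lambda>s. poly (p s) y) x" by (rule deriv_cong_ev) simp
      also have "\<dots> = poly (poly_family_deriv d p x) y"
        using poly_family_has_field_derivative[OF p _ elim(1)] elim(1)
        by (intro DERIV_imp_deriv) (simp add: at_within_open[of x "ball 0 r"])
      finally show ?thesis .
    qed
    moreover have "deriv (\<lambda>s. f (x, s)) y = poly (pderiv (p x)) y" for y
    proof -
      have "(\<lambda>s. f (x, s)) = poly (p x)" using eventually_nhds_x_imp_x[OF elim(2)] by auto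
      then show ?thesis by (simp add: DERIV_imp_deriv[OF poly_DERIV])
    qed
    ultimately show ?case by (simp add: polar_def)
  qed
qed

lemma polar_has_poly_expansion:
  assumes f: "has_poly_expansion f P"
  shows "has_poly_expansion (polar f a b) (polar_poly a b P)"
proof -
  define p where "p = eval_coeffs P"
  define d where "d = degree P"
  have conv: "conv_coeffs P" and eval: "\<forall>\<^sub>F x in nhds 0. \<forall>y. f (x, y) = poly (p x) y"
    using f by (simp_all add: has_poly_expansion_def p_def)
  obtain r where r: "r > 0" "poly_family (ball 0 r) d p"
    using obtain_poly_family_eval_coeffs[OF conv] unfolding p_def d_def by blast
  define q where "q x = smult a (poly_family_deriv d p x) + smult b (pderiv (p x))" for x
  have expansion: "(\<lambda>x. coeff (q x) k) has_fps_expansion coeff (polar_poly a b P) k" for k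
  proof -
    have "(\<lambda>x. coeff (poly_family_deriv d p x) k) has_fps_expansion fps_deriv (coeff P k)"
      using has_fps_expansion_deriv[OF conv_coeffs_imp_expansion[OF conv]]
      by (cases "k \<le> d") (simp_all add: coeff_poly_family_deriv p_def d_def coeff_eq_0)
    then show ?thesis
      unfolding q_def coeff_polar_poly coeff_add coeff_smult coeff_pderiv fps_of_nat[symmetric]
      using conv_coeffs_imp_expansion[OF conv]
      by (intro has_fps_expansion_add has_fps_expansion_cmult_left) (simp_all add: p_def)
  qed
  have degree: "\<forall>\<^sub>F x in nhds 0. degree (q x) \<le> d"
    using degree_eval_coeffs_le[of P] unfolding q_def
    by (intro always_eventually allI degree_add_le degree_le)
      (auto simp: coeff_poly_family_deriv coeff_pderiv p_def d_def coeff_eval_coeffs coeff_eq_0)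
  have "\<forall>\<^sub>F x in nhds 0. \<forall>y. polar f a b (x, y) = poly (eval_coeffs (polar_poly a b P) x) y"
    using eventually_polar_eq_poly[OF eval r(2,1), of a b, folded q_def] eventually_eq_eval_coeffs(2)[OF expansion degree]
    by eventually_elim simp
  then show ?thesis
    using eventually_eq_eval_coeffs(1)[OF expansion degree] by (simp add: has_poly_expansion_def)
qed

text \<open>The coefficients of the polar below the leading one vanish at the origin because those of the branch vanish
  to order at least two, its roots having order \<open>v1 > v0\<close> in the parameter.\<close>

definition flat_monic :: "nat \<Rightarrow> complex fps poly \<Rightarrow> bool" where
  "flat_monic n P \<longleftrightarrow> degree P = n \<and> lead_coeff P = 1 \<and> (\<forall>k<n. \<forall>j<2. fps_nth (coeff P k) j = 0)"

definition monic_polar :: "complex \<Rightarrow> complex fps poly \<Rightarrow> complex fps poly" where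
  "monic_polar l P = smult (inverse (coeff (polar_poly l 1 P) (degree P - 1))) (polar_poly l 1 P)"

lemma fps_nth_polar_poly_0:
  assumes "flat_monic (Suc m) P"
  shows "fps_nth (coeff (polar_poly l 1 P) k) 0 = (if k = m then of_nat (Suc m) else 0)"
proof -
  have P: "coeff P (Suc m) = 1" "\<forall>k>Suc m. coeff P k = 0" "\<forall>k\<le>m. \<forall>j<2. fps_nth (coeff P k) j = 0"
    using assms by (auto simp: flat_monic_def coeff_eq_0)
  consider "k < m" | "k = m" | "k = Suc m" | "k > Suc m" by linarith
  then show ?thesis
    by cases (use P in \<open>simp_all add: coeff_polar_poly flip: fps_of_nat\<close>)
qed

lemma
  fixes l :: complex and P :: "complex fps poly"
  assumes P: "flat_monic (Suc m) P"
  defines "u \<equiv> coeff (polar_poly l 1 P) m"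
  shows polar_poly_eq_smult_monic_polar: "polar_poly l 1 P = smult u (monic_polar l P)"
    and polar_poly_leading_unit: "fps_nth u 0 \<noteq> 0"
    and degree_monic_polar: "degree (monic_polar l P) = m"
    and lead_coeff_monic_polar: "lead_coeff (monic_polar l P) = 1"
    and coeff_monic_polar_nth_0: "\<And>k. k < m \<Longrightarrow> fps_nth (coeff (monic_polar l P) k) 0 = 0"
proof -
  have degree: "degree P = Suc m" and "lead_coeff P = 1" using P unfolding flat_monic_def by blast+
  then have lead: "coeff P (Suc m) = 1" by simp
  show u: "fps_nth u 0 \<noteq> 0" unfolding u_def fps_nth_polar_poly_0[OF P] by (simp del: of_nat_Suc)
  then have unit: "inverse u * u = 1" by (rule inverse_mult_eq_1)
  have monic: "monic_polar l P = smult (inverse u) (polar_poly l 1 P)"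
    by (simp add: monic_polar_def u_def degree)
  show "polar_poly l 1 P = smult u (monic_polar l P)" using unit by (simp add: monic mult.commute)
  have "coeff (polar_poly l 1 P) k = 0" if "k > m" for k
    using that degree lead by (cases "k = Suc m") (simp_all add: coeff_polar_poly coeff_eq_0)
  then show "degree (monic_polar l P) = m" "lead_coeff (monic_polar l P) = 1"
    by (intro monic_polyI[of _ m]; simp add: monic u_def[symmetric] unit)+
  show "fps_nth (coeff (monic_polar l P) k) 0 = 0" if "k < m" for k
    using that by (simp add: monic fps_mult_nth_0 fps_nth_polar_poly_0[OF P])
qed

lemma conv_coeffs_polar_poly:
  assumes "conv_coeffs P"
  shows "conv_coeffs (polar_poly a b P)"
proof -
  have "has_poly_expansion (\<lambda>(x, y). poly (eval_coeffs P x) y) P"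
    using assms by (simp add: has_poly_expansion_def)
  then show ?thesis using polar_has_poly_expansion has_poly_expansion_def by blast
qed

lemma conv_coeffs_monic_polar:
  assumes "flat_monic (Suc m) P" "conv_coeffs P"
  shows "conv_coeffs (monic_polar l P)"
proof -
  have "degree P = Suc m" using assms(1) by (simp add: flat_monic_def)
  moreover have "fps_conv_radius (inverse (coeff (polar_poly l 1 P) m)) > 0"
    using conv_coeffs_polar_poly[OF assms(2)] polar_poly_leading_unit[OF assms(1)]
    by (simp add: conv_coeffs_def fps_conv_radius_inverse_pos)
  ultimately show ?thesis
    using conv_coeffs_polar_poly[OF assms(2)]
    by (auto simp: monic_polar_def conv_coeffs_def intro: fps_conv_radius_pos_mult)
qed

lemma coeff_poly_of_roots_add_mset:
  "coeff (poly_of_roots (add_mset a A)) k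
    = (case k of 0 \<Rightarrow> 0 | Suc j \<Rightarrow> coeff (poly_of_roots A) j) - a * coeff (poly_of_roots A) k"
  by (cases k) simp_all

lemma fps_nth_coeff_poly_of_roots_low:
  fixes A :: "'a::idom fps multiset"
  assumes "\<And>a j. a \<in># A \<Longrightarrow> j < d \<Longrightarrow> fps_nth a j = 0" "k < size A" "j < d"
  shows "fps_nth (coeff (poly_of_roots A) k) j = 0"
  using assms
proof (induction A arbitrary: k j)
  case (add a A)
  have "fps_nth (a * coeff (poly_of_roots A) k) j = 0"
    unfolding fps_mult_nth using add.prems by (intro sum.neutral) auto
  moreover have "fps_nth (case k of 0 \<Rightarrow> 0 | Suc i \<Rightarrow> coeff (poly_of_roots A) i) j = 0"
    using add.prems by (cases k) (auto intro!: add.IH)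
  ultimately show ?case by (simp only: coeff_poly_of_roots_add_mset fps_sub_nth diff_0_right)
qed simp

lemma flat_monic_branch_poly:
  assumes "v0 > 0" "v1 > v0"
  shows "flat_monic v0 (branch_poly v0 v1 N z)"
proof -
  define A where "A = fps_conjugates v0 (branch_fps v1 N z)"
  have A: "size A = v0" "\<And>a j. a \<in># A \<Longrightarrow> j < v1 \<Longrightarrow> fps_nth a j = 0"
    by (auto simp: A_def fps_conjugates_def fps_nth_branch_fps_low)
  have coeff: "coeff (branch_poly v0 v1 N z) k = fps_unramify v0 (coeff (poly_of_roots A) k)" for k
    by (simp add: branch_poly_def A_def coeff_poly_unramify)
  have "coeff (poly_of_roots A) v0 = 1" using lead_coeff_poly_of_roots[of A] by (simp add: A(1))
  then have "coeff (branch_poly v0 v1 N z) v0 = 1" using assms(1) by (simp add: coeff fps_eq_iff)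
  moreover have "coeff (branch_poly v0 v1 N z) k = 0" if "k > v0" for k
    using that by (simp add: coeff fps_eq_iff coeff_eq_0 A(1))
  ultimately have "degree (branch_poly v0 v1 N z) = v0" "lead_coeff (branch_poly v0 v1 N z) = 1"
    by (intro monic_polyI; blast)+
  moreover have "fps_nth (coeff (branch_poly v0 v1 N z) k) j = 0" if "k < v0" "j < 2" for k j
    using that assms fps_nth_coeff_poly_of_roots_low[of A v1, OF A(2)] by (auto simp: coeff A(1) less_2_cases_iff)
  ultimately show ?thesis by (simp add: flat_monic_def)
qed

theorem polar_germ_equiv_puiseux_curve:
  assumes f: "has_poly_expansion f P" and P: "flat_monic (Suc m) P" and b: "b \<noteq> 0" and L: "L > 0"
    and Y: "poly_ramify L (monic_polar (a / b) P) = poly_of_roots Y" "\<forall>y\<in>#Y. fps_conv_radius y > 0"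
  shows "germ_equiv (0, 0) {p. polar f a b p = 0} (puiseux_curve L (set_mset Y))"
proof -
  have "polar f (a / b) 1 p = polar f a b p / b" for p
    using b by (simp add: polar_def case_prod_beta field_simps)
  then have zeros: "{p. polar f a b p = 0} = {p. polar f (a / b) 1 p = 0}" using b by simp
  have conv: "conv_coeffs P" using f by (simp add: has_poly_expansion_def)
  define u where "u = coeff (polar_poly (a / b) 1 P) m"
  have u: "fps_conv_radius u > 0" "fps_nth u 0 \<noteq> 0"
    using conv_coeffs_polar_poly[OF conv] polar_poly_leading_unit[OF P] by (simp_all add: u_def conv_coeffs_def)
  have "polar_poly (a / b) 1 P = smult u (monic_polar (a / b) P)"
    unfolding u_def by (rule polar_poly_eq_smult_monic_polar[OF P])
  then have "has_poly_expansion (polar f (a / b) 1) (smult u (monic_polar (a / b) P))"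
    using polar_has_poly_expansion[OF f, of "a / b" 1] by simp
  then show ?thesis
    unfolding zeros by (rule germ_equiv_zero_set_puiseux_curve[OF _ conv_coeffs_monic_polar[OF P conv] u L Y])
qed

subsection \<open>Dependence on the parameters\<close>

lemma param_fps_deriv: "param_fps N S \<Longrightarrow> param_fps N (\<lambda>s. fps_deriv (S s))"
  by (auto simp: param_fps_def intro!: param_fun_mult param_fun_const)

lemma param_fps_inverse:
  assumes S: "param_fps N S" and const: "\<And>s. fps_nth (S s) 0 = c"
  shows "param_fps N (\<lambda>s. inverse (S s))"
  unfolding param_fps_def
proof
  show "param_fun N (\<lambda>s. fps_nth (inverse (S s)) n)" for n
  proof (induction n rule: less_induct)
    case (less n)
    show ?case
    proof (cases n)
      case 0
      then show ?thesis using param_fun_const by (simp add: const)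
    next
      case (Suc m)
      have "fps_nth (inverse (S s)) n
          = - inverse c * (\<Sum>i = 1..n. fps_nth (S s) i * fps_nth (inverse (S s)) (n - i))" for s
        using Suc by (simp add: fps_inverse_def const)
      moreover have "param_fun N (\<lambda>s. - inverse c * (\<Sum>i = 1..n. fps_nth (S s) i * fps_nth (inverse (S s)) (n - i)))"
        using S less.IH by (intro param_fun_mult param_fun_sum param_fun_const) (auto simp: param_fps_def)
      ultimately show ?thesis by simp
    qed
  qed
qed

lemma param_fps_coeff_poly_of_roots:
  assumes "\<And>i. i \<in># A \<Longrightarrow> param_fps N (y i)"
  shows "param_fps N (\<lambda>s. coeff (poly_of_roots (image_mset (\<lambda>i. y i s) A)) k)"
  using assms
proof (induction A arbitrary: k)
  case (add i A)
  have "param_fps N (\<lambda>s. case k of 0 \<Rightarrow> 0 | Suc j \<Rightarrow> coeff (poly_of_roots (image_mset (\<lambda>i. y i s) A)) j)"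
    using add by (cases k) (simp_all add: param_fps_const)
  then show ?case
    unfolding image_mset_add_mset coeff_poly_of_roots_add_mset using add
    by (intro param_fps_diff param_fps_mult) simp_all
qed (simp add: param_fps_const)

lemma param_fps_branch_poly: "param_fps N (\<lambda>s. coeff (branch_poly v0 v1 N (fst s)) k)"
proof -
  have "param_fun N (\<lambda>s. fps_nth (branch_fps v1 N (fst s)) i)" for i
    unfolding branch_fps_def fps_add_nth fps_sum_nth fps_mult_left_const_nth
    by (intro param_fun_add param_fun_sum param_fun_mult param_fun_const param_fun_poly_fun[OF poly_fun_var, of _ N]) auto
  then have "param_fps N (\<lambda>s. fps_rot w (branch_fps v1 N (fst s)))" for w
    by (auto simp: param_fps_def intro!: param_fun_mult param_fun_const)
  then have "param_fps N (\<lambda>s. coeff (poly_of_roots (fps_conjugates v0 (branch_fps v1 N (fst s)))) k)"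
    unfolding fps_conjugates_def by (intro param_fps_coeff_poly_of_roots)
  then show ?thesis by (simp add: branch_poly_def coeff_poly_unramify param_fps_def)
qed

lemma param_fps_monic_polar:
  assumes "v0 > 0" "v1 > v0"
  shows "param_fps N (\<lambda>s. coeff (monic_polar (snd s) (branch_poly v0 v1 N (fst s))) k)"
proof -
  obtain m where m: "v0 = Suc m" using assms(1) gr0_conv_Suc by blast
  have flat: "flat_monic (Suc m) (branch_poly v0 v1 N z)" for z
    using flat_monic_branch_poly[OF assms] m by simp
  have "param_fun N (\<lambda>s. fps_nth (fps_const (snd s)) i)" for i
    using param_fun_slope[of N] param_fun_const[of N 0] by (cases i) simp_all
  then have polar: "param_fps N (\<lambda>s. coeff (polar_poly (snd s) 1 (branch_poly v0 v1 N (fst s))) k)" for k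
    unfolding coeff_polar_poly
    by (intro param_fps_add param_fps_mult param_fps_const param_fps_deriv param_fps_branch_poly)
      (simp add: param_fps_def)
  have "degree (branch_poly v0 v1 N z) = Suc m" for z using flat by (simp add: flat_monic_def)
  then show ?thesis
    using param_fps_mult[OF param_fps_inverse[OF polar, of m "of_nat (Suc m)"] polar]
    by (simp add: monic_polar_def fps_nth_polar_poly_0[OF flat])
qed

section \<open>Generic constancy of the polar\<close>

lemma conv2_power_fst: "conv2 (\<lambda>(x, y). x ^ k)"
  unfolding conv2_def
proof (intro exI[of _ "\<lambda>i. if i = (k, 0) then 1 else 0"] exI[of _ "1::real"] conjI allI impI)
  fix x y :: complex
  have "((\<lambda>(m, n). (if (m, n) = (k, 0) then 1 else 0) * x ^ m * y ^ n) has_sum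
      (\<Sum>(m, n)\<in>{(k, 0)}. (if (m, n) = (k, 0) then 1 else 0) * x ^ m * y ^ n)) UNIV"
    by (rule has_sum_finite_neutralI[of "{(k, 0)}"]) (auto split: if_splits)
  then show "((\<lambda>(m, n). (if (m, n) = (k, 0) then 1 else 0) * x ^ m * y ^ n) has_sum (case (x, y) of (x, y) \<Rightarrow> x ^ k)) UNIV"
    by simp
qed simp

lemma power_in_value_semigroup: "n * k \<in> value_semigroup (bx n) Y"
proof -
  have "ord0 (\<lambda>t. (case (bx n t, Y t) of (x, y) \<Rightarrow> x ^ k)) (n * k)"
    unfolding ord0_def by (intro exI[of _ "\<lambda>_. 1"]) (auto simp: bx_def power_mult)
  then show ?thesis unfolding value_semigroup_def using conv2_power_fst by blast
qed

lemma sg_v0_pos: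
  assumes "finite (UNIV - \<Gamma>)"
  shows "sg_v0 \<Gamma> > 0"
proof -
  obtain c where "\<forall>x\<in>UNIV - \<Gamma>. x < c" using finite_nat_set_iff_bounded assms by blast
  then have "Suc c \<in> \<Gamma> \<and> Suc c > 0" by (metis DiffI UNIV_I Suc_lessD less_irrefl zero_less_Suc)
  then have "sg_v0 \<Gamma> \<in> \<Gamma> \<and> sg_v0 \<Gamma> > 0" unfolding sg_v0_def by (rule LeastI)
  then show ?thesis ..
qed

lemma sg_v0_ge_2:
  assumes "z \<in> eq_class_set \<Gamma>" "finite (UNIV - \<Gamma>)" "\<Gamma> \<noteq> UNIV"
  shows "sg_v0 \<Gamma> \<ge> 2"
proof -
  have "sg_v0 \<Gamma> \<noteq> 1"
  proof
    assume "sg_v0 \<Gamma> = 1"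
    then have "k \<in> \<Gamma>" for k
      using assms(1) power_in_value_semigroup[of 1 k "byp (sg_v1 \<Gamma>) (sg_dim \<Gamma>) z"] by (auto simp: eq_class_set_def)
    then show False using assms(3) by blast
  qed
  then show ?thesis using sg_v0_pos[OF assms(2)] by linarith
qed

lemma sg_v0_less_sg_v1:
  assumes "finite (UNIV - \<Gamma>)" "sg_v0 \<Gamma> \<ge> 2"
  shows "sg_v0 \<Gamma> < sg_v1 \<Gamma>"
proof -
  obtain c where c: "\<forall>x\<in>UNIV - \<Gamma>. x < c" using finite_nat_set_iff_bounded assms(1) by blast
  have "c \<le> sg_v0 \<Gamma> * c + 1" using assms(2) by (metis mult_le_mono1 nat_mult_1 one_le_numeral order_trans trans_le_add1)
  then have "sg_v0 \<Gamma> * c + 1 \<in> \<Gamma>" using c by (meson DiffI UNIV_I not_less)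
  moreover have "\<not> sg_v0 \<Gamma> dvd sg_v0 \<Gamma> * c + 1"
    using assms(2) dvd_add_right_iff[of "sg_v0 \<Gamma>" "sg_v0 \<Gamma> * c" 1] by simp
  ultimately have "sg_v0 \<Gamma> * c + 1 \<in> \<Gamma> \<and> \<not> sg_v0 \<Gamma> dvd sg_v0 \<Gamma> * c + 1" by simp
  then have v1: "sg_v1 \<Gamma> \<in> \<Gamma> \<and> \<not> sg_v0 \<Gamma> dvd sg_v1 \<Gamma>" unfolding sg_v1_def by (rule LeastI)
  then have "sg_v1 \<Gamma> > 0" by (metis dvd_0_right gr0I)
  then have "sg_v0 \<Gamma> \<le> sg_v1 \<Gamma>" using v1 unfolding sg_v0_def by (intro Least_le) simp
  moreover have "sg_v1 \<Gamma> \<noteq> sg_v0 \<Gamma>" using v1 by auto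
  ultimately show ?thesis by simp
qed

lemma general_dirI:
  assumes "finite D" "\<And>a b. b \<noteq> 0 \<Longrightarrow> a / b \<notin> D \<Longrightarrow> P a b"
  shows "general_dir P"
  unfolding general_dir_def
proof (intro exI[of _ "insert (1, 0) ((\<lambda>l. (l, 1)) ` D)"] conjI allI impI)
  fix a b :: complex
  assume dir: "(a, b) \<noteq> (0, 0) \<and> (\<forall>(c, d)\<in>insert (1, 0) ((\<lambda>l. (l, 1)) ` D). a * d - b * c \<noteq> 0)"
  then have b: "b \<noteq> 0" by auto
  moreover have "a / b \<notin> D"
  proof
    assume "a / b \<in> D"
    then have "a * 1 - b * (a / b) \<noteq> 0" using dir by blast
    then show False using b by simp
  qed
  ultimately show "P a b" by (rule assms(2))
qed (use assms(1) in auto)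

lemma same_general_polar_classI:
  assumes "finite {l. \<not> Q l}" "finite {l. \<not> Q' l}"
    and "\<And>a b a' b'. b \<noteq> 0 \<Longrightarrow> Q (a / b) \<Longrightarrow> b' \<noteq> 0 \<Longrightarrow> Q' (a' / b') \<Longrightarrow> top_equiv (polar f a b) (polar g a' b')"
  shows "same_general_polar_class f g"
  unfolding same_general_polar_class_def
proof (rule general_dirI[OF assms(1)], rule general_dirI[OF assms(2)])
  fix a b a' b' :: complex
  assume "b \<noteq> 0" "a / b \<notin> {l. \<not> Q l}" "b' \<noteq> 0" "a' / b' \<notin> {l. \<not> Q' l}"
  then show "top_equiv (polar f a b) (polar g a' b')" by (intro assms(3)) simp_all
qed

lemma top_equiv_polar:
  assumes P: "has_poly_expansion f P" "flat_monic (Suc m) P" and P': "has_poly_expansion g P'" "flat_monic (Suc m) P'"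
    and b: "b \<noteq> 0" "b' \<noteq> 0" and L: "L > 0" and "m > 0"
    and splits: "puiseux_splits L (monic_polar (a / b) P)" "puiseux_splits L (monic_polar (a' / b') P')"
    and contact: "\<And>Y Y'. poly_ramify L (monic_polar (a / b) P) = poly_of_roots Y \<Longrightarrow>
      poly_ramify L (monic_polar (a' / b') P') = poly_of_roots Y' \<Longrightarrow> contact_equiv 1 (set_mset Y) (set_mset Y')"
  shows "top_equiv (polar f a b) (polar g a' b')"
proof -
  obtain Y where Y: "poly_ramify L (monic_polar (a / b) P) = poly_of_roots Y" "\<forall>y\<in>#Y. fps_conv_radius y > 0"
    using splits(1) unfolding puiseux_splits_def by blast
  obtain Y' where Y': "poly_ramify L (monic_polar (a' / b') P') = poly_of_roots Y'" "\<forall>y\<in>#Y'. fps_conv_radius y > 0"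
    using splits(2) unfolding puiseux_splits_def by blast
  define w where "w = cis (2 * pi / L)"
  have w: "w ^ L = 1" using L by (simp add: w_def Complex.DeMoivre)
  have "size Y = m"
    using arg_cong[OF Y(1), of degree] degree_monic_polar[OF P(2)] L by (simp add: degree_poly_ramify)
  then have "set_mset Y \<noteq> {}" using \<open>m > 0\<close> by auto
  have "contact_equiv w (set_mset Y) (set_mset Y')"
    by (rule contact_equiv_equivariant[OF finite_set_mset contact[OF Y(1) Y'(1)]
          poly_ramify_roots_rot[OF Y(1) w L] poly_ramify_roots_rot[OF Y'(1) w L] w L])
  moreover have "fps_nth y 0 = 0" if "y \<in># Y" for y
    by (rule poly_ramify_roots_nth_0[OF Y(1) L _ _ that])
      (use degree_monic_polar[OF P(2), where l = "a / b"] lead_coeff_monic_polar[OF P(2), where l = "a / b"]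
          coeff_monic_polar_nth_0[OF P(2), where l = "a / b"] in simp_all)
  moreover have "fps_nth y 0 = 0" if "y \<in># Y'" for y
    by (rule poly_ramify_roots_nth_0[OF Y'(1) L _ _ that])
      (use degree_monic_polar[OF P'(2), where l = "a' / b'"] lead_coeff_monic_polar[OF P'(2), where l = "a' / b'"]
          coeff_monic_polar_nth_0[OF P'(2), where l = "a' / b'"] in simp_all)
  ultimately have curves: "germ_equiv (0, 0) (puiseux_curve L (set_mset Y)) (puiseux_curve L (set_mset Y'))"
    using Y(2) Y'(2) L \<open>set_mset Y \<noteq> {}\<close> unfolding w_def by (intro germ_equiv_puiseux_curve) auto
  have "germ_equiv (0, 0) {p. polar f a b p = 0} (puiseux_curve L (set_mset Y))"
    by (rule polar_germ_equiv_puiseux_curve[OF P b(1) L Y])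
  also note curves
  also have "germ_equiv (0, 0) (puiseux_curve L (set_mset Y')) {p. polar g a' b' p = 0}"
    by (rule germ_equiv_sym[OF polar_germ_equiv_puiseux_curve[OF P' b(2) L Y']])
  finally show ?thesis by (simp only: top_equiv_iff_germ_equiv)
qed

lemma generic_polar_contact_equiv:
  assumes v: "v0 > 0" "v0 < v1" and "L > 0" and Z: "zirreducible N Z"
  obtains Q where "generic_on N Z Q"
    "\<And>p q l l' Y Y'. Q (p, l) \<Longrightarrow> Q (q, l') \<Longrightarrow>
      poly_ramify L (monic_polar l (branch_poly v0 v1 N p)) = poly_of_roots Y \<Longrightarrow>
      poly_ramify L (monic_polar l' (branch_poly v0 v1 N q)) = poly_of_roots Y' \<Longrightarrow>
      contact_equiv 1 (set_mset Y) (set_mset Y')"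
proof -
  define P where "P s = monic_polar (snd s) (branch_poly v0 v1 N (fst s))" for s
  interpret monic_param_family N "v0 - 1" L P
  proof
    show "param_fps N (\<lambda>s. coeff (P s) k)" for k unfolding P_def by (rule param_fps_monic_polar[OF v])
    show "degree (P s) = v0 - 1" for s
      unfolding P_def using flat_monic_branch_poly[OF v] v(1) by (intro degree_monic_polar) simp
  qed fact
  obtain Q where Q: "generic_on N Z Q" "\<And>s s' Y Y'. Q s \<Longrightarrow> Q s' \<Longrightarrow> poly_ramify L (P s) = poly_of_roots Y \<Longrightarrow>
      poly_ramify L (P s') = poly_of_roots Y' \<Longrightarrow> contact_equiv 1 (set_mset Y) (set_mset Y')"
    by (rule generic_contact_equiv[OF Z]) (rule that)
  show ?thesis
  proof (rule that[OF Q(1)])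
    fix p q l l' Y Y'
    assume "Q (p, l)" "Q (q, l')" "poly_ramify L (monic_polar l (branch_poly v0 v1 N p)) = poly_of_roots Y"
      "poly_ramify L (monic_polar l' (branch_poly v0 v1 N q)) = poly_of_roots Y'"
    then show "contact_equiv 1 (set_mset Y) (set_mset Y')"
      using Q(2)[of "(p, l)" "(q, l')" Y Y'] by (simp add: P_def)
  qed
qed

theorem same_general_polar_class_on_zopen:
  assumes v0: "v0 \<ge> 2" and v1: "v0 < v1" and Z: "zirreducible N Z"
    and cofinite: "\<forall>z\<in>Z. finite (UNIV - value_semigroup (bx v0) (byp v1 N z))"
  shows "\<exists>U. U \<subseteq> Z \<and> zopen_in N Z U \<and> zdense_in N Z U \<and>
    (\<forall>p\<in>U. \<forall>q\<in>U. \<forall>f g. weierstrass_eq v0 (bx v0) (byp v1 N p) f \<longrightarrow>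
      weierstrass_eq v0 (bx v0) (byp v1 N q) g \<longrightarrow> same_general_polar_class f g)"
proof -
  obtain m where m: "v0 = Suc m" "m > 0" using v0 by (cases v0) auto
  define B where "B = branch_poly v0 v1 N"
  have flat: "flat_monic (Suc m) (B z)" for z
    using flat_monic_branch_poly[of v0 v1 N z] v1 m by (simp add: B_def)
  obtain L where L: "L > 0" "\<forall>G M. degree G = m \<longrightarrow> lead_coeff G = 1 \<longrightarrow> conv_coeffs G \<longrightarrow> M > 0 \<longrightarrow> L dvd M
      \<longrightarrow> puiseux_splits M G" using puiseux[of m] by (elim exE conjE)
  have expansion: "has_poly_expansion f (B z)" if "z \<in> Z" "weierstrass_eq v0 (bx v0) (byp v1 N z) f" for z f
    unfolding B_def using weierstrass_eq_has_branch_poly_expansion[of v0 v1 N z f] cofinite that m by simp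
  have splits: "puiseux_splits L (monic_polar l (B z))" if "has_poly_expansion f (B z)" for z l f
  proof -
    have "conv_coeffs (B z)" using that by (simp add: has_poly_expansion_def)
    then show ?thesis
      using L(2)[rule_format, OF degree_monic_polar[OF flat] lead_coeff_monic_polar[OF flat]
          conv_coeffs_monic_polar[OF flat] L(1)] by simp
  qed
  obtain Q where Q: "generic_on N Z Q"
    "\<And>p q l l' Y Y'. Q (p, l) \<Longrightarrow> Q (q, l') \<Longrightarrow> poly_ramify L (monic_polar l (B p)) = poly_of_roots Y \<Longrightarrow>
      poly_ramify L (monic_polar l' (B q)) = poly_of_roots Y' \<Longrightarrow> contact_equiv 1 (set_mset Y) (set_mset Y')"
    by (rule generic_polar_contact_equiv[OF _ v1 L(1) Z, folded B_def]) (use m that in auto)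
  obtain F where F: "zclosed N F" "\<not> Z \<subseteq> F" "\<And>z. z \<in> Z - F \<Longrightarrow> finite {l. \<not> Q (z, l)}"
    using Q(1) unfolding generic_on_def by blast
  have "same_general_polar_class f g"
    if pq: "p \<in> Z - F" "q \<in> Z - F"
      and "weierstrass_eq v0 (bx v0) (byp v1 N p) f" "weierstrass_eq v0 (bx v0) (byp v1 N q) g" for p q f g
  proof (rule same_general_polar_classI[OF F(3)[OF pq(1)] F(3)[OF pq(2)]])
    have f: "has_poly_expansion f (B p)" and g: "has_poly_expansion g (B q)" using expansion that by auto
    fix a b a' b' :: complex assume "b \<noteq> 0" "Q (p, a / b)" "b' \<noteq> 0" "Q (q, a' / b')"
    then show "top_equiv (polar f a b) (polar g a' b')"
      using Q(2)[of p "a / b" q "a' / b'"] splits[OF f] splits[OF g] m(2) L(1)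
      by (intro top_equiv_polar[OF f flat g flat, where L = L]) simp_all
  qed
  then show ?thesis using zopen_zdense_Diff[OF Z F(1,2)] by (intro exI[of _ "Z - F"]) auto
qed

theorem mainTheorem1:
  fixes \<Gamma> \<Lambda> :: "nat set" and Z :: "(nat \<Rightarrow> complex) set"
  assumes branch: "\<exists>X Y. is_branch_param X Y \<and> value_semigroup X Y = \<Gamma>"
    and cofinite: "finite (UNIV - \<Gamma>)"
    and singular: "\<Gamma> \<noteq> UNIV"
    and comp: "zirreducible_component (sg_dim \<Gamma>) (eq_class_set_kahler \<Gamma> \<Lambda>) Z"
  shows "\<exists>U. U \<subseteq> Z \<and> zopen_in (sg_dim \<Gamma>) Z U \<and> zdense_in (sg_dim \<Gamma>) Z U \<and>
     (\<forall>p\<in>U. \<forall>q\<in>U. \<forall>f g.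
        weierstrass_eq (sg_v0 \<Gamma>) (bx (sg_v0 \<Gamma>)) (byp (sg_v1 \<Gamma>) (sg_dim \<Gamma>) p) f \<longrightarrow>
        weierstrass_eq (sg_v0 \<Gamma>) (bx (sg_v0 \<Gamma>)) (byp (sg_v1 \<Gamma>) (sg_dim \<Gamma>) q) g \<longrightarrow>
        same_general_polar_class f g)"
proof -
  have Z: "zirreducible (sg_dim \<Gamma>) Z" and Z_sub: "Z \<subseteq> eq_class_set \<Gamma>"
    using comp by (auto simp: zirreducible_component_def eq_class_set_kahler_def)
  then obtain z where "z \<in> eq_class_set \<Gamma>" by (auto simp: zirreducible_def)
  then have v0: "sg_v0 \<Gamma> \<ge> 2" using sg_v0_ge_2 cofinite singular by blast
  have v1: "sg_v0 \<Gamma> < sg_v1 \<Gamma>" using sg_v0_less_sg_v1[OF cofinite v0] .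
  have "\<forall>z\<in>Z. finite (UNIV - value_semigroup (bx (sg_v0 \<Gamma>)) (byp (sg_v1 \<Gamma>) (sg_dim \<Gamma>) z))"
    using Z_sub cofinite by (auto simp: eq_class_set_def)
  with v0 v1 Z show ?thesis by (rule same_general_polar_class_on_zopen)
qed

end
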